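(* Let $\varepsilon\in\{+1,-1\}$, let $m>2$ and $k$ be integers, and let $\mathcal{M}=(M,g)$ be a harmonic space whose density function satisfies $\Theta_{\mathcal{M}}=\Theta_\varepsilon(m,k)$, where $\Theta_{+}(m,k)(r)=\sin(r)^{m-1}\cos(r)^k$ and $\Theta_{-}(m,k)(r)=\sinh(r)^{m-1}\cosh(r)^k$. Let $\lambda$ be an eigenvalue of the reduced Jacobi operator $\tilde{\mathcal{J}}_{\mathcal{M}}(\xi)$ for some unit tangent vector $\xi$ of $\mathcal{M}$. Then $$\frac{m+3k-1}{m-1}-\mathcal{E}(m,k)\le\varepsilon\lambda\le\frac{m+3k-1}{m-1}+\mathcal{E}(m,k),\qquad \mathcal{E}(m,k):=\frac{3m-6}{m-1}\sqrt{\frac{k(m-1-k)}{m-2}}.$$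
   Context: Let $\mathcal{M}=(M,g)$ be a (smooth) Riemannian manifold with Riemannian measure $\operatorname{dvol}_{\mathcal{M}}$. For $P\in M$ write $\xi\in T_PM$ in polar coordinates $\xi=r\theta$, $r=\|\xi\|>0$, $\|\theta\|=1$. The density $\Theta_{\mathcal{M}}(P;\xi)$ is defined for small $\xi\neq0$ by $\exp_P^*\operatorname{dvol}_{\mathcal{M}}=\Theta_{\mathcal{M}}(P;\xi)\,dr\,d\theta$, where $d\theta$ is the standard measure on the unit sphere of $T_PM$; equivalently $\Theta_{\mathcal{M}}(P;\xi)=r^{\dim(M)-1}\sqrt{\det(g_{ij}(\xi))}$ in geodesic normal coordinates at $P$. $\mathcal{M}$ is a harmonic space if $\Theta_{\mathcal{M}}(P;\xi)$ depends only on $\|\xi\|$, in which case one writes $\Theta_{\mathcal{M}}(r)$, $r=\|\xi\|$. The equality $\Theta_{\mathcal{M}}=\Theta_\varepsilon(m,k)$ is as functions of $r$ for small $r>0$ (and it forces $\dim M=m$ and $0\le k\le m-1$). No completeness is assumed. Subscripts $\varepsilon=\pm$ are identified with the signs $\pm1$. With $R(\xi,\eta)=\nabla_\xi\nabla_\eta-\nabla_\eta\nabla_\xi-\nabla_{[\xi,\eta]}$, the Jacobi operator is the self-adjoint operator $\mathcal{J}_{\mathcal{M}}(\xi)\eta=R(\eta,\xi)\xi$; it preserves $\xi^\perp$, and the reduced Jacobi operator $\tilde{\mathcal{J}}_{\mathcal{M}}(\xi)$ is its restriction to $\xi^\perp$. *)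

theory Defs
  imports "HOL-Analysis.Analysis"
begin

subsection \<open>Smooth maps between open subsets of Euclidean spaces\<close>

fun Ck_on :: "nat \<Rightarrow> 'a::euclidean_space set \<Rightarrow> ('a \<Rightarrow> 'b::real_normed_vector) \<Rightarrow> bool" where
  "Ck_on 0 S f \<longleftrightarrow> continuous_on S f"
| "Ck_on (Suc k) S f \<longleftrightarrow>
     (\<forall>x\<in>S. f differentiable (at x)) \<and> (\<forall>v. Ck_on k S (\<lambda>x. frechet_derivative f (at x) v))"

text \<open>Only used for open \<open>S\<close>.\<close>

definition smooth_on :: "'a::euclidean_space set \<Rightarrow> ('a \<Rightarrow> 'b::real_normed_vector) \<Rightarrow> bool" where
  "smooth_on S f \<longleftrightarrow> (\<forall>k. Ck_on k S f)"

definition jacobian :: "(real^'n \<Rightarrow> real^'n) \<Rightarrow> real^'n \<Rightarrow> real^'n^'n" where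
  "jacobian f x = matrix (frechet_derivative f (at x))"

subsection \<open>Smooth manifolds with a Riemannian metric\<close>

record ('a, 'n::finite) chart =
  chart_dom :: "'a set"
  chart_map :: "'a \<Rightarrow> real^'n"

definition chart_im :: "('a, 'n::finite) chart \<Rightarrow> (real^'n) set" where
  "chart_im c = chart_map c ` chart_dom c"

definition chart_inv :: "('a, 'n::finite) chart \<Rightarrow> real^'n \<Rightarrow> 'a" where
  "chart_inv c = inv_into (chart_dom c) (chart_map c)"

definition is_chart :: "'a topology \<Rightarrow> ('a, 'n::finite) chart \<Rightarrow> bool" where
  "is_chart X c \<longleftrightarrow> openin X (chart_dom c) \<and> open (chart_im c) \<and>
     homeomorphic_map (subtopology X (chart_dom c)) (top_of_set (chart_im c)) (chart_map c)"

definition transition :: "('a, 'n::finite) chart \<Rightarrow> ('a, 'n) chart \<Rightarrow> real^'n \<Rightarrow> real^'n" where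
  "transition c d = chart_map d \<circ> chart_inv c"

definition compatible :: "('a, 'n::finite) chart \<Rightarrow> ('a, 'n) chart \<Rightarrow> bool" where
  "compatible c d \<longleftrightarrow>
     smooth_on (chart_map c ` (chart_dom c \<inter> chart_dom d)) (transition c d) \<and>
     smooth_on (chart_map d ` (chart_dom c \<inter> chart_dom d)) (transition d c)"

text \<open>\<open>metric M c x\<close> is the matrix \<open>(g\<^sub>i\<^sub>j(x))\<close> of the metric in the chart \<open>c\<close>, as a function of
  the coordinates \<open>x\<close>.\<close>

record ('a, 'n::finite) riemannian =
  space_top :: "'a topology"
  atlas :: "('a, 'n) chart set"
  metric :: "('a, 'n) chart \<Rightarrow> real^'n \<Rightarrow> real^'n^'n"

definition smooth_manifold :: "'a topology \<Rightarrow> ('a, 'n::finite) chart set \<Rightarrow> bool" where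
  "smooth_manifold X A \<longleftrightarrow>
     Hausdorff_space X \<and> second_countable X \<and>
     (\<forall>c\<in>A. is_chart X c) \<and> (\<Union>c\<in>A. chart_dom c) = topspace X \<and>
     (\<forall>c\<in>A. \<forall>d\<in>A. compatible c d)"

definition riemannian_manifold :: "('a, 'n::finite) riemannian \<Rightarrow> bool" where
  "riemannian_manifold M \<longleftrightarrow>
     smooth_manifold (space_top M) (atlas M) \<and>
     (\<forall>c\<in>atlas M. smooth_on (chart_im c) (metric M c)) \<and>
     (\<forall>c\<in>atlas M. \<forall>x\<in>chart_im c. transpose (metric M c x) = metric M c x \<and>
        (\<forall>v. v \<noteq> 0 \<longrightarrow> v \<bullet> (metric M c x *v v) > 0)) \<and>
     (\<forall>c\<in>atlas M. \<forall>d\<in>atlas M. \<forall>p\<in>chart_dom c \<inter> chart_dom d.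
        metric M c (chart_map c p) =
          transpose (jacobian (transition c d) (chart_map c p)) **
          metric M d (chart_map d p) ** jacobian (transition c d) (chart_map c p))"

definition smooth_chart :: "('a, 'n::finite) riemannian \<Rightarrow> ('a, 'n) chart \<Rightarrow> bool" where
  "smooth_chart M c \<longleftrightarrow> is_chart (space_top M) c \<and> (\<forall>d\<in>atlas M. compatible c d)"

text \<open>A tangent vector at \<open>p\<close> is represented by its components, an element of \<open>real^'n\<close>, in the
  chart \<open>chart_at M p\<close> chosen once and for all at \<open>p\<close>.\<close>

definition chart_at :: "('a, 'n::finite) riemannian \<Rightarrow> 'a \<Rightarrow> ('a, 'n) chart" where
  "chart_at M p = (SOME c. c \<in> atlas M \<and> p \<in> chart_dom c)"

definition inner_at :: "('a, 'n::finite) riemannian \<Rightarrow> 'a \<Rightarrow> real^'n \<Rightarrow> real^'n \<Rightarrow> real" where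
  "inner_at M p u v = u \<bullet> (metric M (chart_at M p) (chart_map (chart_at M p) p) *v v)"

definition norm_at :: "('a, 'n::finite) riemannian \<Rightarrow> 'a \<Rightarrow> real^'n \<Rightarrow> real" where
  "norm_at M p u = sqrt (inner_at M p u u)"

text \<open>The matrix of the metric in an arbitrary chart compatible with the atlas, at the
  coordinates \<open>x\<close>.\<close>

definition metric_in :: "('a, 'n::finite) riemannian \<Rightarrow> ('a, 'n) chart \<Rightarrow> real^'n \<Rightarrow> real^'n^'n" where
  "metric_in M c x =
     (let q = chart_inv c x; d = chart_at M q; J = jacobian (transition c d) x
      in transpose J ** metric M d (chart_map d q) ** J)"

subsection \<open>Levi-Civita connection and curvature in coordinates\<close>

text \<open>\<open>G\<close> is a matrix-valued function of the coordinates; vector fields are functions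
  \<open>real^'n \<Rightarrow> real^'n\<close>.\<close>

definition metric_partial :: "(real^'n \<Rightarrow> real^'n^'n) \<Rightarrow> real^'n \<Rightarrow> 'n \<Rightarrow> 'n \<Rightarrow> 'n \<Rightarrow> real" where
  "metric_partial G x i j l = frechet_derivative G (at x) (axis i 1) $ j $ l"

definition christoffel :: "(real^'n \<Rightarrow> real^'n^'n) \<Rightarrow> real^'n \<Rightarrow> 'n \<Rightarrow> 'n \<Rightarrow> 'n \<Rightarrow> real" where
  "christoffel G x k i j =
     (1/2) * (\<Sum>l\<in>UNIV. matrix_inv (G x) $ k $ l *
       (metric_partial G x i j l + metric_partial G x j i l - metric_partial G x l i j))"

definition christoffel_vec :: "(real^'n \<Rightarrow> real^'n^'n) \<Rightarrow> real^'n \<Rightarrow> real^'n \<Rightarrow> real^'n \<Rightarrow> real^'n" where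
  "christoffel_vec G x u v = (\<chi> k. \<Sum>i\<in>UNIV. \<Sum>j\<in>UNIV. christoffel G x k i j * u $ i * v $ j)"

definition nabla ::
  "(real^'n \<Rightarrow> real^'n^'n) \<Rightarrow> (real^'n \<Rightarrow> real^'n) \<Rightarrow> (real^'n \<Rightarrow> real^'n) \<Rightarrow> real^'n \<Rightarrow> real^'n" where
  "nabla G X Y x = frechet_derivative Y (at x) (X x) + christoffel_vec G x (X x) (Y x)"

definition lie_bracket ::
  "(real^'n \<Rightarrow> real^'n) \<Rightarrow> (real^'n \<Rightarrow> real^'n) \<Rightarrow> real^'n \<Rightarrow> real^'n" where
  "lie_bracket X Y x = frechet_derivative Y (at x) (X x) - frechet_derivative X (at x) (Y x)"

definition curvature_field ::
  "(real^'n \<Rightarrow> real^'n^'n) \<Rightarrow> (real^'n \<Rightarrow> real^'n) \<Rightarrow> (real^'n \<Rightarrow> real^'n) \<Rightarrow> (real^'n \<Rightarrow> real^'n)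
     \<Rightarrow> real^'n \<Rightarrow> real^'n" where
  "curvature_field G X Y Z x =
     nabla G X (nabla G Y Z) x - nabla G Y (nabla G X Z) x - nabla G (lie_bracket X Y) Z x"

text \<open>\<open>R\<close> is a tensor, so its value on tangent vectors at \<open>p\<close> may be computed with the extensions
  having constant components.\<close>

definition curvature_at ::
  "('a, 'n::finite) riemannian \<Rightarrow> 'a \<Rightarrow> real^'n \<Rightarrow> real^'n \<Rightarrow> real^'n \<Rightarrow> real^'n" where
  "curvature_at M p u v w =
     curvature_field (metric M (chart_at M p)) (\<lambda>_. u) (\<lambda>_. v) (\<lambda>_. w) (chart_map (chart_at M p) p)"

definition jacobi_op :: "('a, 'n::finite) riemannian \<Rightarrow> 'a \<Rightarrow> real^'n \<Rightarrow> real^'n \<Rightarrow> real^'n" where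
  "jacobi_op M p \<xi> \<eta> = curvature_at M p \<eta> \<xi> \<xi>"

definition reduced_jacobi_eigenvalue ::
  "('a, 'n::finite) riemannian \<Rightarrow> 'a \<Rightarrow> real^'n \<Rightarrow> real \<Rightarrow> bool" where
  "reduced_jacobi_eigenvalue M p \<xi> \<mu> \<longleftrightarrow>
     (\<exists>\<eta>. \<eta> \<noteq> 0 \<and> inner_at M p \<xi> \<eta> = 0 \<and> jacobi_op M p \<xi> \<eta> = \<mu> *\<^sub>R \<eta>)"

subsection \<open>Geodesics, exponential map and normal coordinates\<close>

definition geodesic_on :: "('a, 'n::finite) riemannian \<Rightarrow> (real \<Rightarrow> 'a) \<Rightarrow> real set \<Rightarrow> bool" where
  "geodesic_on M \<gamma> I \<longleftrightarrow>
     continuous_map (top_of_set I) (space_top M) \<gamma> \<and>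
     (\<forall>c\<in>atlas M. \<exists>v. \<forall>t\<in>I. \<gamma> t \<in> chart_dom c \<longrightarrow>
        ((chart_map c \<circ> \<gamma>) has_vector_derivative v t) (at t) \<and>
        (v has_vector_derivative
           - christoffel_vec (metric M c) (chart_map c (\<gamma> t)) (v t) (v t)) (at t))"

definition exp_rel :: "('a, 'n::finite) riemannian \<Rightarrow> 'a \<Rightarrow> real^'n \<Rightarrow> 'a \<Rightarrow> bool" where
  "exp_rel M p \<xi> q \<longleftrightarrow>
     (\<exists>\<gamma> a b. a < 0 \<and> 1 < b \<and> geodesic_on M \<gamma> {a<..<b} \<and> \<gamma> 0 = p \<and>
        ((chart_map (chart_at M p) \<circ> \<gamma>) has_vector_derivative \<xi>) (at 0) \<and> \<gamma> 1 = q)"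

definition exp_map :: "('a, 'n::finite) riemannian \<Rightarrow> 'a \<Rightarrow> real^'n \<Rightarrow> 'a" where
  "exp_map M p \<xi> = (THE q. exp_rel M p \<xi> q)"

text \<open>The columns of \<open>L\<close> are an orthonormal basis of the tangent space at \<open>p\<close>.\<close>

definition orthonormal_frame :: "('a, 'n::finite) riemannian \<Rightarrow> 'a \<Rightarrow> real^'n^'n \<Rightarrow> bool" where
  "orthonormal_frame M p L \<longleftrightarrow>
     (\<forall>i j. inner_at M p (column i L) (column j L) = (if i = j then 1 else 0))"

definition normal_chart ::
  "('a, 'n::finite) riemannian \<Rightarrow> 'a \<Rightarrow> real^'n^'n \<Rightarrow> real \<Rightarrow> ('a, 'n) chart" where
  "normal_chart M p L \<delta> =
     \<lparr>chart_dom = (\<lambda>x. exp_map M p (L *v x)) ` ball 0 \<delta>,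
      chart_map = inv_into (ball 0 \<delta>) (\<lambda>x. exp_map M p (L *v x))\<rparr>"

text \<open>\<open>exp\<^sub>p\<close> is defined on the ball of radius \<open>\<delta>\<close> and maps it diffeomorphically onto an open set.\<close>

definition normal_coordinates ::
  "('a, 'n::finite) riemannian \<Rightarrow> 'a \<Rightarrow> real^'n^'n \<Rightarrow> real \<Rightarrow> bool" where
  "normal_coordinates M p L \<delta> \<longleftrightarrow>
     orthonormal_frame M p L \<and>
     (\<forall>x\<in>ball 0 \<delta>. \<exists>q. exp_rel M p (L *v x) q) \<and>
     inj_on (\<lambda>x. exp_map M p (L *v x)) (ball 0 \<delta>) \<and>
     smooth_chart M (normal_chart M p L \<delta>)"

subsection \<open>Density function and harmonic spaces\<close>

text \<open>\<open>\<Theta>(p;\<xi>)\<close> is a partial function of \<open>\<xi>\<close>, hence a relation: \<open>has_density M p \<xi> d\<close> says that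
  \<open>\<xi>\<close> lies in a ball carrying geodesic normal coordinates and
  \<open>d = r\<^sup>n\<^sup>-\<^sup>1 (det g\<^sub>i\<^sub>j(\<xi>))\<^sup>1\<^sup>/\<^sup>2\<close> in these.\<close>

definition has_density ::
  "('a, 'n::finite) riemannian \<Rightarrow> 'a \<Rightarrow> real^'n \<Rightarrow> real \<Rightarrow> bool" where
  "has_density M p \<xi> d \<longleftrightarrow>
     (\<exists>L \<delta>. normal_coordinates M p L \<delta> \<and>
        (\<exists>x\<in>ball 0 \<delta>. \<xi> = L *v x \<and>
           d = norm_at M p \<xi> ^ (CARD('n) - 1) * sqrt (det (metric_in M (normal_chart M p L \<delta>) x))))"

definition harmonic_with_density ::
  "('a, 'n::finite) riemannian \<Rightarrow> (real \<Rightarrow> real) \<Rightarrow> bool" where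
  "harmonic_with_density M f \<longleftrightarrow>
     (\<forall>p\<in>topspace (space_top M). \<exists>\<delta>>0. \<forall>\<xi>.
        0 < norm_at M p \<xi> \<and> norm_at M p \<xi> < \<delta> \<longrightarrow> has_density M p \<xi> (f (norm_at M p \<xi>)))"

definition model_density :: "int \<Rightarrow> int \<Rightarrow> int \<Rightarrow> real \<Rightarrow> real" where
  "model_density \<epsilon> m k r =
     (if \<epsilon> = 1 then sin r powi (m - 1) * cos r powi k
      else sinh r powi (m - 1) * cosh r powi k)"

definition error_term :: "int \<Rightarrow> int \<Rightarrow> real" where
  "error_term m k = (3 * of_int m - 6) / (of_int m - 1) *
     sqrt (of_int k * (of_int m - 1 - of_int k) / (of_int m - 2))"

end

theory Submission
  imports Defs "HOL-Real_Asymp.Real_Asymp"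
begin

text \<open>
  Along a unit speed geodesic \<open>t \<mapsto> exp\<^sub>p(t u)\<close> let \<open>W\<close> be the matrix of Jacobi fields vanishing at \<open>p\<close> and
  \<open>V = (\<nabla>W) W\<^sup>-\<^sup>1 - 1 / t\<close>. The Jacobi equation becomes the Riccati equation
  \<open>t (\<nabla>V + V\<^sup>2 + R) + 2 V = 0\<close>, where \<open>R\<close> is the Jacobi operator of the velocity, and \<open>tr V\<close> is the
  logarithmic derivative of the normalized density, an explicit function \<open>h\<close> of \<open>t\<close>. Hence
  \<open>tr V\<^sup>2 + tr R = - (h' + 2 h / t)\<close>. Letting \<open>t\<close> tend to \<open>0\<close> gives
  \<open>tr R = \<epsilon> (m - 1 + 3 k)\<close> at every point for every unit vector, hence along the whole geodesic.
  As \<open>V / t\<close> tends to \<open>- R / 3\<close>, the next order then gives \<open>tr R\<^sup>2 = m - 1 + 15 k\<close>. Since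
  \<open>R\<close> is self-adjoint and annihilates the velocity, the bound on an eigenvalue follows from these two
  traces by the Cauchy-Schwarz inequality.
\<close>


subsection \<open>Directional derivatives\<close>

abbreviation directional_derivative ::
  "'a::real_normed_vector \<Rightarrow> ('a \<Rightarrow> 'b::real_normed_vector) \<Rightarrow> 'a \<Rightarrow> 'b" ("\<partial>")
  where "\<partial> v f x \<equiv> frechet_derivative f (at x) v"

lemma directional_derivative_eqI: "(f has_derivative f') (at x) \<Longrightarrow> \<partial> v f x = f' v"
  by (metis frechet_derivative_at)

lemma directional_derivative_cong:
  assumes "open S" "x \<in> S" "\<And>y. y \<in> S \<Longrightarrow> f y = g y"
  shows "\<partial> v f x = \<partial> v g x"
proof -
  have "(f has_derivative D) (at x) \<longleftrightarrow> (g has_derivative D) (at x)" for D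
    using assms has_derivative_transform_within_open by metis
  then show ?thesis by (simp add: frechet_derivative_def)
qed

lemma directional_derivative_scaleR: "f differentiable (at x) \<Longrightarrow> \<partial> (r *\<^sub>R v) f x = r *\<^sub>R \<partial> v f x"
  by (rule linear_cmul[OF linear_frechet_derivative])

lemma directional_derivative_bounded_linear: "bounded_linear h \<Longrightarrow> \<partial> v h x = h v"
  by (intro directional_derivative_eqI bounded_linear_imp_has_derivative)

lemma directional_derivative_linear_compose:
  assumes "bounded_linear h" "f differentiable (at x)"
  shows "\<partial> v (\<lambda>y. h (f y)) x = h (\<partial> v f x)"
  using bounded_linear.has_derivative[OF assms(1)] assms(2)
  by (intro directional_derivative_eqI) (simp add: frechet_derivative_works)

lemma directional_derivative_add:
  assumes "f differentiable (at x)" "g differentiable (at x)"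
  shows "\<partial> v (\<lambda>x. f x + g x) x = \<partial> v f x + \<partial> v g x"
  using assms by (intro directional_derivative_eqI has_derivative_add)
      (simp_all add: frechet_derivative_works)

lemma directional_derivative_diff:
  assumes "f differentiable (at x)" "g differentiable (at x)"
  shows "\<partial> v (\<lambda>x. f x - g x) x = \<partial> v f x - \<partial> v g x"
  using assms by (intro directional_derivative_eqI has_derivative_diff)
      (simp_all add: frechet_derivative_works)

lemma directional_derivative_bilinear:
  assumes "bounded_bilinear b" "f differentiable (at x)" "g differentiable (at x)"
  shows "\<partial> v (\<lambda>x. b (f x) (g x)) x = b (f x) (\<partial> v g x) + b (\<partial> v f x) (g x)"
  using assms(2,3) by (intro directional_derivative_eqI bounded_bilinear.FDERIV[OF assms(1)])
    (simp_all add: frechet_derivative_works)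

lemma directional_derivative_chain:
  assumes "(f has_derivative f') (at x)" "g differentiable (at (f x))"
  shows "\<partial> v (\<lambda>x. g (f x)) x = \<partial> (f' v) g (f x)"
  using diff_chain_at[OF assms(1)] assms(2)
  by (intro directional_derivative_eqI) (simp add: o_def frechet_derivative_works)

lemma directional_derivative_compose:
  assumes "f differentiable (at x)" "g differentiable (at (f x))"
  shows "\<partial> v (\<lambda>x. g (f x)) x = \<partial> (\<partial> v f x) g (f x)"
  using directional_derivative_chain assms by (simp add: frechet_derivative_works)

lemma has_vector_derivative_compose:
  assumes "(c has_vector_derivative c') (at t)" "f differentiable (at (c t))"
  shows "((\<lambda>s. f (c s)) has_vector_derivative \<partial> c' f (c t)) (at t)"
proof -
  have "((f \<circ> c) has_derivative (frechet_derivative f (at (c t)) \<circ> (\<lambda>h. h *\<^sub>R c'))) (at t)"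
    using assms by (intro diff_chain_at) (auto simp: has_vector_derivative_def frechet_derivative_works)
  then show ?thesis
    by (simp add: has_vector_derivative_def o_def linear_cmul[OF linear_frechet_derivative[OF assms(2)]])
qed

lemma has_vector_derivative_transform_eventually:
  assumes "(f has_vector_derivative f') (at t)" "\<forall>\<^sub>F s in nhds t. f s = g s"
  shows "(g has_vector_derivative f') (at t)"
  using has_vector_derivative_cong_ev[of UNIV f g t f'] assms eventually_nhds_x_imp_x by auto

lemma has_vector_derivative_affine: "((\<lambda>s. a + s *\<^sub>R u) has_vector_derivative u) (at t)"
  by (auto simp: has_vector_derivative_def intro!: derivative_eq_intros)

lemma has_vector_derivative_rescale:
  assumes "(f has_vector_derivative f') (at (r * t))"
  shows "((\<lambda>s. f (r * s)) has_vector_derivative r *\<^sub>R f') (at t)"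
proof -
  have "((\<lambda>s. r * s) has_vector_derivative r) (at t)"
    by (auto simp: has_vector_derivative_def intro!: derivative_eq_intros)
  from vector_diff_chain_at[OF this assms] show ?thesis by (simp add: o_def)
qed

lemma has_vector_derivative_quotient:
  assumes "(f has_vector_derivative f') (at t)"
  shows "((\<lambda>h. (f (t + h) - f t) /\<^sub>R h) \<longlongrightarrow> f') (at 0)"
proof -
  have "((\<lambda>h. norm (f (t + h) - f t - h *\<^sub>R f') / \<bar>h\<bar>) \<longlongrightarrow> 0) (at 0)"
    using assms by (simp add: has_vector_derivative_def has_derivative_at)
  then have "((\<lambda>h. norm ((f (t + h) - f t) /\<^sub>R h - f')) \<longlongrightarrow> 0) (at 0)"
  proof (rule Lim_transform_eventually)
    have "norm (f (t + h) - f t - h *\<^sub>R f') / \<bar>h\<bar> = norm ((f (t + h) - f t) /\<^sub>R h - f')" if "h \<noteq> 0" for h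
    proof -
      have "(f (t + h) - f t) /\<^sub>R h - f' = (f (t + h) - f t - h *\<^sub>R f') /\<^sub>R h"
        using that by (simp add: scaleR_diff_right)
      then show ?thesis by (simp add: divide_inverse_commute)
    qed
    then show "\<forall>\<^sub>F h in at 0. norm (f (t + h) - f t - h *\<^sub>R f') / \<bar>h\<bar> = norm ((f (t + h) - f t) /\<^sub>R h - f')"
      by (simp add: eventually_at_filter)
  qed
  then show ?thesis by (subst Lim_null) (simp add: tendsto_norm_zero_iff)
qed

lemma eventually_has_vector_derivative_in_open:
  assumes "(c has_vector_derivative c') (at t)" "open S" "c t \<in> S"
  shows "\<forall>\<^sub>F s in nhds t. c s \<in> S"
  using has_vector_derivative_continuous[OF assms(1)] assms(2,3)
  by (auto simp: continuous_within tendsto_at_iff_tendsto_nhds dest: topological_tendstoD)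

subsection \<open>Smooth maps\<close>

lemma Ck_on_cong:
  assumes "open S" "\<And>x. x \<in> S \<Longrightarrow> f x = g x" "Ck_on k S f"
  shows "Ck_on k S g"
  using assms(2,3)
proof (induction k arbitrary: f g)
  case 0
  then show ?case by (simp cong: continuous_on_cong)
next
  case (Suc k)
  have "\<partial> v f x = \<partial> v g x" if "x \<in> S" for v x
    using directional_derivative_cong[OF assms(1) that] Suc.prems(1) .
  moreover have "g differentiable (at x)" if "x \<in> S" for x
    using Suc.prems that assms(1)
    by (metis Ck_on.simps(2) differentiable_def has_derivative_transform_within_open)
  moreover have "Ck_on k S (\<partial> v g)" for v
    using Suc.IH[of "\<partial> v f" "\<partial> v g"] Suc.prems(2) calculation(1) by simp
  ultimately show ?case by simp
qed

lemma Ck_on_subset: "Ck_on k S f \<Longrightarrow> T \<subseteq> S \<Longrightarrow> Ck_on k T f"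
  by (induction k arbitrary: f) (auto intro: continuous_on_subset)

lemma Ck_on_SucD: "Ck_on (Suc k) S f \<Longrightarrow> Ck_on k S f"
proof (induction k arbitrary: f)
  case 0
  then show ?case
    by (auto intro!: differentiable_imp_continuous_on differentiable_at_imp_differentiable_on)
next
  case (Suc k)
  then show ?case by auto
qed

lemma Ck_on_has_derivative:
  "Ck_on (Suc k) S f \<Longrightarrow> x \<in> S \<Longrightarrow> (f has_derivative frechet_derivative f (at x)) (at x)"
  using frechet_derivative_works by auto

lemma Ck_on_SucI:
  assumes "open S" "\<And>x. x \<in> S \<Longrightarrow> (f has_derivative f' x) (at x)" "\<And>v. Ck_on k S (\<lambda>x. f' x v)"
  shows "Ck_on (Suc k) S f"
proof -
  have "Ck_on k S (\<partial> v f)" for v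
    by (rule Ck_on_cong[OF assms(1) _ assms(3)[of v]]) (metis assms(2) directional_derivative_eqI)
  then show ?thesis using assms(2) by (auto simp: differentiable_def)
qed

lemma Ck_on_const: "Ck_on k S (\<lambda>x. c)"
  by (induction k arbitrary: c) auto

lemma Ck_on_linear:
  assumes "open S" "bounded_linear f"
  shows "Ck_on k S f"
proof (cases k)
  case 0
  then show ?thesis using assms(2) by (auto simp: linear_continuous_on)
next
  case (Suc j)
  then show ?thesis
    using Ck_on_SucI[of S f "\<lambda>x. f" j] assms by (auto intro: bounded_linear_imp_has_derivative Ck_on_const)
qed

lemma Ck_on_linear_compose:
  assumes "open S" "bounded_linear h" "Ck_on k S f"
  shows "Ck_on k S (\<lambda>x. h (f x))"
  using assms(3)
proof (induction k arbitrary: f)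
  case 0
  then show ?case using assms(2) by (auto simp: bounded_linear.continuous_on)
next
  case (Suc k)
  note h_deriv = bounded_linear.has_derivative[OF assms(2) Ck_on_has_derivative[OF Suc.prems]]
  show ?case by (rule Ck_on_SucI[OF assms(1) h_deriv]) (use Suc in auto)
qed

lemma Ck_on_add:
  assumes "open S" "Ck_on k S f" "Ck_on k S g"
  shows "Ck_on k S (\<lambda>x. f x + g x)"
  using assms(2,3)
proof (induction k arbitrary: f g)
  case 0
  then show ?case by (auto intro: continuous_intros)
next
  case (Suc k)
  note add_deriv = has_derivative_add[OF Suc.prems[THEN Ck_on_has_derivative]]
  show ?case by (rule Ck_on_SucI[OF assms(1) add_deriv]) (use Suc in auto)
qed

lemma Ck_on_bilinear:
  assumes "bounded_bilinear b" "open S" "Ck_on k S f" "Ck_on k S g"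
  shows "Ck_on k S (\<lambda>x. b (f x) (g x))"
  using assms(3,4)
proof (induction k arbitrary: f g)
  case 0
  then show ?case using assms(1) by (auto intro: bounded_bilinear.continuous_on)
next
  case (Suc k)
  note product_deriv = bounded_bilinear.FDERIV[OF assms(1) Suc.prems[THEN Ck_on_has_derivative]]
  have "Ck_on k S f" "Ck_on k S g" by (fact Suc.prems[THEN Ck_on_SucD])+
  with Suc show ?case
    by (intro Ck_on_SucI[OF assms(2) product_deriv] Ck_on_add assms(2) Suc.IH) auto
qed

lemma Ck_on_sum:
  assumes "open S" "\<And>i. i \<in> I \<Longrightarrow> Ck_on k S (f i)"
  shows "Ck_on k S (\<lambda>x. \<Sum>i\<in>I. f i x)"
  using assms(2)
  by (induction I rule: infinite_finite_induct) (auto intro: Ck_on_const Ck_on_add assms(1))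

lemma Ck_on_inverse:
  fixes f :: "'a::euclidean_space \<Rightarrow> real"
  assumes "open S" "Ck_on k S f" "\<And>x. x \<in> S \<Longrightarrow> f x \<noteq> 0"
  shows "Ck_on k S (\<lambda>x. inverse (f x))"
  using assms(2)
proof (induction k)
  case 0
  then show ?case using assms(3) by (auto intro: continuous_intros)
next
  case (Suc k)
  note inverse_deriv = Deriv.has_derivative_inverse[OF assms(3) Ck_on_has_derivative[OF Suc.prems]]
  have "Ck_on k S (\<lambda>x. inverse (f x))"
    using Suc.IH[OF Ck_on_SucD[OF Suc.prems]] .
  then show ?case
    using Suc.prems
    by (intro Ck_on_SucI[OF assms(1) inverse_deriv] Ck_on_bilinear[OF bounded_bilinear_mult] assms(1)
        Ck_on_linear_compose[OF assms(1) bounded_linear_minus[OF bounded_linear_ident]]) auto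
qed

lemma linear_sum_Basis:
  fixes f :: "'a::euclidean_space \<Rightarrow> 'b::real_vector"
  assumes "linear f"
  shows "f v = (\<Sum>b\<in>Basis. (v \<bullet> b) *\<^sub>R f b)"
  by (subst euclidean_representation[of v, symmetric])
    (simp only: linear_sum[OF assms] linear_cmul[OF assms])

lemma Ck_on_compose:
  fixes f :: "'a::euclidean_space \<Rightarrow> 'b::euclidean_space" and g :: "'b \<Rightarrow> 'c::real_normed_vector"
  assumes "open S" "f ` S \<subseteq> T" "Ck_on k S f" "Ck_on k T g"
  shows "Ck_on k S (\<lambda>x. g (f x))"
  using assms(3,4)
proof (induction k arbitrary: g)
  case 0
  then show ?case using assms(2) by (auto intro: continuous_on_compose2)
next
  case (Suc k)
  have in_T: "f x \<in> T" if "x \<in> S" for x using that assms(2) by auto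
  have chain: "((\<lambda>x. g (f x)) has_derivative (\<lambda>v. \<partial> (\<partial> v f x) g (f x))) (at x)" if "x \<in> S" for x
    using diff_chain_at[OF Ck_on_has_derivative[OF Suc.prems(1) that]
        Ck_on_has_derivative[OF Suc.prems(2) in_T[OF that]]] by (simp add: o_def)
  have "Ck_on k S (\<lambda>x. \<partial> (\<partial> v f x) g (f x))" for v
  proof (rule Ck_on_cong[OF assms(1)])
    show "Ck_on k S (\<lambda>x. \<Sum>b\<in>Basis. (\<partial> v f x \<bullet> b) *\<^sub>R \<partial> b g (f x))"
      using Suc.prems(1) Suc.prems(1)[THEN Ck_on_SucD] Suc.prems(2)
      by (intro Ck_on_sum Ck_on_bilinear[OF bounded_bilinear_scaleR] assms(1) Suc.IH
          Ck_on_linear_compose[OF assms(1) bounded_linear_inner_left]) auto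
    show "(\<Sum>b\<in>Basis. (\<partial> v f x \<bullet> b) *\<^sub>R \<partial> b g (f x)) = \<partial> (\<partial> v f x) g (f x)" if "x \<in> S" for x
      using Suc.prems(2) in_T[OF that]
      by (intro linear_sum_Basis[symmetric] linear_frechet_derivative) auto
  qed
  with chain show ?case by (rule Ck_on_SucI[OF assms(1)])
qed

lemma smooth_onD: "smooth_on S f \<Longrightarrow> Ck_on k S f"
  by (simp add: smooth_on_def)

lemma smooth_on_cong:
  "open S \<Longrightarrow> (\<And>x. x \<in> S \<Longrightarrow> f x = g x) \<Longrightarrow> smooth_on S f \<Longrightarrow> smooth_on S g"
  unfolding smooth_on_def using Ck_on_cong by blast

lemma smooth_on_subset: "smooth_on S f \<Longrightarrow> T \<subseteq> S \<Longrightarrow> smooth_on T f"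
  unfolding smooth_on_def using Ck_on_subset by blast

lemma smooth_on_differentiable: "smooth_on S f \<Longrightarrow> x \<in> S \<Longrightarrow> f differentiable (at x)"
  unfolding smooth_on_def by (metis Ck_on.simps(2))

lemma smooth_on_continuous_on: "smooth_on S f \<Longrightarrow> continuous_on S f"
  unfolding smooth_on_def by (metis Ck_on.simps(1))

lemma smooth_on_compose:
  fixes f :: "'a::euclidean_space \<Rightarrow> 'b::euclidean_space" and g :: "'b \<Rightarrow> 'c::real_normed_vector"
  shows "open S \<Longrightarrow> f ` S \<subseteq> T \<Longrightarrow> smooth_on S f \<Longrightarrow> smooth_on T g \<Longrightarrow> smooth_on S (\<lambda>x. g (f x))"
  unfolding smooth_on_def using Ck_on_compose by blast

lemma smooth_on_linear: "open S \<Longrightarrow> bounded_linear f \<Longrightarrow> smooth_on S f"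
  by (simp add: smooth_on_def Ck_on_linear)

lemma smooth_on_linear_compose:
  "open S \<Longrightarrow> bounded_linear h \<Longrightarrow> smooth_on S f \<Longrightarrow> smooth_on S (\<lambda>x. h (f x))"
  by (simp add: smooth_on_def Ck_on_linear_compose)

lemma smooth_on_bilinear:
  "bounded_bilinear b \<Longrightarrow> open S \<Longrightarrow> smooth_on S f \<Longrightarrow> smooth_on S g \<Longrightarrow> smooth_on S (\<lambda>x. b (f x) (g x))"
  by (simp add: smooth_on_def Ck_on_bilinear)

named_theorems smooth_intros

lemma smooth_on_const [smooth_intros]: "smooth_on S (\<lambda>x. c)"
  by (simp add: smooth_on_def Ck_on_const)

lemma smooth_on_directional_derivative [smooth_intros]: "smooth_on S f \<Longrightarrow> smooth_on S (\<partial> v f)"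
  unfolding smooth_on_def by (metis Ck_on.simps(2))

lemma smooth_on_add [smooth_intros]:
  "open S \<Longrightarrow> smooth_on S f \<Longrightarrow> smooth_on S g \<Longrightarrow> smooth_on S (\<lambda>x. f x + g x)"
  by (simp add: smooth_on_def Ck_on_add)

lemma smooth_on_minus [smooth_intros]: "open S \<Longrightarrow> smooth_on S f \<Longrightarrow> smooth_on S (\<lambda>x. - f x)"
  by (rule smooth_on_linear_compose[OF _ bounded_linear_minus[OF bounded_linear_ident]])

lemma smooth_on_diff [smooth_intros]:
  "open S \<Longrightarrow> smooth_on S f \<Longrightarrow> smooth_on S g \<Longrightarrow> smooth_on S (\<lambda>x. f x - g x)"
  using smooth_on_add[of S f "\<lambda>x. - g x"] smooth_on_minus[of S g] by simp

lemmas smooth_on_mult [smooth_intros] =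
  smooth_on_bilinear[OF bounded_bilinear_mult[where 'a = real]]

lemmas smooth_on_scaleR [smooth_intros] = smooth_on_bilinear[OF bounded_bilinear_scaleR]

lemma smooth_on_sum [smooth_intros]:
  "open S \<Longrightarrow> (\<And>i. i \<in> I \<Longrightarrow> smooth_on S (f i)) \<Longrightarrow> smooth_on S (\<lambda>x. \<Sum>i\<in>I. f i x)"
  by (simp add: smooth_on_def Ck_on_sum)

lemma smooth_on_prod [smooth_intros]:
  fixes f :: "'i \<Rightarrow> 'a::euclidean_space \<Rightarrow> real"
  assumes "open S" "\<And>i. i \<in> I \<Longrightarrow> smooth_on S (f i)"
  shows "smooth_on S (\<lambda>x. \<Prod>i\<in>I. f i x)"
  using assms(2)
  by (induction I rule: infinite_finite_induct) (auto intro: smooth_on_const smooth_on_mult assms(1))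

lemma smooth_on_Pair [smooth_intros]:
  assumes "open S" "smooth_on S f" "smooth_on S g"
  shows "smooth_on S (\<lambda>x. (f x, g x))"
proof -
  have "smooth_on S (\<lambda>x. (f x, 0) + (0, g x))"
    by (intro smooth_on_add smooth_on_linear_compose[where h = "\<lambda>y. (y, 0)"]
        smooth_on_linear_compose[where h = "\<lambda>y. (0, y)"] bounded_linear_Pair bounded_linear_ident
        bounded_linear_zero assms)
  then show ?thesis by simp
qed

lemma smooth_on_inverse:
  fixes f :: "'a::euclidean_space \<Rightarrow> real"
  shows "open S \<Longrightarrow> smooth_on S f \<Longrightarrow> (\<And>x. x \<in> S \<Longrightarrow> f x \<noteq> 0) \<Longrightarrow> smooth_on S (\<lambda>x. inverse (f x))"
  by (simp add: smooth_on_def Ck_on_inverse)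

subsection \<open>Symmetry of second derivatives\<close>

lemma second_difference_mean_value:
  fixes f :: "'a::euclidean_space \<Rightarrow> real"
  assumes f: "Ck_on 2 S f" and "0 < h"
    and in_S: "\<And>s t. 0 \<le> s \<Longrightarrow> s \<le> h \<Longrightarrow> 0 \<le> t \<Longrightarrow> t \<le> h \<Longrightarrow> x + s *\<^sub>R u + t *\<^sub>R v \<in> S"
  obtains s t where "0 < s" "s < h" "0 < t" "t < h"
    "f (x + h *\<^sub>R u + h *\<^sub>R v) - f (x + h *\<^sub>R u) - f (x + h *\<^sub>R v) + f x =
      h\<^sup>2 * \<partial> v (\<partial> u f) (x + s *\<^sub>R u + t *\<^sub>R v)"
proof -
  let ?p = "\<lambda>s t. x + s *\<^sub>R u + t *\<^sub>R v"
  have f_C2: "f differentiable (at y)" "\<partial> w f differentiable (at y)" if "y \<in> S" for y w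
    using f that by (simp_all add: numeral_2_eq_2)
  have deriv_u: "((\<lambda>s. f (?p s t)) has_real_derivative \<partial> u f (?p s t)) (at s)"
    if "0 \<le> s" "s \<le> h" "0 \<le> t" "t \<le> h" for s t
    using has_vector_derivative_compose[where c = "\<lambda>s. ?p s t" and c' = u, OF _ f_C2(1)[OF in_S[OF that]]]
      has_vector_derivative_affine[of "x + t *\<^sub>R v" u s]
    by (simp add: has_real_derivative_iff_has_vector_derivative add_ac)
  have deriv_v: "((\<lambda>t. \<partial> u f (?p s t)) has_real_derivative \<partial> v (\<partial> u f) (?p s t)) (at t)"
    if "0 \<le> s" "s \<le> h" "0 \<le> t" "t \<le> h" for s t
    using has_vector_derivative_compose[where c = "?p s",
        OF has_vector_derivative_affine f_C2(2)[OF in_S[OF that]]]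
    by (simp add: has_real_derivative_iff_has_vector_derivative)
  have "\<exists>s. 0 < s \<and> s < h \<and> (f (?p h h) - f (?p h 0)) - (f (?p 0 h) - f (?p 0 0)) =
      (h - 0) * (\<partial> u f (?p s h) - \<partial> u f (?p s 0))"
    by (rule MVT2[OF \<open>0 < h\<close>], rule DERIV_diff[OF deriv_u deriv_u]) (use \<open>0 < h\<close> in auto)
  then obtain s where s: "0 < s" "s < h"
    and diff_s: "f (?p h h) - f (?p h 0) - (f (?p 0 h) - f x) = h * (\<partial> u f (?p s h) - \<partial> u f (?p s 0))"
    by auto
  have "\<exists>t. 0 < t \<and> t < h \<and> \<partial> u f (?p s h) - \<partial> u f (?p s 0) = (h - 0) * \<partial> v (\<partial> u f) (?p s t)"
    by (rule MVT2[OF \<open>0 < h\<close>], rule deriv_v) (use s in auto)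
  then obtain t where "0 < t" "t < h"
    and "\<partial> u f (?p s h) - \<partial> u f (?p s 0) = h * \<partial> v (\<partial> u f) (?p s t)"
    by auto
  with s diff_s that show thesis by (auto simp: power2_eq_square)
qed

lemma second_difference_tendsto:
  fixes f :: "'a::euclidean_space \<Rightarrow> real"
  assumes f: "Ck_on 2 S f" and S: "open S" "x \<in> S"
  shows "((\<lambda>h. (f (x + h *\<^sub>R u + h *\<^sub>R v) - f (x + h *\<^sub>R u) - f (x + h *\<^sub>R v) + f x) / h\<^sup>2)
    \<longlongrightarrow> \<partial> v (\<partial> u f) x) (at_right 0)" (is "(?\<Delta> \<longlongrightarrow> ?D x) _")
proof (rule tendstoI)
  fix e :: real assume "0 < e"
  let ?p = "\<lambda>s t. x + s *\<^sub>R u + t *\<^sub>R v"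
  have "isCont ?D x" using f S by (simp add: numeral_2_eq_2 continuous_on_eq_continuous_at)
  then have "(?D \<longlongrightarrow> ?D x) (nhds x)"
    unfolding isCont_def by (rule tendsto_at_iff_tendsto_nhds[THEN iffD1])
  then have "\<forall>\<^sub>F y in nhds x. y \<in> S \<and> dist (?D y) (?D x) < e"
    using S \<open>0 < e\<close> by (intro eventually_conj eventually_nhds_in_open tendstoD)
  moreover have "((\<lambda>q::real \<times> real. ?p (fst q) (snd q)) \<longlongrightarrow> x) (nhds (0, 0))"
    by (auto intro!: tendsto_eq_intros filterlim_ident)
  ultimately have "\<forall>\<^sub>F q::real \<times> real in nhds (0, 0).
      ?p (fst q) (snd q) \<in> S \<and> dist (?D (?p (fst q) (snd q))) (?D x) < e"
    unfolding filterlim_iff by blast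
  then obtain d where "0 < d"
    and near: "\<And>s t. dist (s, t) (0, 0) < d \<Longrightarrow> ?p s t \<in> S \<and> dist (?D (?p s t)) (?D x) < e"
    unfolding eventually_nhds_metric by auto
  have "dist (?\<Delta> h) (?D x) < e" if h: "0 < h" "h < d / 2" for h
  proof -
    have small: "dist (s, t) (0, 0) < d" if "0 \<le> s" "s \<le> h" "0 \<le> t" "t \<le> h" for s t :: real
      using norm_Pair_le[of s t] that h by (simp add: dist_norm zero_prod_def)
    obtain s t where st: "0 < s" "s < h" "0 < t" "t < h"
      and "f (?p h h) - f (x + h *\<^sub>R u) - f (x + h *\<^sub>R v) + f x = h\<^sup>2 * ?D (?p s t)"
      by (rule second_difference_mean_value[OF f h(1)]) (use near small in blast)+
    then have "?\<Delta> h = ?D (?p s t)" using h(1) by simp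
    then show ?thesis using near[OF small, of s t] st by simp
  qed
  then show "\<forall>\<^sub>F h in at_right 0. dist (?\<Delta> h) (?D x) < e"
    using \<open>0 < d\<close> by (auto simp: eventually_at_right_field intro!: exI[of _ "d / 2"])
qed

lemma second_derivative_symmetric_real:
  fixes f :: "'a::euclidean_space \<Rightarrow> real"
  assumes f: "Ck_on 2 S f" and S: "open S" "x \<in> S"
  shows "\<partial> v (\<partial> u f) x = \<partial> u (\<partial> v f) x"
proof (rule tendsto_unique[OF trivial_limit_at_right_real second_difference_tendsto[OF f S]])
  show "((\<lambda>h. (f (x + h *\<^sub>R u + h *\<^sub>R v) - f (x + h *\<^sub>R u) - f (x + h *\<^sub>R v) + f x) / h\<^sup>2)
      \<longlongrightarrow> \<partial> u (\<partial> v f) x) (at_right 0)"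
    by (rule Lim_transform_eventually[OF second_difference_tendsto[OF f S]])
      (auto simp: add_ac intro!: always_eventually)
qed

lemma second_derivative_symmetric:
  fixes f :: "'a::euclidean_space \<Rightarrow> 'b::euclidean_space"
  assumes f: "Ck_on 2 S f" and S: "open S" "x \<in> S"
  shows "\<partial> v (\<partial> u f) x = \<partial> u (\<partial> v f) x"
proof (rule euclidean_eqI)
  fix b :: 'b
  note component = bounded_linear_inner_left[of b]
  have f_C2: "f differentiable (at y)" "\<partial> w f differentiable (at y)" if "y \<in> S" for y w
    using f that by (simp_all add: numeral_2_eq_2)
  have "\<partial> v (\<partial> u f) x \<bullet> b = \<partial> v (\<partial> u (\<lambda>y. f y \<bullet> b)) x" for u v
  proof -
    have "\<partial> v (\<partial> u f) x \<bullet> b = \<partial> v (\<lambda>y. \<partial> u f y \<bullet> b) x"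
      by (intro directional_derivative_linear_compose[OF component, symmetric] f_C2 S)
    also have "\<dots> = \<partial> v (\<partial> u (\<lambda>y. f y \<bullet> b)) x"
      by (intro directional_derivative_cong[OF S] f_C2
          directional_derivative_linear_compose[OF component, symmetric])
    finally show ?thesis .
  qed
  moreover have "Ck_on 2 S (\<lambda>y. f y \<bullet> b)"
    by (rule Ck_on_linear_compose[OF S(1) component f])
  ultimately show "\<partial> v (\<partial> u f) x \<bullet> b = \<partial> u (\<partial> v f) x \<bullet> b"
    using second_derivative_symmetric_real S by metis
qed

subsection \<open>Families of bilinear maps\<close>

lemma bilinear_sum_Basis:
  fixes b :: "'b::euclidean_space \<Rightarrow> 'c::euclidean_space \<Rightarrow> 'd::real_normed_vector"
  assumes "bilinear b"
  shows "b u v = (\<Sum>i\<in>Basis. \<Sum>j\<in>Basis. ((u \<bullet> i) * (v \<bullet> j)) *\<^sub>R b i j)"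
proof -
  have "b u v = (\<Sum>i\<in>Basis. (u \<bullet> i) *\<^sub>R b i v)"
    using assms by (intro linear_sum_Basis) (simp add: bilinear_def)
  also have "\<dots> = (\<Sum>i\<in>Basis. (u \<bullet> i) *\<^sub>R (\<Sum>j\<in>Basis. (v \<bullet> j) *\<^sub>R b i j))"
    using assms by (intro sum.cong refl arg_cong2[where f = scaleR] linear_sum_Basis) (simp add: bilinear_def)
  finally show ?thesis by (simp add: scaleR_sum_right)
qed

lemma smooth_on_bilinear_family:
  fixes B :: "'a::euclidean_space \<Rightarrow> 'b::euclidean_space \<Rightarrow> 'c::euclidean_space \<Rightarrow> 'd::real_normed_vector"
    and f :: "'e::euclidean_space \<Rightarrow> 'a"
  assumes bil: "\<And>y. y \<in> T \<Longrightarrow> bilinear (B y)" and B: "\<And>a b. smooth_on T (\<lambda>y. B y a b)"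
    and f: "open S" "f ` S \<subseteq> T" "smooth_on S f" and uv: "smooth_on S u" "smooth_on S v"
  shows "smooth_on S (\<lambda>x. B (f x) (u x) (v x))"
proof (rule smooth_on_cong[OF f(1)])
  show "smooth_on S (\<lambda>x. \<Sum>i\<in>Basis. \<Sum>j\<in>Basis. ((u x \<bullet> i) * (v x \<bullet> j)) *\<^sub>R B (f x) i j)"
    by (intro smooth_intros smooth_on_linear_compose[OF _ bounded_linear_inner_left]
        smooth_on_compose[OF f B] f(1) uv)
  show "(\<Sum>i\<in>Basis. \<Sum>j\<in>Basis. ((u x \<bullet> i) * (v x \<bullet> j)) *\<^sub>R B (f x) i j) = B (f x) (u x) (v x)" if "x \<in> S" for x
    using bilinear_sum_Basis[OF bil] f(2) that by (simp add: image_subset_iff)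
qed

lemma directional_derivative_diagonal:
  assumes "H differentiable (at (x, x))"
  shows "\<partial> w (\<lambda>x. H (x, x)) x = \<partial> w (\<lambda>y. H (y, x)) x + \<partial> w (\<lambda>y. H (x, y)) x"
proof -
  note chain = directional_derivative_chain[where g = H and v = w]
  have "((\<lambda>x. (x, x)) has_derivative (\<lambda>w. (w, w))) (at x)"
    and "((\<lambda>y. (y, x)) has_derivative (\<lambda>w. (w, 0))) (at x)"
    and "((\<lambda>y. (x, y)) has_derivative (\<lambda>w. (0, w))) (at x)"
    by (auto intro!: derivative_eq_intros)
  from this[THEN chain] show ?thesis
    using assms linear_add[OF linear_frechet_derivative[OF assms], of "(w, 0)" "(0, w)"] by simp
qed

lemma directional_derivative_bilinear_family:
  fixes B :: "'a::euclidean_space \<Rightarrow> 'b::euclidean_space \<Rightarrow> 'c::euclidean_space \<Rightarrow> 'd::euclidean_space"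
  assumes T: "open T" "f x \<in> T" and bil: "\<And>y. y \<in> T \<Longrightarrow> bilinear (B y)"
    and B: "\<And>a b. smooth_on T (\<lambda>y. B y a b)"
    and diff: "f differentiable (at x)" "u differentiable (at x)" "v differentiable (at x)"
  shows "\<partial> w (\<lambda>x. B (f x) (u x) (v x)) x =
    \<partial> (\<partial> w f x) (\<lambda>y. B y (u x) (v x)) (f x) + B (f x) (\<partial> w u x) (v x) + B (f x) (u x) (\<partial> w v x)"
proof -
  define F where "F = (\<lambda>p. B (fst p) (fst (snd p)) (snd (snd p)))"
  define H where "H = (\<lambda>p. F (f (fst p), u (snd p), v (snd p)))"
  have "open (T \<times> (UNIV :: ('b \<times> 'c) set))" by (intro open_Times T(1) open_UNIV)
  then have "smooth_on (T \<times> UNIV) F"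
    unfolding F_def
    by (intro smooth_on_bilinear_family[OF bil B] smooth_on_linear)
      (auto intro: bounded_linear_fst bounded_linear_snd bounded_linear_compose[OF bounded_linear_fst]
        bounded_linear_compose[OF bounded_linear_snd])
  then have F: "F differentiable (at (f x, u x, v x))"
    by (rule smooth_on_differentiable) (simp add: T(2))
  have "(\<lambda>p. (f (fst p), u (snd p), v (snd p))) differentiable (at (x, x))"
    using diff bounded_linear_imp_differentiable[OF bounded_linear_fst]
      bounded_linear_imp_differentiable[OF bounded_linear_snd]
    by (intro differentiable_Pair differentiable_compose[of f fst] differentiable_compose[of u snd]
        differentiable_compose[of v snd]) simp_all
  then have "H differentiable (at (x, x))"
    unfolding H_def by (rule differentiable_compose[rotated]) (simp add: F)
  from directional_derivative_diagonal[OF this]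
  have "\<partial> w (\<lambda>x. B (f x) (u x) (v x)) x =
      \<partial> w (\<lambda>y. B (f y) (u x) (v x)) x + \<partial> w (\<lambda>y. B (f x) (u y) (v y)) x"
    by (simp add: H_def F_def)
  also have "\<partial> w (\<lambda>y. B (f y) (u x) (v x)) x = \<partial> (\<partial> w f x) (\<lambda>y. B y (u x) (v x)) (f x)"
    by (intro directional_derivative_compose diff smooth_on_differentiable[OF B T(2)])
  also have "\<partial> w (\<lambda>y. B (f x) (u y) (v y)) x = B (f x) (u x) (\<partial> w v x) + B (f x) (\<partial> w u x) (v x)"
    using bil[OF T(2)]
    by (intro directional_derivative_bilinear diff) (simp add: bilinear_conv_bounded_bilinear)
  finally show ?thesis by simp
qed

subsection \<open>Local uniqueness for ordinary differential equations\<close>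

lemma Ck_on_locally_lipschitz:
  fixes f :: "'a::euclidean_space \<Rightarrow> 'a"
  assumes S: "open S" "x \<in> S" and f: "Ck_on (Suc 0) S f"
  obtains r K where "0 < r" "0 \<le> K" "\<And>a b. a \<in> ball x r \<Longrightarrow> b \<in> ball x r \<Longrightarrow> norm (f a - f b) \<le> K * norm (a - b)"
proof -
  define f' where "f' = (\<lambda>(t::real, y). Blinfun (frechet_derivative f (at y)))"
  have f'_apply: "blinfun_apply (f' (t, y)) = frechet_derivative f (at y)" if "y \<in> S" for t y
    using has_derivative_bounded_linear[OF Ck_on_has_derivative[OF f that]]
    by (simp add: f'_def bounded_linear_Blinfun_apply)
  have "local_lipschitz UNIV S (\<lambda>t::real. f)"
  proof (rule c1_implies_local_lipschitz[where f' = f'])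
    show "(f has_derivative blinfun_apply (f' (t, y))) (at y)" if "y \<in> S" for t y
      using that Ck_on_has_derivative[OF f] by (simp add: f'_apply)
    show "continuous_on (UNIV \<times> S) f'"
    proof (rule continuous_on_blinfun_componentwise)
      fix i
      have "continuous_on S (\<partial> i f)" using f by simp
      then have "continuous_on (UNIV \<times> S) (\<lambda>p :: real \<times> 'a. \<partial> i f (snd p))"
        by (rule continuous_on_compose2[OF _ continuous_on_snd[OF continuous_on_id]]) auto
      then show "continuous_on (UNIV \<times> S) (\<lambda>p. blinfun_apply (f' p) i)"
        by (rule continuous_on_eq) (auto simp: f'_apply)
    qed
  qed (use S in auto)
  from local_lipschitzE[OF this UNIV_I S(2)]
  obtain r K where "0 < r" and lip: "K-lipschitz_on (cball x r \<inter> S) f"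
    by (metis Int_UNIV_right centre_in_cball less_imp_le)
  obtain r' where "0 < r'" "ball x r' \<subseteq> S" using S openE by blast
  then have "ball x (min r r') \<subseteq> cball x r \<inter> S" by auto
  from lipschitz_on_subset[OF lip this]
  have "norm (f a - f b) \<le> K * norm (a - b)" if "a \<in> ball x (min r r')" "b \<in> ball x (min r r')" for a b
    using lipschitz_onD that by (metis dist_norm)
  with \<open>0 < r\<close> \<open>0 < r'\<close> lipschitz_on_nonneg[OF lip] show thesis
    by (intro that[of "min r r'" K]) auto
qed

lemma ode_unique_of_contraction:
  fixes f :: "'a::real_normed_vector \<Rightarrow> 'a"
  assumes lip: "\<And>a b. a \<in> U \<Longrightarrow> b \<in> U \<Longrightarrow> norm (f a - f b) \<le> K * norm (a - b)"
    and h: "0 \<le> K" "0 \<le> h" "K * h < 1" and init: "x t0 = y t0"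
    and x: "\<And>t. t \<in> cball t0 h \<Longrightarrow> x t \<in> U \<and> (x has_vector_derivative f (x t)) (at t)"
    and y: "\<And>t. t \<in> cball t0 h \<Longrightarrow> y t \<in> U \<and> (y has_vector_derivative f (y t)) (at t)"
    and t: "t \<in> cball t0 h"
  shows "x t = y t"
proof -
  define z where "z = (\<lambda>t. x t - y t)"
  have z_deriv: "(z has_vector_derivative f (x t) - f (y t)) (at t)" if "t \<in> cball t0 h" for t
    unfolding z_def using x[OF that] y[OF that] by (intro has_vector_derivative_diff) auto
  have "\<exists>s\<in>cball t0 h. \<forall>t\<in>cball t0 h. norm (z t) \<le> norm (z s)"
    using h(2) by (intro continuous_attains_sup continuous_on_norm continuous_at_imp_continuous_on ballI
        has_vector_derivative_continuous[OF z_deriv]) auto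
  then obtain s where s: "s \<in> cball t0 h" and max: "\<And>t. t \<in> cball t0 h \<Longrightarrow> norm (z t) \<le> norm (z s)"
    by blast
  have "norm (z s - z t0 - (s - t0) *\<^sub>R (f (x t0) - f (y t0))) \<le> norm (s - t0) * (K * norm (z s))"
  proof (rule vector_differentiable_bound_linearization[where S = "cball t0 h"])
    show "closed_segment t0 s \<subseteq> cball t0 h"
      using s h(2) by (intro closed_segment_subset convex_cball) auto
    show "norm (f (x t) - f (y t) - (f (x t0) - f (y t0))) \<le> K * norm (z s)" if "t \<in> cball t0 h" for t
      using lip[of "x t" "y t"] x[OF that] y[OF that] mult_left_mono[OF max[OF that] h(1)]
      by (auto simp: init z_def)
  qed (use z_deriv h(2) in \<open>auto intro: has_vector_derivative_at_within\<close>)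
  also have "\<dots> \<le> h * (K * norm (z s))"
    using s h(1) by (intro mult_right_mono) (auto simp: dist_norm norm_minus_commute)
  finally have "(1 - K * h) * norm (z s) \<le> 0" by (simp add: init z_def algebra_simps)
  then have "norm (z s) = 0" using h(3) by (simp add: mult_le_0_iff)
  with max[OF t] show ?thesis by (simp add: z_def)
qed

lemma ode_locally_unique:
  fixes f :: "'a::euclidean_space \<Rightarrow> 'a"
  assumes S: "open S" "x t0 \<in> S" and f: "Ck_on (Suc 0) S f" and init: "x t0 = y t0"
    and x: "\<forall>\<^sub>F t in nhds t0. (x has_vector_derivative f (x t)) (at t)"
    and y: "\<forall>\<^sub>F t in nhds t0. (y has_vector_derivative f (y t)) (at t)"
  shows "\<forall>\<^sub>F t in nhds t0. x t = y t"
proof -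
  obtain r K where "0 < r" "0 \<le> K" and lip: "\<And>a b. a \<in> ball (x t0) r \<Longrightarrow> b \<in> ball (x t0) r \<Longrightarrow>
      norm (f a - f b) \<le> K * norm (a - b)"
    using Ck_on_locally_lipschitz[OF S f] by blast
  have "\<forall>\<^sub>F t in nhds t0. x t \<in> ball (x t0) r \<and> y t \<in> ball (x t0) r"
    using eventually_nhds_x_imp_x[OF x] eventually_nhds_x_imp_x[OF y] init \<open>0 < r\<close>
    by (intro eventually_conj eventually_has_vector_derivative_in_open[OF _ open_ball]) auto
  with x y have "\<forall>\<^sub>F t in nhds t0. (x t \<in> ball (x t0) r \<and> (x has_vector_derivative f (x t)) (at t)) \<and>
      (y t \<in> ball (x t0) r \<and> (y has_vector_derivative f (y t)) (at t))"
    by eventually_elim blast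
  then obtain d where "0 < d" and near: "\<And>t. dist t t0 < d \<Longrightarrow>
      (x t \<in> ball (x t0) r \<and> (x has_vector_derivative f (x t)) (at t)) \<and>
      (y t \<in> ball (x t0) r \<and> (y has_vector_derivative f (y t)) (at t))"
    unfolding eventually_nhds_metric by blast
  define h where "h = min (d / 2) (1 / (K + 1))"
  have h: "0 < h" "h < d" "K * h < 1"
    using \<open>0 < d\<close> \<open>0 \<le> K\<close> by (auto simp: h_def min_def field_simps)
  have near_h: "(x s \<in> ball (x t0) r \<and> (x has_vector_derivative f (x s)) (at s)) \<and>
      (y s \<in> ball (x t0) r \<and> (y has_vector_derivative f (y s)) (at s))" if "s \<in> cball t0 h" for s
    using that h(2) by (intro near) (simp add: dist_commute)
  have "x t = y t" if "t \<in> cball t0 h" for t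
    using ode_unique_of_contraction[OF lip \<open>0 \<le> K\<close> less_imp_le[OF h(1)] h(3) init
        conjunct1[OF near_h] conjunct2[OF near_h] that] .
  then show ?thesis
    unfolding eventually_nhds_metric using h(1) by (auto simp: dist_commute intro!: exI[of _ h])
qed

subsection \<open>Matrix calculus\<close>

lemma bounded_bilinear_matrix_mult:
  "bounded_bilinear ((**) :: real^'n^'m \<Rightarrow> real^'l^'n \<Rightarrow> real^'l^'m)"
  unfolding bilinear_conv_bounded_bilinear[symmetric] bilinear_def
  by (auto intro!: linearI
      simp: matrix_matrix_mult_def vec_eq_iff sum.distrib sum_distrib_left algebra_simps)

lemma bounded_bilinear_matrix_vector_mult:
  "bounded_bilinear ((*v) :: real^'n^'m \<Rightarrow> real^'n \<Rightarrow> real^'m)"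
  unfolding bilinear_conv_bounded_bilinear[symmetric] bilinear_def
  by (auto intro!: linearI
      simp: matrix_vector_mult_def vec_eq_iff sum.distrib sum_distrib_left algebra_simps)

interpretation matrix_mult: bounded_bilinear "(**) :: real^'n^'m \<Rightarrow> real^'l^'n \<Rightarrow> real^'l^'m"
  by (rule bounded_bilinear_matrix_mult)

interpretation matrix_vector_mult: bounded_bilinear "(*v) :: real^'n^'m \<Rightarrow> real^'n \<Rightarrow> real^'m"
  by (rule bounded_bilinear_matrix_vector_mult)

lemma bounded_linear_trace: "bounded_linear (trace :: real^'n^'n \<Rightarrow> real)"
  unfolding linear_conv_bounded_linear[symmetric]
  by (auto intro!: linearI simp: trace_def sum.distrib sum_distrib_left)


lemma trace_scaleR: "trace (r *\<^sub>R A) = r * trace A" for A :: "real^'n^'n"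
  by (simp add: trace_def sum_distrib_left)

lemma bounded_linear_transpose: "bounded_linear (transpose :: real^'n^'m \<Rightarrow> real^'m^'n)"
  unfolding linear_conv_bounded_linear[symmetric]
  by (auto intro!: linearI simp: transpose_def vec_eq_iff)

lemma trace_transpose: "trace (transpose A) = trace A"
  by (simp add: trace_def transpose_def)

lemma inner_transpose_mult: "(transpose A *v x) \<bullet> y = x \<bullet> (A *v y)" for A :: "real^'n^'m"
  by (simp add: dot_lmul_matrix)

lemma symmetric_matrix_inner:
  fixes A :: "real^'n^'n"
  assumes "transpose A = A"
  shows "(A *v x) \<bullet> y = x \<bullet> (A *v y)"
  by (metis assms inner_transpose_mult)

lemma matrix_eqI_inner:
  fixes A B :: "real^'n^'m"
  assumes "\<And>a b. a \<bullet> (A *v b) = a \<bullet> (B *v b)"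
  shows "A = B"
  unfolding matrix_eq using assms by (metis vector_eq_ldot)

lemma linear_sum_axis:
  fixes f :: "real^'n \<Rightarrow> 'b::real_vector"
  assumes "linear f"
  shows "f v = (\<Sum>i\<in>UNIV. v $ i *\<^sub>R f (axis i 1))"
  by (subst basis_expansion[of v, symmetric])
    (simp only: linear_sum[OF assms] linear_cmul[OF assms] scalar_mult_eq_scaleR)

lemma positive_definite_det_nonzero:
  fixes A :: "real^'n^'n"
  assumes "\<And>v. v \<noteq> 0 \<Longrightarrow> v \<bullet> (A *v v) > 0"
  shows "det A \<noteq> 0"
proof -
  have "v = 0" if "A *v v = 0" for v
    using assms[of v] that by force
  then show ?thesis
    by (metis invertible_det_nz invertible_left_inverse matrix_left_invertible_ker)
qed

lemma
  fixes A :: "real^'n^'n"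
  assumes "det A \<noteq> 0"
  shows matrix_inv_right: "A ** matrix_inv A = mat 1"
    and matrix_inv_left: "matrix_inv A ** A = mat 1"
proof -
  have "\<exists>A'. A ** A' = mat 1 \<and> A' ** A = mat 1"
    using assms by (simp add: invertible_det_nz[symmetric] invertible_def)
  from someI_ex[OF this] show "A ** matrix_inv A = mat 1" "matrix_inv A ** A = mat 1"
    by (simp_all add: matrix_inv_def)
qed

lemma
  fixes A :: "real^'n^'n"
  assumes "det A \<noteq> 0"
  shows matrix_inv_vector_right: "A *v (matrix_inv A *v x) = x"
    and matrix_inv_vector_left: "matrix_inv A *v (A *v x) = x"
  by (simp_all add: matrix_vector_mul_assoc matrix_inv_right matrix_inv_left assms)

lemma trace_matrix_conjugate:
  fixes A P :: "real^'n^'n"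
  assumes "det P \<noteq> 0"
  shows "trace (matrix_inv P ** A ** P) = trace A"
  by (subst trace_mul_sym) (simp add: matrix_mul_assoc matrix_inv_right[OF assms])

lemma trace_matrix_inv_mult_symmetrized:
  fixes h K :: "real^'n^'n"
  assumes "det h \<noteq> 0"
  shows "trace (matrix_inv h ** (transpose K ** h + h ** K)) = 2 * trace K"
proof -
  have "matrix_inv h ** (transpose K ** h + h ** K) = matrix_inv h ** transpose K ** h + K"
    by (simp add: matrix_mult.add_right matrix_mul_assoc matrix_inv_left[OF assms])
  then show ?thesis
    by (simp add: trace_add trace_matrix_conjugate[OF assms] trace_transpose)
qed

lemma matrix_inv_cramer:
  fixes A :: "real^'n^'n"
  assumes "det A \<noteq> 0"
  shows "matrix_inv A $ k $ l = det (\<chi> i j. if j = k then axis l 1 $ i else A $ i $ j) * inverse (det A)"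
proof -
  have "matrix_inv A *v axis l 1 = (\<chi> k. det (\<chi> i j. if j = k then axis l 1 $ i else A $ i $ j) / det A)"
    using cramer[OF assms] matrix_inv_vector_right[OF assms] by blast
  moreover have "matrix_inv A $ k $ l = (matrix_inv A *v axis l 1) $ k"
    by (simp add: matrix_vector_mult_basis column_def)
  ultimately show ?thesis by (simp add: divide_inverse)
qed

lemmas smooth_on_matrix_mult [smooth_intros] = smooth_on_bilinear[OF bounded_bilinear_matrix_mult]

lemmas smooth_on_matrix_vector_mult [smooth_intros] =
  smooth_on_bilinear[OF bounded_bilinear_matrix_vector_mult]

lemma smooth_on_vec_nth [smooth_intros]:
  "open S \<Longrightarrow> smooth_on S f \<Longrightarrow> smooth_on S (\<lambda>x. f x $ i)"
  for f :: "'a::euclidean_space \<Rightarrow> ('b::real_normed_vector)^'n"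
  by (rule smooth_on_linear_compose[OF _ bounded_linear_vec_nth])

lemma smooth_on_componentwise:
  fixes f :: "'a::euclidean_space \<Rightarrow> 'b::euclidean_space"
  assumes "open S" "\<And>b. b \<in> Basis \<Longrightarrow> smooth_on S (\<lambda>x. f x \<bullet> b)"
  shows "smooth_on S f"
proof -
  have "smooth_on S (\<lambda>x. \<Sum>b\<in>Basis. (f x \<bullet> b) *\<^sub>R b)"
    by (intro smooth_intros assms)
  then show ?thesis by (simp add: euclidean_representation)
qed

lemma smooth_on_vecI:
  fixes f :: "'a::euclidean_space \<Rightarrow> real^'n"
  assumes "open S" "\<And>i. smooth_on S (\<lambda>x. f x $ i)"
  shows "smooth_on S f"
proof (rule smooth_on_componentwise[OF assms(1)])
  fix b :: "real^'n" assume "b \<in> Basis"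
  then obtain i where "b = axis i 1" by (auto simp: Basis_vec_def)
  with assms(2)[of i] show "smooth_on S (\<lambda>x. f x \<bullet> b)" by (simp add: inner_axis)
qed

lemma smooth_on_matrixI:
  fixes f :: "'a::euclidean_space \<Rightarrow> real^'n^'m"
  assumes "open S" "\<And>i j. smooth_on S (\<lambda>x. f x $ i $ j)"
  shows "smooth_on S f"
proof (rule smooth_on_componentwise[OF assms(1)])
  fix b :: "real^'n^'m" assume "b \<in> Basis"
  then obtain i j where "b = axis i (axis j 1)" by (auto simp: Basis_vec_def)
  with assms(2)[of i j] show "smooth_on S (\<lambda>x. f x \<bullet> b)" by (simp add: inner_axis)
qed

lemma smooth_on_matrix_vectorI:
  fixes f :: "'a::euclidean_space \<Rightarrow> real^'n^'m"
  assumes "open S" "\<And>w. smooth_on S (\<lambda>x. f x *v w)"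
  shows "smooth_on S f"
proof (intro smooth_on_matrixI assms(1))
  fix i j
  show "smooth_on S (\<lambda>x. f x $ i $ j)"
    using smooth_on_vec_nth[OF assms(1) assms(2)[of "axis j 1"], of i]
    by (simp add: matrix_vector_mult_basis column_def)
qed

lemma smooth_on_det [smooth_intros]:
  fixes f :: "'a::euclidean_space \<Rightarrow> real^'n^'n"
  assumes "open S" "smooth_on S f"
  shows "smooth_on S (\<lambda>x. det (f x))"
  unfolding det_def by (intro smooth_intros assms)

lemma smooth_on_matrix_inv:
  fixes f :: "'a::euclidean_space \<Rightarrow> real^'n^'n"
  assumes "open S" "smooth_on S f" "\<And>x. x \<in> S \<Longrightarrow> det (f x) \<noteq> 0"
  shows "smooth_on S (\<lambda>x. matrix_inv (f x))"
proof (intro smooth_on_matrixI assms(1))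
  fix k l
  have "smooth_on S (\<lambda>x. if j = k then axis l (1::real) $ i else f x $ i $ j)" for i j
    by (cases "j = k") (simp_all add: smooth_intros assms)
  then have "smooth_on S (\<lambda>x. det (\<chi> i j. if j = k then axis l 1 $ i else f x $ i $ j) * inverse (det (f x)))"
    by (intro smooth_on_mult smooth_on_inverse smooth_on_det smooth_on_matrixI assms) simp_all
  then show "smooth_on S (\<lambda>x. matrix_inv (f x) $ k $ l)"
    by (rule smooth_on_cong[OF assms(1), rotated]) (simp add: matrix_inv_cramer assms(3))
qed

lemma directional_derivative_det_mat_1: "\<partial> H det (mat 1) = trace (H :: real^'n^'n)"
proof -
  let ?P = "{p. p permutes (UNIV :: 'n set)}"
  let ?term = "\<lambda>p. of_int (sign p) *
    (\<Sum>i\<in>UNIV. H $ i $ p i * (\<Prod>j\<in>UNIV - {i}. (mat 1 :: real^'n^'n) $ j $ p j))"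
  have entry: "((\<lambda>A. A $ i $ j) has_derivative (\<lambda>H. H $ i $ j)) (at A)" for i j and A :: "real^'n^'n"
    by (intro bounded_linear_imp_has_derivative
        bounded_linear_compose[OF bounded_linear_vec_nth bounded_linear_vec_nth])
  have "\<partial> H det (mat 1) = (\<Sum>p\<in>?P. ?term p)"
    unfolding det_def[abs_def]
    by (intro directional_derivative_eqI has_derivative_sum has_derivative_mult_right
        has_derivative_prod entry)
  also have "\<dots> = (\<Sum>p\<in>{id}. ?term p)"
  proof (intro sum.mono_neutral_right ballI)
    fix p assume "p \<in> ?P - {id}"
    then have p: "p permutes UNIV" "p \<noteq> id" by auto
    have vanishing: "(\<Prod>j\<in>UNIV - {i}. (mat 1 :: real^'n^'n) $ j $ p j) = 0" for i
    proof -
      have "\<exists>j. j \<noteq> i \<and> p j \<noteq> j"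
        using p permutes_inj[OF p(1)] by (metis eq_id_iff injD)
      then show ?thesis by (auto simp: mat_def intro!: bexI)
    qed
    show "?term p = 0" by (simp only: vanishing mult_zero_right sum.neutral_const)
  qed (auto simp: permutes_id)
  also have "\<dots> = trace H" by (simp add: mat_def trace_def)
  finally show ?thesis .
qed

lemma det_differentiable: "det differentiable (at (A :: real^'n^'n))"
  using smooth_on_differentiable[OF smooth_on_det[OF open_UNIV
      smooth_on_linear[OF open_UNIV bounded_linear_ident]]]
  by simp

lemma directional_derivative_det:
  fixes A H :: "real^'n^'n"
  assumes "det A \<noteq> 0"
  shows "\<partial> H det A = det A * trace (matrix_inv A ** H)"
proof -

  have left_mult: "((\<lambda>X. matrix_inv A ** X) has_derivative (\<lambda>H. matrix_inv A ** H)) (at A)"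
    by (intro bounded_linear_imp_has_derivative matrix_mult.bounded_linear_right)
  have "det X = det A * det (matrix_inv A ** X)" for X
    by (simp add: det_mul[symmetric] matrix_mul_assoc matrix_inv_right[OF assms])
  then have "\<partial> H det A = \<partial> H (\<lambda>X. det A * det (matrix_inv A ** X)) A"
    by (rule directional_derivative_cong[OF open_UNIV UNIV_I])
  also have "\<dots> = det A * \<partial> H (\<lambda>X. det (matrix_inv A ** X)) A"
    using differentiable_chain_at[OF _ det_differentiable] left_mult
    by (intro directional_derivative_linear_compose bounded_linear_mult_right)
      (auto simp: differentiable_def o_def)
  also have "\<partial> H (\<lambda>X. det (matrix_inv A ** X)) A = \<partial> (matrix_inv A ** H) det (mat 1)"
    using directional_derivative_chain[OF left_mult det_differentiable]
    by (simp add: matrix_inv_left[OF assms])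
  finally show ?thesis by (simp add: directional_derivative_det_mat_1)
qed

lemma jacobian_vector_mult: "f differentiable (at x) \<Longrightarrow> jacobian f x *v w = \<partial> w f x"
  using linear_frechet_derivative[of f "at x"] by (simp add: jacobian_def)

lemma smooth_on_jacobian:
  assumes "open S" "smooth_on S f"
  shows "smooth_on S (jacobian f)"
proof (rule smooth_on_matrix_vectorI[OF assms(1)])
  show "smooth_on S (\<lambda>x. jacobian f x *v w)" for w
    by (rule smooth_on_cong[OF assms(1) _ smooth_on_directional_derivative[OF assms(2), of w]])
      (simp add: jacobian_vector_mult smooth_on_differentiable[OF assms(2)])
qed

lemma directional_derivative_matrix_vector:
  fixes F :: "'a::real_normed_vector \<Rightarrow> real^'n^'m"
  assumes "F differentiable (at x)"
  shows "\<partial> a (\<lambda>y. F y *v w) x = \<partial> a F x *v w"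
  by (rule directional_derivative_linear_compose[OF matrix_vector_mult.bounded_linear_left assms])

lemma directional_derivative_jacobian:
  assumes "open S" "x \<in> S" "smooth_on S f"
  shows "\<partial> a (jacobian f) x *v w = \<partial> a (\<partial> w f) x"
proof -
  have "\<partial> a (jacobian f) x *v w = \<partial> a (\<lambda>y. jacobian f y *v w) x"
    by (intro directional_derivative_matrix_vector[symmetric]
        smooth_on_differentiable[OF smooth_on_jacobian[OF assms(1,3)] assms(2)])
  also have "\<dots> = \<partial> a (\<partial> w f) x"
    by (intro directional_derivative_cong[OF assms(1,2)] jacobian_vector_mult
        smooth_on_differentiable[OF assms(3)])
  finally show ?thesis .
qed

subsection \<open>Eigenvalues and traces of self-adjoint matrices\<close>

lemma frobenius_inner: "A \<bullet> B = trace (transpose A ** B)" for A B :: "real^'n^'n"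
  unfolding trace_def matrix_matrix_mult_def transpose_def inner_vec_def
  by simp (rule sum.swap)

lemma frobenius_outer: "A \<bullet> (\<chi> i j. x $ i * y $ j) = x \<bullet> (A *v y)" for A :: "real^'n^'n"
  by (simp add: inner_vec_def matrix_vector_mult_def sum_distrib_left mult_ac)

lemma frobenius_mat_1: "A \<bullet> mat 1 = trace A" for A :: "real^'n^'n"
  by (simp add: inner_vec_def trace_def mat_def if_distrib cong: if_cong)

text \<open>Cauchy--Schwarz for the Frobenius product of \<open>S - \<mu> y y\<^sup>T\<close> with the projection
  \<open>1 - x x\<^sup>T - y y\<^sup>T\<close>.\<close>

lemma symmetric_eigenvalue_trace_inequality:
  fixes S :: "real^'n^'n"
  assumes sym: "transpose S = S" and x: "norm x = 1" "S *v x = 0"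
    and y: "norm y = 1" "S *v y = \<mu> *\<^sub>R y" and orth: "x \<bullet> y = 0"
  shows "(trace S - \<mu>)\<^sup>2 \<le> (trace (S ** S) - \<mu>\<^sup>2) * (real CARD('n) - 2)"
proof -
  define X Y where "X = (\<chi> i j. x $ i * x $ j)" and "Y = (\<chi> i j. y $ i * y $ j)"
  have inner_XY: "A \<bullet> X = x \<bullet> (A *v x)" "A \<bullet> Y = y \<bullet> (A *v y)" "X \<bullet> A = x \<bullet> (A *v x)"
      "Y \<bullet> A = y \<bullet> (A *v y)" for A
    unfolding X_def Y_def frobenius_outer[symmetric] by (rule refl refl inner_commute inner_commute)+
  have XY_mult: "X *v v = (x \<bullet> v) *\<^sub>R x" "Y *v v = (y \<bullet> v) *\<^sub>R y" for v
    by (simp_all add: X_def Y_def vec_eq_iff matrix_vector_mult_def inner_vec_def sum_distrib_left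
        sum_distrib_right mult_ac)
  have unit: "x \<bullet> x = 1" "y \<bullet> y = 1" "y \<bullet> x = 0"
    using x(1) y(1) orth by (simp_all add: dot_square_norm inner_commute)
  have traces: "trace X = 1" "trace Y = 1"
    using unit by (simp_all add: frobenius_mat_1[symmetric] inner_XY)
  note products = inner_diff_left inner_diff_right inner_XY XY_mult matrix_vector_mult.diff_left
    matrix_vector_mult.scaleR_left x(2) y(2) orth unit frobenius_mat_1 trace_sub trace_scaleR traces trace_I
    frobenius_inner[of S S] sym
  have "(S - \<mu> *\<^sub>R Y) \<bullet> (mat 1 - X - Y) = trace S - \<mu>"
    by (simp add: products)
  moreover have "(S - \<mu> *\<^sub>R Y) \<bullet> (S - \<mu> *\<^sub>R Y) = trace (S ** S) - \<mu>\<^sup>2"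
    by (simp add: products power2_eq_square)
  moreover have "(mat 1 - X - Y) \<bullet> (mat 1 - X - Y) = real CARD('n) - 2"
    by (simp add: products)
  ultimately show ?thesis
    using Cauchy_Schwarz_ineq[of "S - \<mu> *\<^sub>R Y" "mat 1 - X - Y"] by simp
qed

lemma congruence_inner: "x \<bullet> ((transpose K ** g ** L) *v y) = (K *v x) \<bullet> (g *v (L *v y))"
  for K L g :: "real^'n^'n"
  by (metis inner_commute inner_transpose_mult matrix_vector_mul_assoc)

lemma self_adjoint_eigenvalue_trace_inequality:
  fixes g P R :: "real^'n^'n"
  assumes frame: "transpose P ** g ** P = mat 1"
    and self_adjoint: "\<And>a b. a \<bullet> (g *v (R *v b)) = b \<bullet> (g *v (R *v a))"
    and kernel: "\<xi> \<bullet> (g *v \<xi>) = 1" "R *v \<xi> = 0"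
    and eigenvector: "\<eta> \<noteq> 0" "R *v \<eta> = \<mu> *\<^sub>R \<eta>" and orth: "\<xi> \<bullet> (g *v \<eta>) = 0"
  shows "(trace R - \<mu>)\<^sup>2 \<le> (trace (R ** R) - \<mu>\<^sup>2) * (real CARD('n) - 2)"
proof -
  have P: "det P \<noteq> 0" using arg_cong[OF frame, of det] by (auto simp: det_mul)
  note inv = matrix_inv_vector_right[OF P] matrix_inv_vector_left[OF P]
  have isometry: "(P *v a) \<bullet> (g *v (P *v b)) = a \<bullet> b" for a b
    using congruence_inner[of a P g P b] by (simp add: frame)
  define S where "S = matrix_inv P ** R ** P"
  have PS: "P *v (S *v a) = R *v (P *v a)" for a
    by (simp add: S_def inv flip: matrix_vector_mul_assoc)
  have "a \<bullet> (S *v b) = b \<bullet> (S *v a)" for a b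
    using self_adjoint[of "P *v a" "P *v b"] isometry[of a "S *v b"] isometry[of b "S *v a"] by (simp add: PS)
  then have sym: "transpose S = S"
    by (intro matrix_eqI_inner) (metis inner_commute inner_transpose_mult)
  define x where "x = matrix_inv P *v \<xi>"
  define z where "z = matrix_inv P *v \<eta>"
  have Px: "P *v x = \<xi>" and Pz: "P *v z = \<eta>" by (simp_all add: x_def z_def inv)
  have "z \<noteq> 0" using Pz eigenvector(1) by auto
  have "(trace S - \<mu>)\<^sup>2 \<le> (trace (S ** S) - \<mu>\<^sup>2) * (real CARD('n) - 2)"
  proof (rule symmetric_eigenvalue_trace_inequality[OF sym])
    show "norm x = 1" using isometry[of x x] kernel(1) by (simp add: Px norm_eq_1)
    show "S *v x = 0" using PS[of x] by (metis Px inv(2) kernel(2) matrix_vector_mult.zero_right)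
    show "norm (sgn z) = 1" using \<open>z \<noteq> 0\<close> by (simp add: norm_sgn)
    have "S *v z = \<mu> *\<^sub>R z"
      using PS[of z] by (metis Pz inv(2) eigenvector(2) matrix_vector_mult.scaleR_right)
    then show "S *v sgn z = \<mu> *\<^sub>R sgn z" by (simp add: sgn_div_norm matrix_vector_mult.scaleR_right)
    show "x \<bullet> sgn z = 0" using isometry[of x z] orth by (simp add: Px Pz sgn_div_norm)
  qed
  moreover have "S ** S = matrix_inv P ** (R ** (P ** matrix_inv P) ** R) ** P"
    by (simp add: S_def matrix_mul_assoc)
  then have "S ** S = matrix_inv P ** (R ** R) ** P" by (simp add: matrix_inv_right[OF P])
  ultimately show ?thesis by (simp add: S_def trace_matrix_conjugate[OF P])
qed

subsection \<open>The Levi-Civita connection in coordinates\<close>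

definition jacobi_at :: "(real^'n \<Rightarrow> real^'n^'n) \<Rightarrow> real^'n \<Rightarrow> real^'n \<Rightarrow> real^'n \<Rightarrow> real^'n" where
  "jacobi_at G x \<xi> \<eta> = curvature_field G (\<lambda>_. \<eta>) (\<lambda>_. \<xi>) (\<lambda>_. \<xi>) x"

definition jacobi_matrix :: "(real^'n \<Rightarrow> real^'n^'n) \<Rightarrow> real^'n \<Rightarrow> real^'n \<Rightarrow> real^'n^'n" where
  "jacobi_matrix G x \<xi> = matrix (jacobi_at G x \<xi>)"

locale coordinate_metric =
  fixes \<Omega> :: "(real^'n) set" and G :: "real^'n \<Rightarrow> real^'n^'n"
  assumes open_domain: "open \<Omega>" and smooth_metric: "smooth_on \<Omega> G"
    and symmetric_metric: "\<And>x. x \<in> \<Omega> \<Longrightarrow> transpose (G x) = G x"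
    and positive_metric: "\<And>x v. x \<in> \<Omega> \<Longrightarrow> v \<noteq> 0 \<Longrightarrow> v \<bullet> (G x *v v) > 0"
begin

abbreviation "\<Gamma> \<equiv> christoffel_vec G"

abbreviation "D\<Gamma> x w u v \<equiv> \<partial> w (\<lambda>y. \<Gamma> y u v) x"

lemma det_metric_nonzero: "x \<in> \<Omega> \<Longrightarrow> det (G x) \<noteq> 0"
  by (rule positive_definite_det_nonzero[OF positive_metric])

lemma metric_inner_commute: "x \<in> \<Omega> \<Longrightarrow> (G x *v a) \<bullet> b = (G x *v b) \<bullet> a"
  by (metis inner_commute symmetric_matrix_inner symmetric_metric)

lemma metric_cancel:
  assumes "x \<in> \<Omega>" "\<And>w. (G x *v u) \<bullet> w = (G x *v v) \<bullet> w"
  shows "u = v"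
  by (metis assms matrix_inv_vector_left[OF det_metric_nonzero] vector_eq_rdot)

lemma metric_differentiable: "x \<in> \<Omega> \<Longrightarrow> G differentiable (at x)"
  by (rule smooth_on_differentiable[OF smooth_metric])

lemma metric_derivative_trilinear:
  assumes "x \<in> \<Omega>"
  shows "b \<bullet> (\<partial> a G x *v c) =
    (\<Sum>i\<in>UNIV. \<Sum>j\<in>UNIV. \<Sum>l\<in>UNIV. a $ i * b $ j * c $ l * metric_partial G x i j l)"
proof -
  have "\<partial> a G x = (\<Sum>i\<in>UNIV. a $ i *\<^sub>R \<partial> (axis i 1) G x)"
    by (intro linear_sum_axis linear_frechet_derivative metric_differentiable assms)
  then have "\<partial> a G x $ j $ l = (\<Sum>i\<in>UNIV. a $ i * metric_partial G x i j l)" for j l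
    by (simp add: metric_partial_def)
  then have "b \<bullet> (\<partial> a G x *v c) =
     (\<Sum>j\<in>UNIV. \<Sum>l\<in>UNIV. \<Sum>i\<in>UNIV. a $ i * b $ j * c $ l * metric_partial G x i j l)"
    by (simp add: inner_vec_def matrix_vector_mult_def sum_distrib_left sum_distrib_right mult_ac)
  also have "\<dots> = (\<Sum>j\<in>UNIV. \<Sum>i\<in>UNIV. \<Sum>l\<in>UNIV. a $ i * b $ j * c $ l * metric_partial G x i j l)"
    by (intro sum.cong refl sum.swap)
  also have "\<dots> = (\<Sum>i\<in>UNIV. \<Sum>j\<in>UNIV. \<Sum>l\<in>UNIV. a $ i * b $ j * c $ l * metric_partial G x i j l)"
    by (rule sum.swap)
  finally show ?thesis .
qed

lemma lowered_christoffel: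
  assumes x: "x \<in> \<Omega>"
  shows "(G x *v \<Gamma> x u v) \<bullet> w = (v \<bullet> (\<partial> u G x *v w) + u \<bullet> (\<partial> v G x *v w) - u \<bullet> (\<partial> w G x *v v)) / 2"
proof -
  let ?g = "metric_partial G x"
  define cyclic where "cyclic = (\<lambda>i j. (\<chi> l. ?g i j l + ?g j i l - ?g l i j))"
  have "\<Gamma> x u v = (\<Sum>i\<in>UNIV. \<Sum>j\<in>UNIV. (u $ i * v $ j / 2) *\<^sub>R (matrix_inv (G x) *v cyclic i j))"
    by (simp add: christoffel_vec_def christoffel_def vec_eq_iff matrix_vector_mult_def cyclic_def mult_ac)
  then have "G x *v \<Gamma> x u v = (\<Sum>i\<in>UNIV. \<Sum>j\<in>UNIV. (u $ i * v $ j / 2) *\<^sub>R cyclic i j)"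
    by (simp add: matrix_vector_mult.sum_right matrix_vector_mult.scaleR_right
        matrix_inv_vector_right[OF det_metric_nonzero[OF x]])
  then have "2 * ((G x *v \<Gamma> x u v) \<bullet> w) =
     (\<Sum>i\<in>UNIV. \<Sum>j\<in>UNIV. \<Sum>l\<in>UNIV. u $ i * v $ j * w $ l * (?g i j l + ?g j i l - ?g l i j))"
    by (simp add: inner_sum_left sum_distrib_left)
      (simp add: inner_vec_def cyclic_def sum_distrib_left mult_ac)
  also have "\<dots> = (\<Sum>i\<in>UNIV. \<Sum>j\<in>UNIV. \<Sum>l\<in>UNIV. u $ i * v $ j * w $ l * ?g i j l) +
     (\<Sum>i\<in>UNIV. \<Sum>j\<in>UNIV. \<Sum>l\<in>UNIV. u $ i * v $ j * w $ l * ?g j i l) -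
     (\<Sum>i\<in>UNIV. \<Sum>j\<in>UNIV. \<Sum>l\<in>UNIV. u $ i * v $ j * w $ l * ?g l i j)"
    by (simp add: sum.distrib sum_subtractf algebra_simps)
  also have "(\<Sum>i\<in>UNIV. \<Sum>j\<in>UNIV. \<Sum>l\<in>UNIV. u $ i * v $ j * w $ l * ?g i j l) = v \<bullet> (\<partial> u G x *v w)"
    by (rule metric_derivative_trilinear[OF x, symmetric])
  also have "(\<Sum>i\<in>UNIV. \<Sum>j\<in>UNIV. \<Sum>l\<in>UNIV. u $ i * v $ j * w $ l * ?g j i l) = u \<bullet> (\<partial> v G x *v w)"
    unfolding metric_derivative_trilinear[OF x] by (subst sum.swap) (simp add: mult_ac)
  also have "(\<Sum>i\<in>UNIV. \<Sum>j\<in>UNIV. \<Sum>l\<in>UNIV. u $ i * v $ j * w $ l * ?g l i j) =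
      (\<Sum>i\<in>UNIV. \<Sum>l\<in>UNIV. \<Sum>j\<in>UNIV. u $ i * v $ j * w $ l * ?g l i j)"
    by (intro sum.cong refl sum.swap)
  also have "\<dots> = u \<bullet> (\<partial> w G x *v v)"
    unfolding metric_derivative_trilinear[OF x] by (subst sum.swap) (simp add: mult_ac)
  finally show ?thesis by simp
qed

lemma bilinear_christoffel: "bilinear (\<Gamma> x)"
  unfolding bilinear_def
  by (auto intro!: linearI simp: christoffel_vec_def vec_eq_iff sum.distrib sum_distrib_left algebra_simps)

lemmas christoffel_linear =
  bilinear_ladd[OF bilinear_christoffel] bilinear_radd[OF bilinear_christoffel]
  bilinear_lmul[OF bilinear_christoffel] bilinear_rmul[OF bilinear_christoffel]
  bilinear_lneg[OF bilinear_christoffel] bilinear_lzero[OF bilinear_christoffel]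
  bilinear_rzero[OF bilinear_christoffel]

lemma directional_derivative_metric_symmetric:
  assumes "x \<in> \<Omega>"
  shows "transpose (\<partial> w G x) = \<partial> w G x"
  using directional_derivative_linear_compose[OF bounded_linear_transpose
      metric_differentiable[OF assms], where v = w]
    directional_derivative_cong[OF open_domain assms symmetric_metric, where v = w] by (rule trans[OF sym])

lemma second_derivative_metric_symmetric:
  assumes "x \<in> \<Omega>"
  shows "transpose (\<partial> w (\<partial> u G) x) = \<partial> w (\<partial> u G) x"
  using directional_derivative_linear_compose[OF bounded_linear_transpose
      smooth_on_differentiable[OF smooth_on_directional_derivative[OF smooth_metric, of u]
          assms], where v = w]
    directional_derivative_cong[OF open_domain assms directional_derivative_metric_symmetric, where v = w]
  by (rule trans[OF sym])

lemma christoffel_commute: "x \<in> \<Omega> \<Longrightarrow> \<Gamma> x u v = \<Gamma> x v u"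
  by (rule metric_cancel, assumption)
    (simp add: lowered_christoffel,
      metis inner_commute symmetric_matrix_inner directional_derivative_metric_symmetric)

lemma metric_compatible:
  assumes x: "x \<in> \<Omega>"
  shows "a \<bullet> (\<partial> w G x *v b) = (G x *v \<Gamma> x w a) \<bullet> b + (G x *v \<Gamma> x w b) \<bullet> a"
proof -
  have "b \<bullet> (\<partial> w G x *v a) = a \<bullet> (\<partial> w G x *v b)"
    by (metis x inner_commute symmetric_matrix_inner directional_derivative_metric_symmetric)
  then show ?thesis by (simp add: lowered_christoffel[OF x] field_simps)
qed

lemma christoffel_matrix_mult: "matrix (\<Gamma> x u) *v w = \<Gamma> x u w"
  using bilinear_christoffel[of x] by (simp add: bilinear_def)

lemma metric_compatible_matrix:
  assumes x: "x \<in> \<Omega>"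
  shows "\<partial> w G x = transpose (matrix (\<Gamma> x w)) ** G x + G x ** matrix (\<Gamma> x w)"
proof (rule matrix_eqI_inner)
  fix a b
  have "a \<bullet> (transpose (matrix (\<Gamma> x w)) *v (G x *v b)) = (G x *v \<Gamma> x w a) \<bullet> b"
    by (metis christoffel_matrix_mult inner_commute inner_transpose_mult metric_inner_commute[OF x])
  then show "a \<bullet> (\<partial> w G x *v b) = a \<bullet> ((transpose (matrix (\<Gamma> x w)) ** G x + G x ** matrix (\<Gamma> x w)) *v b)"
    by (simp add: metric_compatible[OF x] matrix_vector_mult.add_left inner_add_right christoffel_matrix_mult
        inner_commute[of a] flip: matrix_vector_mul_assoc)
qed

lemma smooth_christoffel: "smooth_on \<Omega> (\<lambda>x. \<Gamma> x u v)"
proof (intro smooth_on_vecI open_domain)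
  fix k
  show "smooth_on \<Omega> (\<lambda>x. \<Gamma> x u v $ k)"
    unfolding christoffel_vec_def christoffel_def metric_partial_def
    by (simp only: vec_lambda_beta)
      (intro smooth_intros smooth_on_matrix_inv open_domain smooth_metric det_metric_nonzero)
qed

lemmas directional_derivative_christoffel =
  directional_derivative_bilinear_family[where B = \<Gamma>, OF open_domain _ bilinear_christoffel
      smooth_christoffel]

lemma christoffel_differentiable: "x \<in> \<Omega> \<Longrightarrow> (\<lambda>y. \<Gamma> y u v) differentiable (at x)"
  by (rule smooth_on_differentiable[OF smooth_christoffel])

lemma smooth_christoffel_derivative: "smooth_on \<Omega> (\<lambda>x. D\<Gamma> x w u v)"
  by (intro smooth_intros smooth_christoffel)

lemma linear_christoffel_derivative: "x \<in> \<Omega> \<Longrightarrow> linear (\<lambda>w. D\<Gamma> x w u v)"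
  by (rule linear_frechet_derivative[OF christoffel_differentiable])

lemma christoffel_derivative_commute: "x \<in> \<Omega> \<Longrightarrow> D\<Gamma> x w u v = D\<Gamma> x w v u"
  by (intro directional_derivative_cong[OF open_domain] christoffel_commute)

lemma bilinear_christoffel_derivative:
  assumes x: "x \<in> \<Omega>"
  shows "bilinear (D\<Gamma> x w)"
proof -
  have "linear (D\<Gamma> x w u)" for u
    using christoffel_differentiable[OF x]
    by (intro linearI) (simp_all add: christoffel_linear directional_derivative_add
        directional_derivative_linear_compose[OF bounded_linear_scaleR_right])
  moreover have "(\<lambda>u. D\<Gamma> x w u v) = D\<Gamma> x w v" for v
    by (rule ext) (rule christoffel_derivative_commute[OF x])
  ultimately have "linear (\<lambda>u. D\<Gamma> x w u v)" for v by simp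
  with \<open>\<And>u. linear (D\<Gamma> x w u)\<close> show ?thesis by (simp add: bilinear_def)
qed

subsection \<open>The Jacobi operator in coordinates\<close>

lemma jacobi_at_eq:
  assumes x: "x \<in> \<Omega>"
  shows "jacobi_at G x \<xi> \<eta> = D\<Gamma> x \<eta> \<xi> \<xi> - D\<Gamma> x \<xi> \<xi> \<eta> + \<Gamma> x \<eta> (\<Gamma> x \<xi> \<xi>) - \<Gamma> x \<xi> (\<Gamma> x \<xi> \<eta>)"
  using christoffel_derivative_commute[OF x, of \<xi> \<eta> \<xi>] christoffel_commute[OF x, of \<eta> \<xi>]
  by (simp add: jacobi_at_def curvature_field_def nabla_def[abs_def] lie_bracket_def christoffel_linear)

lemma linear_jacobi_at:
  assumes x: "x \<in> \<Omega>"
  shows "linear (jacobi_at G x \<xi>)"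
proof -
  have linear: "linear (\<Gamma> x u)" "linear (\<lambda>w. \<Gamma> x w u)" "linear (D\<Gamma> x w u)" for u w
    using bilinear_christoffel[of x] bilinear_christoffel_derivative[OF x] by (auto simp: bilinear_def)
  have "linear (\<lambda>\<eta>. \<Gamma> x \<xi> (\<Gamma> x \<xi> \<eta>))"
    using linear_compose[OF linear(1) linear(1)] by (simp add: o_def)
  then show ?thesis
    unfolding jacobi_at_eq[OF x]
    by (intro linear_compose_sub linear_compose_add linear_christoffel_derivative[OF x] linear)
qed

lemma jacobi_matrix_mult: "x \<in> \<Omega> \<Longrightarrow> jacobi_matrix G x \<xi> *v \<eta> = jacobi_at G x \<xi> \<eta>"
  using linear_jacobi_at by (simp add: jacobi_matrix_def)

lemma jacobi_at_self: "x \<in> \<Omega> \<Longrightarrow> jacobi_at G x \<xi> \<xi> = 0"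
  using christoffel_commute by (simp add: jacobi_at_eq)

lemma lowered_christoffel_derivative:
  assumes x: "x \<in> \<Omega>"
  shows "(G x *v D\<Gamma> x w u v) \<bullet> z + (\<partial> w G x *v \<Gamma> x u v) \<bullet> z =
    (v \<bullet> (\<partial> w (\<partial> u G) x *v z) + u \<bullet> (\<partial> w (\<partial> v G) x *v z) - u \<bullet> (\<partial> w (\<partial> z G) x *v v)) / 2"
proof -
  let ?T = "\<lambda>a b c y. b \<bullet> (\<partial> a G y *v c)"
  have entry: "bounded_linear (\<lambda>A :: real^'n^'n. b \<bullet> (A *v c))" for b c :: "real^'n"
    by (intro bounded_linear_inner_right_comp matrix_vector_mult.bounded_linear_left)
  have T_differentiable: "?T a b c differentiable (at x)" for a b c
    by (intro smooth_on_differentiable[OF _ x] smooth_on_linear_compose[OF open_domain entry] smooth_intros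
        smooth_metric)
  have T_derivative: "\<partial> w (?T a b c) x = b \<bullet> (\<partial> w (\<partial> a G) x *v c)" for a b c
    by (intro directional_derivative_linear_compose[OF entry] smooth_on_differentiable[OF _ x] smooth_intros
        smooth_metric)
  have "(\<lambda>y. G y *v \<Gamma> y u v) differentiable (at x)"
    by (intro smooth_on_differentiable[OF _ x] smooth_intros open_domain smooth_metric smooth_christoffel)
  then have "(G x *v D\<Gamma> x w u v) \<bullet> z + (\<partial> w G x *v \<Gamma> x u v) \<bullet> z = \<partial> w (\<lambda>y. (G y *v \<Gamma> y u v) \<bullet> z) x"
    by (simp add: directional_derivative_linear_compose[OF bounded_linear_inner_left] inner_add_left
        directional_derivative_bilinear[OF bounded_bilinear_matrix_vector_mult]
        metric_differentiable[OF x] christoffel_differentiable[OF x])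
  also have "\<dots> = \<partial> w (\<lambda>y. (?T u v z y + ?T v u z y - ?T z u v y) / 2) x"
    by (intro directional_derivative_cong[OF open_domain x] lowered_christoffel)
  also have "\<dots> = \<partial> w (\<lambda>y. ?T u v z y + ?T v u z y - ?T z u v y) x / 2"
    by (intro directional_derivative_linear_compose[OF bounded_linear_divide] derivative_intros
        T_differentiable)
  also have "\<dots> = (\<partial> w (?T u v z) x + \<partial> w (?T v u z) x - \<partial> w (?T z u v) x) / 2"
    by (simp add: directional_derivative_add directional_derivative_diff T_differentiable)
  finally show ?thesis unfolding T_derivative .
qed

definition metric_hessian :: "real^'n \<Rightarrow> real^'n \<Rightarrow> real^'n \<Rightarrow> real^'n \<Rightarrow> real^'n \<Rightarrow> real" where
  "metric_hessian x a b c d = c \<bullet> (\<partial> a (\<partial> b G) x *v d)"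

lemma metric_hessian_commute:
  assumes "x \<in> \<Omega>"
  shows "metric_hessian x a b c d = metric_hessian x b a c d"
    and "metric_hessian x a b c d = metric_hessian x a b d c"
  unfolding metric_hessian_def
  by (simp add: second_derivative_symmetric[OF smooth_onD[OF smooth_metric] open_domain assms, of a b])
    (metis inner_commute symmetric_matrix_inner second_derivative_metric_symmetric[OF assms])

lemma lowered_jacobi_at:
  assumes x: "x \<in> \<Omega>"
  shows "(G x *v jacobi_at G x \<xi> w) \<bullet> z =
    (metric_hessian x w \<xi> \<xi> z + metric_hessian x \<xi> z \<xi> w
      - metric_hessian x w z \<xi> \<xi> - metric_hessian x \<xi> \<xi> w z) / 2
    - (G x *v \<Gamma> x w z) \<bullet> \<Gamma> x \<xi> \<xi> + (G x *v \<Gamma> x \<xi> z) \<bullet> \<Gamma> x \<xi> w"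
proof -
  let ?H = "metric_hessian x"
  have "(G x *v D\<Gamma> x w \<xi> \<xi>) \<bullet> z = ?H w \<xi> \<xi> z - ?H w z \<xi> \<xi> / 2 - (\<partial> w G x *v \<Gamma> x \<xi> \<xi>) \<bullet> z"
    using lowered_christoffel_derivative[OF x, where w = w and u = \<xi> and v = \<xi> and z = z]
    by (simp add: metric_hessian_def field_simps)
  moreover have "(G x *v D\<Gamma> x \<xi> \<xi> w) \<bullet> z =
      (?H \<xi> \<xi> w z + ?H \<xi> w \<xi> z - ?H \<xi> z \<xi> w) / 2 - (\<partial> \<xi> G x *v \<Gamma> x \<xi> w) \<bullet> z"
    using lowered_christoffel_derivative[OF x, where w = \<xi> and u = \<xi> and v = w and z = z]
    by (simp add: metric_hessian_def field_simps)
  moreover have "(\<partial> a G x *v b) \<bullet> z = (G x *v \<Gamma> x a b) \<bullet> z + (G x *v \<Gamma> x a z) \<bullet> b" for a b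
    using metric_compatible[OF x, of z a b] by (simp add: inner_commute[of z])
  moreover have "?H \<xi> w \<xi> z = ?H w \<xi> \<xi> z" by (rule metric_hessian_commute(1)[OF x])
  ultimately show ?thesis
    by (simp add: jacobi_at_eq[OF x] matrix_vector_mult.add_right matrix_vector_mult.diff_right
        inner_add_left inner_diff_left field_simps)
qed

lemma jacobi_at_self_adjoint:
  assumes x: "x \<in> \<Omega>"
  shows "(G x *v jacobi_at G x \<xi> w) \<bullet> z = (G x *v jacobi_at G x \<xi> z) \<bullet> w"
  unfolding lowered_jacobi_at[OF x]
  using metric_hessian_commute(1)[OF x, of w \<xi> \<xi> z] metric_hessian_commute(1)[OF x, of z \<xi> \<xi> w]
    metric_hessian_commute(1)[OF x, of w z \<xi> \<xi>] metric_hessian_commute(2)[OF x, of \<xi> \<xi> w z]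
    christoffel_commute[OF x, of w z] metric_inner_commute[OF x, of "\<Gamma> x \<xi> z" "\<Gamma> x \<xi> w"] by simp

end

subsection \<open>The Riccati equation along radial geodesics\<close>

definition pullback_metric ::
  "(real^'n \<Rightarrow> real^'n^'n) \<Rightarrow> (real^'n \<Rightarrow> real^'n) \<Rightarrow> real^'n \<Rightarrow> real^'n^'n" where
  "pullback_metric G f x = transpose (jacobian f x) ** G (f x) ** jacobian f x"

lemma pullback_metric_inner:
  "a \<bullet> (pullback_metric G f x *v b) = (jacobian f x *v a) \<bullet> (G (f x) *v (jacobian f x *v b))"
  by (simp add: pullback_metric_def congruence_inner)

locale exponential_coordinates = coordinate_metric \<Omega> G
  for \<Omega> :: "(real^'n) set" and G :: "real^'n \<Rightarrow> real^'n^'n" +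
  fixes E :: "real^'n \<Rightarrow> real^'n" and \<delta> :: real
  assumes radius: "0 < \<delta>" and smooth_exp: "smooth_on (ball 0 \<delta>) E"
    and exp_in_domain: "\<And>x. x \<in> ball 0 \<delta> \<Longrightarrow> E x \<in> \<Omega>"
    and radial_geodesic: "\<And>t u. t *\<^sub>R u \<in> ball 0 \<delta> \<Longrightarrow>
      \<partial> u (\<partial> u E) (t *\<^sub>R u) = - \<Gamma> (E (t *\<^sub>R u)) (\<partial> u E (t *\<^sub>R u)) (\<partial> u E (t *\<^sub>R u))"
    and regular: "\<And>x. x \<in> ball 0 \<delta> \<Longrightarrow> det (jacobian E x) \<noteq> 0"
    and orthonormal_origin: "pullback_metric G E 0 = mat 1"
begin

abbreviation "J \<equiv> jacobian E"

lemma origin_in_ball: "0 \<in> ball (0 :: real^'n) \<delta>"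
  using radius by simp

lemma exp_differentiable: "x \<in> ball 0 \<delta> \<Longrightarrow> E differentiable (at x)"
  by (rule smooth_on_differentiable[OF smooth_exp])

lemma J_mult: "x \<in> ball 0 \<delta> \<Longrightarrow> J x *v w = \<partial> w E x"
  by (intro jacobian_vector_mult exp_differentiable)

lemma smooth_J: "smooth_on (ball 0 \<delta>) J"
  by (intro smooth_on_jacobian open_ball smooth_exp)

lemma J_differentiable: "x \<in> ball 0 \<delta> \<Longrightarrow> J differentiable (at x)"
  by (rule smooth_on_differentiable[OF smooth_J])

lemma J_derivative_mult: "x \<in> ball 0 \<delta> \<Longrightarrow> \<partial> a J x *v w = \<partial> a (\<partial> w E) x"
  by (rule directional_derivative_jacobian[OF open_ball _ smooth_exp])

lemma J_derivative_commute: "x \<in> ball 0 \<delta> \<Longrightarrow> \<partial> a J x *v b = \<partial> b J x *v a"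
  using second_derivative_symmetric[OF smooth_onD[OF smooth_exp] open_ball] by (simp add: J_derivative_mult)

lemma J_second_derivative_mult:
  assumes x: "x \<in> ball 0 \<delta>"
  shows "\<partial> a (\<partial> b J) x *v w = \<partial> a (\<partial> b (\<partial> w E)) x"
proof -
  have "\<partial> a (\<partial> b J) x *v w = \<partial> a (\<lambda>y. \<partial> b J y *v w) x"
    by (intro directional_derivative_matrix_vector[symmetric] smooth_on_differentiable[OF _ x]
        smooth_intros smooth_J)
  also have "\<dots> = \<partial> a (\<partial> b (\<partial> w E)) x"
    by (intro directional_derivative_cong[OF open_ball x] J_derivative_mult)
  finally show ?thesis .
qed

lemma J_second_derivative_commute:
  assumes x: "x \<in> ball 0 \<delta>"
  shows "\<partial> w (\<partial> u J) x *v u = \<partial> u (\<partial> u J) x *v w"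
proof -
  have "\<partial> w (\<partial> u (\<partial> u E)) x = \<partial> u (\<partial> w (\<partial> u E)) x"
    by (intro second_derivative_symmetric[OF _ open_ball x] smooth_onD
        smooth_on_directional_derivative smooth_exp)
  also have "\<dots> = \<partial> u (\<partial> u (\<partial> w E)) x"
    by (intro directional_derivative_cong[OF open_ball x])
      (rule second_derivative_symmetric[OF smooth_onD[OF smooth_exp] open_ball])
  finally show ?thesis by (simp add: J_second_derivative_mult[OF x])
qed

definition connection :: "real^'n \<Rightarrow> real^'n \<Rightarrow> real^'n^'n" where
  "connection u x = matrix (\<Gamma> (E x) (\<partial> u E x))"

definition covariant_derivative :: "real^'n \<Rightarrow> (real^'n \<Rightarrow> real^'n^'n) \<Rightarrow> real^'n \<Rightarrow> real^'n^'n" where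
  "covariant_derivative u F x = \<partial> u F x + connection u x ** F x"

definition curvature :: "real^'n \<Rightarrow> real^'n \<Rightarrow> real^'n^'n" where
  "curvature u x = jacobi_matrix G (E x) (\<partial> u E x)"

text \<open>With \<open>W = t J\<close> the matrix of Jacobi fields along the ray, \<open>(\<nabla>W) W\<^sup>-\<^sup>1 = t\<^sup>-\<^sup>1 + shape\<close>.\<close>

definition shape :: "real^'n \<Rightarrow> real^'n \<Rightarrow> real^'n^'n" where
  "shape u x = covariant_derivative u J x ** matrix_inv (J x)"

lemma connection_mult: "connection u x *v w = \<Gamma> (E x) (\<partial> u E x) w"
  by (simp add: connection_def christoffel_matrix_mult)

lemma curvature_mult: "x \<in> ball 0 \<delta> \<Longrightarrow> curvature u x *v w = jacobi_at G (E x) (\<partial> u E x) w"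
  by (simp add: curvature_def jacobi_matrix_mult exp_in_domain)

lemma exp_image: "E ` ball 0 \<delta> \<subseteq> \<Omega>"
  using exp_in_domain by blast

lemmas smooth_christoffel_along =
  smooth_on_bilinear_family[OF bilinear_christoffel smooth_christoffel open_ball exp_image smooth_exp]

lemmas smooth_christoffel_derivative_along =
  smooth_on_bilinear_family[OF bilinear_christoffel_derivative smooth_christoffel_derivative
    open_ball exp_image smooth_exp]

lemma smooth_connection: "smooth_on (ball 0 \<delta>) (connection u)"
  by (rule smooth_on_matrix_vectorI[OF open_ball], unfold connection_mult)
    (intro smooth_christoffel_along smooth_intros smooth_exp)

lemma smooth_curvature: "smooth_on (ball 0 \<delta>) (curvature u)"
proof (rule smooth_on_matrix_vectorI[OF open_ball])
  fix w
  let ?a = "\<partial> u E"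
  have "smooth_on (ball 0 \<delta>) (\<lambda>x. \<Sum>i\<in>Basis. (?a x \<bullet> i) *\<^sub>R D\<Gamma> (E x) i (?a x) w)"
    by (intro smooth_intros smooth_on_linear_compose[OF _ bounded_linear_inner_left]
        smooth_christoffel_derivative_along smooth_exp open_ball)
  then have "smooth_on (ball 0 \<delta>) (\<lambda>x. D\<Gamma> (E x) (?a x) (?a x) w)"
    by (rule smooth_on_cong[OF open_ball, rotated])
      (intro linear_sum_Basis[symmetric] linear_christoffel_derivative exp_in_domain)
  then have "smooth_on (ball 0 \<delta>) (\<lambda>x. D\<Gamma> (E x) w (?a x) (?a x) - D\<Gamma> (E x) (?a x) (?a x) w +
      \<Gamma> (E x) w (\<Gamma> (E x) (?a x) (?a x)) - \<Gamma> (E x) (?a x) (\<Gamma> (E x) (?a x) w))"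
    by (intro smooth_intros smooth_christoffel_along smooth_christoffel_derivative_along smooth_exp open_ball)
  then show "smooth_on (ball 0 \<delta>) (\<lambda>x. curvature u x *v w)"
    by (rule smooth_on_cong[OF open_ball, rotated]) (simp add: curvature_mult jacobi_at_eq exp_in_domain)
qed

lemma smooth_covariant_derivative:
  "smooth_on (ball 0 \<delta>) F \<Longrightarrow> smooth_on (ball 0 \<delta>) (covariant_derivative u F)"
  unfolding covariant_derivative_def[abs_def] by (intro smooth_intros smooth_connection open_ball)

lemma smooth_shape: "smooth_on (ball 0 \<delta>) (shape u)"
  unfolding shape_def[abs_def]
  by (intro smooth_intros smooth_covariant_derivative smooth_on_matrix_inv smooth_J open_ball regular)

lemma covariant_derivative_J: "x \<in> ball 0 \<delta> \<Longrightarrow> covariant_derivative u J x = shape u x ** J x"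
  by (simp add: shape_def matrix_inv_left regular flip: matrix_mul_assoc)

lemma curvature_along_geodesic:
  assumes t: "t *\<^sub>R u \<in> ball 0 \<delta>"
  defines "x \<equiv> t *\<^sub>R u"
  shows "curvature u x *v w = D\<Gamma> (E x) w (\<partial> u E x) (\<partial> u E x)
    - \<partial> u (connection u) x *v w - connection u x *v (connection u x *v w)"
proof -
  let ?a = "\<partial> u E x"
  have x: "x \<in> ball 0 \<delta>" using t by (simp add: x_def)
  have Ex: "E x \<in> \<Omega>" by (rule exp_in_domain[OF x])
  have "\<partial> u (connection u) x *v w = \<partial> u (\<lambda>y. connection u y *v w) x"
    by (intro directional_derivative_matrix_vector[symmetric]
        smooth_on_differentiable[OF smooth_connection x])
  also have "\<dots> = \<partial> u (\<lambda>y. \<Gamma> (E y) (\<partial> u E y) w) x"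
    by (simp add: connection_mult)
  also have "\<dots> = D\<Gamma> (E x) ?a ?a w + \<Gamma> (E x) (\<partial> u (\<partial> u E) x) w + \<Gamma> (E x) ?a (\<partial> u (\<lambda>_. w) x)"
    by (intro directional_derivative_christoffel Ex smooth_on_differentiable[OF _ x] smooth_intros smooth_exp)
  also have "\<dots> = D\<Gamma> (E x) ?a ?a w - \<Gamma> (E x) (\<Gamma> (E x) ?a ?a) w"
    using radial_geodesic[OF t] by (simp add: x_def christoffel_linear)
  finally show ?thesis
    by (simp add: curvature_mult[OF x] jacobi_at_eq[OF Ex] connection_mult christoffel_commute[OF Ex, of w])
qed

lemma open_scaled_ball: "open ((\<lambda>a. t *\<^sub>R a) -` ball (0 :: real^'n) \<delta>)"
  by (intro open_vimage open_ball continuous_intros)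

lemma smooth_scaled:
  fixes F :: "real^'n \<Rightarrow> 'b::real_normed_vector"
  assumes "smooth_on (ball 0 \<delta>) F"
  shows "smooth_on ((\<lambda>a. t *\<^sub>R a) -` ball 0 \<delta>) (\<lambda>a. F (t *\<^sub>R a))"
  by (rule smooth_on_compose[OF open_scaled_ball _
      smooth_on_linear[OF open_scaled_ball bounded_linear_scaleR_right] assms])
    auto

lemma directional_derivative_scaled:
  assumes "F differentiable (at (t *\<^sub>R u))"
  shows "\<partial> w (\<lambda>a. F (t *\<^sub>R a)) u = t *\<^sub>R \<partial> w F (t *\<^sub>R u)"
  using directional_derivative_chain[OF
      bounded_linear_imp_has_derivative[OF bounded_linear_scaleR_right] assms]
  by (simp add: directional_derivative_scaleR[OF assms])

lemma smooth_velocity: "smooth_on ((\<lambda>a. t *\<^sub>R a) -` ball 0 \<delta>) (\<lambda>a. J (t *\<^sub>R a) *v a)"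
  by (intro smooth_intros smooth_scaled smooth_J open_scaled_ball smooth_on_linear bounded_linear_ident)

lemma velocity_variation:
  assumes t: "t *\<^sub>R u \<in> ball 0 \<delta>"
  shows "\<partial> w (\<lambda>a. J (t *\<^sub>R a) *v a) u = t *\<^sub>R (\<partial> u J (t *\<^sub>R u) *v w) + J (t *\<^sub>R u) *v w"
proof -
  have "(\<lambda>a. J (t *\<^sub>R a)) differentiable (at u)"
    by (rule smooth_on_differentiable[OF smooth_scaled[OF smooth_J]]) (use t in simp)
  then have "\<partial> w (\<lambda>a. J (t *\<^sub>R a) *v a) u = J (t *\<^sub>R u) *v \<partial> w (\<lambda>a. a) u + \<partial> w (\<lambda>a. J (t *\<^sub>R a)) u *v u"
    by (intro directional_derivative_bilinear[OF bounded_bilinear_matrix_vector_mult]) simp_all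
  then show ?thesis
    by (simp add: directional_derivative_bounded_linear[OF bounded_linear_ident]
        directional_derivative_scaled[OF J_differentiable[OF t]] matrix_vector_mult.scaleR_left
        J_derivative_commute[OF t, of w])
qed

lemma
  assumes t: "t *\<^sub>R u \<in> ball 0 \<delta>"
  shows acceleration_differentiable: "(\<lambda>a. \<partial> a J (t *\<^sub>R a) *v a) differentiable (at u)"
    and acceleration_variation: "\<partial> w (\<lambda>a. \<partial> a J (t *\<^sub>R a) *v a) u =
      t *\<^sub>R (\<partial> u (\<partial> u J) (t *\<^sub>R u) *v w) + 2 *\<^sub>R (\<partial> u J (t *\<^sub>R u) *v w)"
proof -
  let ?x = "t *\<^sub>R u" and ?B = "\<lambda>y a b. \<partial> a J y *v b"
  have bilinear: "bilinear (?B y)" if "y \<in> ball 0 \<delta>" for y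
    unfolding bilinear_def using linear_frechet_derivative[OF J_differentiable[OF that]]
    by (auto intro!: linearI simp: linear_add linear_cmul matrix_vector_mult.add_left
        matrix_vector_mult.add_right matrix_vector_mult.scaleR_left matrix_vector_mult.scaleR_right)
  have smooth: "smooth_on (ball 0 \<delta>) (\<lambda>y. ?B y a b)" for a b
    by (intro smooth_intros smooth_J open_ball)
  have identity: "smooth_on S (\<lambda>a. a)" if "open S" for S :: "(real^'n) set"
    by (rule smooth_on_linear[OF that bounded_linear_ident])
  have "smooth_on ((\<lambda>a. t *\<^sub>R a) -` ball 0 \<delta>) (\<lambda>a. \<partial> a J (t *\<^sub>R a) *v a)"
    by (rule smooth_on_bilinear_family[OF bilinear smooth open_scaled_ball _
        smooth_scaled[OF identity] identity identity])
      (auto intro: open_scaled_ball)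
  then show "(\<lambda>a. \<partial> a J (t *\<^sub>R a) *v a) differentiable (at u)"
    by (rule smooth_on_differentiable) (use t in simp)
  have "\<partial> w (\<lambda>a. ?B (t *\<^sub>R a) a a) u = \<partial> (\<partial> w (\<lambda>a. t *\<^sub>R a) u) (\<lambda>y. ?B y u u) ?x +
      ?B ?x (\<partial> w (\<lambda>a. a) u) u + ?B ?x u (\<partial> w (\<lambda>a. a) u)"
    by (rule directional_derivative_bilinear_family[where B = ?B and f = "\<lambda>a. t *\<^sub>R a",
          OF open_ball t bilinear smooth]) simp_all
  also have "\<dots> = t *\<^sub>R \<partial> w (\<lambda>y. \<partial> u J y *v u) ?x + 2 *\<^sub>R (\<partial> u J ?x *v w)"
    using smooth_on_differentiable[OF smooth t, of u u]
    by (simp add: directional_derivative_bounded_linear bounded_linear_scaleR_right bounded_linear_ident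
        directional_derivative_scaleR J_derivative_commute[OF t, of w] scaleR_2)
  also have "\<partial> w (\<lambda>y. \<partial> u J y *v u) ?x = \<partial> w (\<partial> u J) ?x *v u"
    by (intro directional_derivative_matrix_vector smooth_on_differentiable[OF _ t] smooth_intros smooth_J)
  also have "\<dots> = \<partial> u (\<partial> u J) ?x *v w"
    by (rule J_second_derivative_commute[OF t])
  finally show "\<partial> w (\<lambda>a. \<partial> a J (t *\<^sub>R a) *v a) u =
      t *\<^sub>R (\<partial> u (\<partial> u J) ?x *v w) + 2 *\<^sub>R (\<partial> u J ?x *v w)" .
qed

lemma
  assumes t: "t *\<^sub>R u \<in> ball 0 \<delta>"
  defines "x \<equiv> t *\<^sub>R u"
  shows christoffel_velocity_differentiable:
      "(\<lambda>a. \<Gamma> (E (t *\<^sub>R a)) (J (t *\<^sub>R a) *v a) (J (t *\<^sub>R a) *v a)) differentiable (at u)"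
    and christoffel_velocity_variation:
      "\<partial> w (\<lambda>a. \<Gamma> (E (t *\<^sub>R a)) (J (t *\<^sub>R a) *v a) (J (t *\<^sub>R a) *v a)) u =
        t *\<^sub>R D\<Gamma> (E x) (J x *v w) (\<partial> u E x) (\<partial> u E x) +
        2 *\<^sub>R (connection u x *v (t *\<^sub>R (\<partial> u J x *v w) + J x *v w))"
proof -
  let ?U = "(\<lambda>a. t *\<^sub>R a) -` ball (0 :: real^'n) \<delta>"
  have x: "x \<in> ball 0 \<delta>" and u: "u \<in> ?U" using t by (simp_all add: x_def)
  note Ex = exp_in_domain[OF x]
  let ?velocity = "\<lambda>a. J (t *\<^sub>R a) *v a"
  let ?\<Gamma> = "\<lambda>a. \<Gamma> (E (t *\<^sub>R a)) (?velocity a) (?velocity a)"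
  have "smooth_on ?U ?\<Gamma>"
    using exp_in_domain
    by (intro smooth_on_bilinear_family[OF bilinear_christoffel smooth_christoffel open_scaled_ball]
        smooth_scaled[OF smooth_exp] smooth_velocity) auto
  then show "?\<Gamma> differentiable (at u)"
    using u by (rule smooth_on_differentiable)
  have "(\<lambda>a. E (t *\<^sub>R a)) differentiable (at u)" "?velocity differentiable (at u)"
    by (intro smooth_on_differentiable[OF _ u] smooth_scaled[OF smooth_exp] smooth_velocity)+
  then have "\<partial> w ?\<Gamma> u = D\<Gamma> (E x) (\<partial> w (\<lambda>a. E (t *\<^sub>R a)) u) (?velocity u) (?velocity u)
      + \<Gamma> (E x) (\<partial> w ?velocity u) (?velocity u) + \<Gamma> (E x) (?velocity u) (\<partial> w ?velocity u)"
    unfolding x_def by (intro directional_derivative_christoffel exp_in_domain t)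
  moreover have "\<partial> w (\<lambda>a. E (t *\<^sub>R a)) u = t *\<^sub>R (J x *v w)"
    using directional_derivative_scaled[OF exp_differentiable[OF t]] by (simp add: x_def J_mult[OF t])
  moreover have "\<partial> w ?velocity u = t *\<^sub>R (\<partial> u J x *v w) + J x *v w"
    unfolding x_def by (rule velocity_variation[OF t])
  moreover have "?velocity u = \<partial> u E x"
    using J_mult[OF t] by (simp add: x_def)
  ultimately show "\<partial> w ?\<Gamma> u = t *\<^sub>R D\<Gamma> (E x) (J x *v w) (\<partial> u E x) (\<partial> u E x) +
      2 *\<^sub>R (connection u x *v (t *\<^sub>R (\<partial> u J x *v w) + J x *v w))"
    using christoffel_commute[OF Ex, of _ "\<partial> u E x"]
    by (simp add: connection_mult scaleR_2 linear_cmul[OF linear_christoffel_derivative[OF Ex]])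
qed

text \<open>The derivative of the geodesic equation for \<open>s \<mapsto> E (s a)\<close> at \<open>s = t\<close> with respect to the
  initial velocity \<open>a\<close>.\<close>

lemma geodesic_variation_equation:
  assumes t: "t *\<^sub>R u \<in> ball 0 \<delta>"
  defines "x \<equiv> t *\<^sub>R u"
  shows "t *\<^sub>R (\<partial> u (\<partial> u J) x *v w) + 2 *\<^sub>R (\<partial> u J x *v w) + t *\<^sub>R D\<Gamma> (E x) (J x *v w) (\<partial> u E x) (\<partial> u E x)
    + 2 *\<^sub>R (connection u x *v (t *\<^sub>R (\<partial> u J x *v w) + J x *v w)) = 0"
proof -
  let ?force = "\<lambda>a. \<Gamma> (E (t *\<^sub>R a)) (J (t *\<^sub>R a) *v a) (J (t *\<^sub>R a) *v a)"
  have "\<partial> a J (t *\<^sub>R a) *v a + ?force a = 0" if "t *\<^sub>R a \<in> ball 0 \<delta>" for a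
    by (simp add: J_mult[OF that] J_derivative_mult[OF that] radial_geodesic[OF that])
  then have "\<partial> w (\<lambda>a. \<partial> a J (t *\<^sub>R a) *v a + ?force a) u = \<partial> w (\<lambda>a. 0) u"
    using t by (intro directional_derivative_cong[OF open_scaled_ball]) auto
  then have "\<partial> w (\<lambda>a. \<partial> a J (t *\<^sub>R a) *v a) u + \<partial> w ?force u = 0"
    by (simp add: directional_derivative_add acceleration_differentiable[OF t]
        christoffel_velocity_differentiable[OF t])
  then show ?thesis
    unfolding christoffel_velocity_variation[OF t] acceleration_variation[OF t]
    by (simp add: x_def add.assoc)
qed

lemma second_covariant_derivative_J:
  assumes x: "x \<in> ball 0 \<delta>"
  shows "covariant_derivative u (covariant_derivative u J) x = \<partial> u (\<partial> u J) x + \<partial> u (connection u) x ** J x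
    + 2 *\<^sub>R (connection u x ** \<partial> u J x) + connection u x ** (connection u x ** J x)"
proof -
  have "(\<lambda>y. connection u y ** J y) differentiable (at x)" "\<partial> u J differentiable (at x)"
    by (intro smooth_on_differentiable[OF _ x] smooth_intros smooth_connection smooth_J open_ball)+
  then have "\<partial> u (covariant_derivative u J) x =
      \<partial> u (\<partial> u J) x + (connection u x ** \<partial> u J x + \<partial> u (connection u) x ** J x)"
    unfolding covariant_derivative_def[abs_def]
    by (simp add: directional_derivative_add directional_derivative_bilinear[OF bounded_bilinear_matrix_mult]
        smooth_on_differentiable[OF smooth_connection x] J_differentiable[OF x])
  then show ?thesis
    by (simp add: covariant_derivative_def matrix_mult.add_right scaleR_2)
qed

lemma jacobi_equation:
  assumes t: "t *\<^sub>R u \<in> ball 0 \<delta>"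
  defines "x \<equiv> t *\<^sub>R u"
  shows "t *\<^sub>R (covariant_derivative u (covariant_derivative u J) x + curvature u x ** J x)
    + 2 *\<^sub>R covariant_derivative u J x = 0"
proof -
  have x: "x \<in> ball 0 \<delta>" using t by (simp add: x_def)
  have "(t *\<^sub>R (covariant_derivative u (covariant_derivative u J) x + curvature u x ** J x)
      + 2 *\<^sub>R covariant_derivative u J x) *v w = 0 *v w" for w
    using geodesic_variation_equation[OF t, of w] curvature_along_geodesic[OF t, of "J x *v w"]
    by (simp add: x_def[symmetric] second_covariant_derivative_J[OF x] covariant_derivative_def[of u J x]
        matrix_vector_mult.add_left matrix_vector_mult.add_right matrix_vector_mult.scaleR_left
        matrix_vector_mult.scaleR_right flip: matrix_vector_mul_assoc)
     (simp add: algebra_simps)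
  then show ?thesis by (subst matrix_eq) blast
qed

lemma riccati:
  assumes t: "t *\<^sub>R u \<in> ball 0 \<delta>"
  defines "x \<equiv> t *\<^sub>R u"
  shows "t *\<^sub>R (\<partial> u (shape u) x + (connection u x ** shape u x - shape u x ** connection u x)
    + shape u x ** shape u x + curvature u x) + 2 *\<^sub>R shape u x = 0"
proof -
  have x: "x \<in> ball 0 \<delta>" using t by (simp add: x_def)
  let ?P = "connection u x" and ?V = "shape u x"
  have J_derivative: "\<partial> u J x = ?V ** J x - ?P ** J x"
    using covariant_derivative_J[OF x, of u] by (simp add: covariant_derivative_def algebra_simps)
  have "\<partial> u (covariant_derivative u J) x = \<partial> u (\<lambda>y. shape u y ** J y) x"
    by (intro directional_derivative_cong[OF open_ball x] covariant_derivative_J)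
  also have "\<dots> = ?V ** \<partial> u J x + \<partial> u (shape u) x ** J x"
    by (intro directional_derivative_bilinear[OF bounded_bilinear_matrix_mult] J_differentiable[OF x]
        smooth_on_differentiable[OF smooth_shape x])
  finally have "covariant_derivative u (covariant_derivative u J) x =
      (\<partial> u (shape u) x + (?P ** ?V - ?V ** ?P) + ?V ** ?V) ** J x"
    by (simp add: covariant_derivative_def[of u "covariant_derivative u J"] covariant_derivative_J[OF x]
        J_derivative matrix_mult.add_left matrix_mult.diff_left matrix_mult.diff_right matrix_mul_assoc)
  then have "(t *\<^sub>R (\<partial> u (shape u) x + (?P ** ?V - ?V ** ?P) + ?V ** ?V + curvature u x)
      + 2 *\<^sub>R ?V) ** J x = 0"
    using jacobi_equation[OF t]
    by (simp add: x_def[symmetric] covariant_derivative_J[OF x] matrix_mult.add_left matrix_mult.scaleR_left)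
  then have "(t *\<^sub>R (\<partial> u (shape u) x + (?P ** ?V - ?V ** ?P) + ?V ** ?V + curvature u x) + 2 *\<^sub>R ?V)
      ** J x ** matrix_inv (J x) = 0"
    by (simp add: matrix_mult.zero_left)
  then show ?thesis
    by (simp add: matrix_inv_right[OF regular[OF x]] flip: matrix_mul_assoc)
qed

lemma trace_riccati:
  assumes t: "t *\<^sub>R u \<in> ball 0 \<delta>"
  defines "x \<equiv> t *\<^sub>R u"
  shows "t * (trace (\<partial> u (shape u) x) + trace (shape u x ** shape u x) + trace (curvature u x))
    + 2 * trace (shape u x) = 0"
proof -
  have "trace (t *\<^sub>R (\<partial> u (shape u) x + (connection u x ** shape u x - shape u x ** connection u x)
    + shape u x ** shape u x + curvature u x) + 2 *\<^sub>R shape u x) = 0"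
    unfolding x_def riccati[OF t] by (simp add: trace_def)
  then show ?thesis
    by (simp add: trace_add trace_sub trace_scaleR trace_mul_sym[of "connection u x"])
qed

lemma pullback_metric_derivative:
  assumes x: "x \<in> ball 0 \<delta>"
  shows "\<partial> u (pullback_metric G E) x = transpose (covariant_derivative u J x) ** G (E x) ** J x
    + transpose (J x) ** G (E x) ** covariant_derivative u J x"
proof -
  let ?P = "connection u x" and ?g = "G (E x)"
  have Ex: "E x \<in> \<Omega>" by (rule exp_in_domain[OF x])
  have smooth: "smooth_on (ball 0 \<delta>) (\<lambda>y. transpose (J y))" "smooth_on (ball 0 \<delta>) (\<lambda>y. G (E y))"
    by (intro smooth_on_linear_compose[OF open_ball bounded_linear_transpose] smooth_J
        smooth_on_compose[OF open_ball exp_image smooth_exp smooth_metric])+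
  note differentiable = smooth_on_differentiable[OF smooth(1) x] smooth_on_differentiable[OF smooth(2) x]
    smooth_on_differentiable[OF smooth_on_matrix_mult[OF open_ball smooth] x] J_differentiable[OF x]
  have "\<partial> u (\<lambda>y. G (E y)) x = transpose ?P ** ?g + ?g ** ?P"
    using directional_derivative_compose[OF exp_differentiable[OF x] metric_differentiable[OF Ex]]
      metric_compatible_matrix[OF Ex] by (simp add: connection_def)
  then have "\<partial> u (pullback_metric G E) x = transpose (J x) ** ?g ** \<partial> u J x +
      (transpose (J x) ** (transpose ?P ** ?g + ?g ** ?P) + transpose (\<partial> u J x) ** ?g) ** J x"
    unfolding pullback_metric_def[abs_def]
    by (simp add: directional_derivative_bilinear[OF bounded_bilinear_matrix_mult] differentiable
        directional_derivative_linear_compose[OF bounded_linear_transpose])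
  moreover have "transpose (A + B) = transpose A + transpose B" for A B :: "real^'n^'n"
    by (simp add: transpose_def vec_eq_iff)
  ultimately show ?thesis
    by (simp add: covariant_derivative_def matrix_mult.add_left matrix_mult.add_right matrix_mul_assoc
        matrix_transpose_mul)
qed

lemma smooth_pullback_metric: "smooth_on (ball 0 \<delta>) (pullback_metric G E)"
  unfolding pullback_metric_def[abs_def]
  by (intro smooth_intros smooth_on_linear_compose[OF open_ball bounded_linear_transpose] smooth_J
      smooth_on_compose[OF open_ball exp_image smooth_exp smooth_metric] open_ball)

lemma det_pullback_metric: "det (pullback_metric G E x) = (det (J x))\<^sup>2 * det (G (E x))"
  by (simp add: pullback_metric_def det_mul power2_eq_square)

lemma volume_derivative:
  assumes x: "x \<in> ball 0 \<delta>"
  shows "\<partial> u (\<lambda>y. det (pullback_metric G E y)) x = 2 * det (pullback_metric G E x) * trace (shape u x)"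
proof -
  let ?h = "pullback_metric G E x"
  define K where "K = matrix_inv (J x) ** covariant_derivative u J x"
  have h: "det ?h \<noteq> 0"
    using regular[OF x] det_metric_nonzero[OF exp_in_domain[OF x]] by (simp add: det_pullback_metric)
  have JK: "J x ** K = covariant_derivative u J x"
    by (simp add: K_def matrix_mul_assoc matrix_inv_right[OF regular[OF x]])
  have "\<partial> u (pullback_metric G E) x = transpose K ** ?h + ?h ** K"
    by (simp add: pullback_metric_derivative[OF x] JK[symmetric] pullback_metric_def matrix_transpose_mul
        matrix_mul_assoc)
  moreover have "trace K = trace (shape u x)"
    by (simp add: K_def shape_def trace_mul_sym[of "matrix_inv (J x)"])
  moreover have "\<partial> u (\<lambda>y. det (pullback_metric G E y)) x = \<partial> (\<partial> u (pullback_metric G E) x) det ?h"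
    by (intro directional_derivative_compose smooth_on_differentiable[OF smooth_pullback_metric x]
        det_differentiable)
  ultimately show ?thesis
    by (simp add: directional_derivative_det[OF h] trace_matrix_inv_mult_symmetrized[OF h])
qed

lemma ray_derivative:
  assumes "smooth_on (ball 0 \<delta>) F" "t *\<^sub>R u \<in> ball 0 \<delta>"
  shows "((\<lambda>s. F (s *\<^sub>R u)) has_vector_derivative \<partial> u F (t *\<^sub>R u)) (at t)"
  using has_vector_derivative_compose[where c = "\<lambda>s. s *\<^sub>R u" and t = t,
      OF _ smooth_on_differentiable[OF assms]]
    has_vector_derivative_affine[of 0 u t] by simp

lemma ray_tendsto:
  assumes "smooth_on (ball 0 \<delta>) F"
  shows "((\<lambda>t. F (t *\<^sub>R u)) \<longlongrightarrow> F 0) (at 0)"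
  using has_vector_derivative_continuous[OF ray_derivative[OF assms, of 0]] origin_in_ball
  by (simp add: continuous_within)

lemma radial_isometry:
  assumes t: "t *\<^sub>R u \<in> ball 0 \<delta>"
  shows "u \<bullet> (pullback_metric G E (t *\<^sub>R u) *v u) = u \<bullet> u"
proof -
  let ?speed = "\<lambda>s. u \<bullet> (pullback_metric G E (s *\<^sub>R u) *v u)" and ?I = "(\<lambda>s. s *\<^sub>R u) -` ball 0 \<delta>"
  have geodesic: "covariant_derivative u J (s *\<^sub>R u) *v u = 0" if "s *\<^sub>R u \<in> ball 0 \<delta>" for s
    using radial_geodesic[OF that] that
    by (simp add: covariant_derivative_def matrix_vector_mult.add_left connection_mult
        J_derivative_mult J_mult flip: matrix_vector_mul_assoc)
  have "(?speed has_vector_derivative 0) (at s within ?I)" if "s \<in> ?I" for s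
  proof (rule has_vector_derivative_at_within)
    have s: "s *\<^sub>R u \<in> ball 0 \<delta>" using that by simp
    have "u \<bullet> (\<partial> u (pullback_metric G E) (s *\<^sub>R u) *v u) = 0"
      by (simp add: pullback_metric_derivative[OF s] matrix_vector_mult.add_left inner_add_right
          congruence_inner geodesic[OF s])
    then show "(?speed has_vector_derivative 0) (at s)"
      using bounded_linear.has_vector_derivative[OF bounded_linear_compose[OF bounded_linear_inner_right[of u]
            matrix_vector_mult.bounded_linear_left[of u]] ray_derivative[OF smooth_pullback_metric s]]
      by simp
  qed
  moreover have "convex ?I"
    by (intro convex_linear_vimage convex_ball) (auto intro!: linearI simp: scaleR_add_left)
  ultimately obtain c where "?speed s = c" if "s \<in> ?I" for s
    using has_vector_derivative_zero_constant by blast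
  from this[of t] this[of 0] show ?thesis
    using t origin_in_ball by (simp add: orthonormal_origin)
qed

lemma shape_origin: "shape u 0 = 0"
  using riccati[of 0 u] origin_in_ball by simp

lemma shape_quotient: "((\<lambda>t. shape u (t *\<^sub>R u) /\<^sub>R t) \<longlongrightarrow> \<partial> u (shape u) 0) (at 0)"
  using has_vector_derivative_quotient[OF ray_derivative[OF smooth_shape, of 0 u]] origin_in_ball
  by (simp add: shape_origin)

lemma eventually_ray: "\<forall>\<^sub>F t in at 0. t *\<^sub>R (u :: real^'n) \<in> ball 0 \<delta> \<and> t \<noteq> 0"
proof -
  have "\<forall>\<^sub>F t in nhds 0. t *\<^sub>R u \<in> ball 0 \<delta>"
    using eventually_has_vector_derivative_in_open[OF has_vector_derivative_affine[of 0 u 0]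
        open_ball[of 0 \<delta>]]
      radius by simp
  then show ?thesis by (simp add: eventually_at_filter eventually_mono)
qed

lemma shape_derivative_origin: "3 *\<^sub>R \<partial> u (shape u) 0 = - curvature u 0"
proof -
  let ?V = "shape u" and ?P = "connection u" and ?R = "curvature u"
  let ?F = "\<lambda>x. \<partial> u ?V x + (?P x ** ?V x - ?V x ** ?P x) + ?V x ** ?V x + ?R x"
  have "smooth_on (ball 0 \<delta>) ?F"
    by (intro smooth_intros smooth_shape smooth_connection smooth_curvature open_ball)
  then have "((\<lambda>t. ?F (t *\<^sub>R u) + 2 *\<^sub>R (?V (t *\<^sub>R u) /\<^sub>R t)) \<longlongrightarrow> ?F 0 + 2 *\<^sub>R \<partial> u ?V 0) (at 0)"
    by (intro tendsto_intros ray_tendsto[of ?F] shape_quotient)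
  moreover have "((\<lambda>t. ?F (t *\<^sub>R u) + 2 *\<^sub>R (?V (t *\<^sub>R u) /\<^sub>R t)) \<longlongrightarrow> 0) (at 0)"
  proof (rule tendsto_eventually, rule eventually_mono[OF eventually_ray])
    fix t assume t: "t *\<^sub>R u \<in> ball 0 \<delta> \<and> t \<noteq> 0"
    then have "t *\<^sub>R (2 *\<^sub>R (?V (t *\<^sub>R u) /\<^sub>R t)) = 2 *\<^sub>R ?V (t *\<^sub>R u)" by simp
    then have "t *\<^sub>R (?F (t *\<^sub>R u) + 2 *\<^sub>R (?V (t *\<^sub>R u) /\<^sub>R t)) = 0"
      using riccati[of t u] t by (simp only: scaleR_add_right)
    then show "?F (t *\<^sub>R u) + 2 *\<^sub>R (?V (t *\<^sub>R u) /\<^sub>R t) = 0" using t by simp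
  qed
  ultimately have "?F 0 + 2 *\<^sub>R \<partial> u ?V 0 = 0"
    using tendsto_unique[OF trivial_limit_at] by blast
  then have "3 *\<^sub>R \<partial> u ?V 0 + ?R 0 = 0"
    by (simp add: shape_origin matrix_mult.zero_left matrix_mult.zero_right vec_eq_iff)
  then show ?thesis by (simp add: eq_neg_iff_add_eq_0)
qed

lemma curvature_unit_velocity:
  assumes "v \<bullet> (G (E 0) *v v) = 1"
  obtains u where "norm u = 1" "\<partial> u E 0 = v" "curvature u 0 = jacobi_matrix G (E 0) v"
proof
  let ?u = "matrix_inv (J 0) *v v"
  have Ju: "J 0 *v ?u = v" by (rule matrix_inv_vector_right[OF regular[OF origin_in_ball]])
  then show velocity: "\<partial> ?u E 0 = v" by (simp add: J_mult[OF origin_in_ball])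
  show "norm ?u = 1"
    using pullback_metric_inner[of ?u G E 0 ?u] assms by (simp add: orthonormal_origin Ju norm_eq_1)
  show "curvature ?u 0 = jacobi_matrix G (E 0) v" by (simp add: curvature_def velocity)
qed

end

subsection \<open>Model densities\<close>

definition model_sin :: "int \<Rightarrow> real \<Rightarrow> real" where
  "model_sin \<epsilon> t = (if \<epsilon> = 1 then sin t else sinh t)"

definition model_cos :: "int \<Rightarrow> real \<Rightarrow> real" where
  "model_cos \<epsilon> t = (if \<epsilon> = 1 then cos t else cosh t)"

definition normalized_model_density :: "int \<Rightarrow> nat \<Rightarrow> int \<Rightarrow> real \<Rightarrow> real" where
  "normalized_model_density \<epsilon> N k t = (model_sin \<epsilon> t / t) ^ N * model_cos \<epsilon> t powi k"

text \<open>The mean curvature of geodesic spheres minus its Euclidean value \<open>N / t\<close>.\<close>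

definition model_mean_curvature :: "int \<Rightarrow> real \<Rightarrow> real \<Rightarrow> real \<Rightarrow> real" where
  "model_mean_curvature \<epsilon> N k t =
     N * (model_cos \<epsilon> t / model_sin \<epsilon> t - 1 / t) - of_int \<epsilon> * k * model_sin \<epsilon> t / model_cos \<epsilon> t"

definition model_mean_curvature_derivative :: "int \<Rightarrow> real \<Rightarrow> real \<Rightarrow> real \<Rightarrow> real" where
  "model_mean_curvature_derivative \<epsilon> N k t =
     N * (1 / t\<^sup>2 - 1 / (model_sin \<epsilon> t)\<^sup>2) - of_int \<epsilon> * k / (model_cos \<epsilon> t)\<^sup>2"

text \<open>The value of \<open>tr V\<^sup>2 + tr R\<close> dictated by the trace of the Riccati equation.\<close>

definition model_riccati_term :: "int \<Rightarrow> real \<Rightarrow> real \<Rightarrow> real \<Rightarrow> real" where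
  "model_riccati_term \<epsilon> N k t =
     - (model_mean_curvature_derivative \<epsilon> N k t + 2 * model_mean_curvature \<epsilon> N k t / t)"

lemma model_density_normalized:
  "t \<noteq> 0 \<Longrightarrow> model_density \<epsilon> (int N + 1) k t = t ^ N * normalized_model_density \<epsilon> N k t"
  by (simp add: model_density_def normalized_model_density_def model_sin_def model_cos_def power_divide)

lemma model_sin_pos: "0 < t \<Longrightarrow> t < 1 \<Longrightarrow> model_sin \<epsilon> t > 0"
  using pi_gt3 by (auto simp: model_sin_def intro!: sin_gt_zero)

lemma model_cos_pos: "0 < t \<Longrightarrow> t < 1 \<Longrightarrow> model_cos \<epsilon> t > 0"
  using pi_gt3 by (auto simp: model_cos_def intro!: cos_gt_zero)

lemma normalized_model_density_pos: "0 < t \<Longrightarrow> t < 1 \<Longrightarrow> normalized_model_density \<epsilon> N k t > 0"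
  by (simp add: normalized_model_density_def model_sin_pos model_cos_pos)

lemma DERIV_model_sin: "(model_sin \<epsilon> has_real_derivative model_cos \<epsilon> t) (at t)"
  unfolding model_sin_def[abs_def] model_cos_def
  by (cases "\<epsilon> = 1") (auto intro!: derivative_eq_intros)

lemma DERIV_model_cos: "\<epsilon> \<in> {1, -1} \<Longrightarrow> (model_cos \<epsilon> has_real_derivative - of_int \<epsilon> * model_sin \<epsilon> t) (at t)"
  unfolding model_cos_def[abs_def] model_sin_def by (auto intro!: derivative_eq_intros)

lemma model_cos_squared: "\<epsilon> \<in> {1, -1} \<Longrightarrow> (model_cos \<epsilon> t)\<^sup>2 = 1 - of_int \<epsilon> * (model_sin \<epsilon> t)\<^sup>2"
  by (auto simp: model_cos_def model_sin_def cos_squared_eq cosh_square_eq)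

lemma normalized_model_density_tendsto_1: "(normalized_model_density \<epsilon> N k \<longlongrightarrow> 1) (at_right 0)"
proof -
  have "((\<lambda>t. model_sin \<epsilon> t / t) \<longlongrightarrow> 1) (at_right 0)"
    unfolding model_sin_def by (cases "\<epsilon> = 1") (simp_all, real_asymp+)
  moreover have "(model_cos \<epsilon> \<longlongrightarrow> 1) (at_right 0)"
    unfolding model_cos_def[abs_def] by (cases "\<epsilon> = 1") (simp_all, real_asymp+)
  ultimately have "((\<lambda>t. (model_sin \<epsilon> t / t) ^ N * model_cos \<epsilon> t powi k) \<longlongrightarrow> 1 ^ N * 1 powi k) (at_right 0)"
    by (intro tendsto_intros) auto
  then show ?thesis by (simp add: normalized_model_density_def[abs_def])
qed

lemma DERIV_normalized_model_density:
  assumes "\<epsilon> \<in> {1, -1}" "0 < t" "t < 1"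
  shows "(normalized_model_density \<epsilon> N k has_real_derivative
    normalized_model_density \<epsilon> N k t * model_mean_curvature \<epsilon> (real N) (of_int k) t) (at t)"
proof -
  let ?s = "model_sin \<epsilon> t" and ?c = "model_cos \<epsilon> t"
  note pos = model_sin_pos[OF assms(2,3), of \<epsilon>] model_cos_pos[OF assms(2,3), of \<epsilon>]
  have quotient: "((\<lambda>t. model_sin \<epsilon> t / t) has_real_derivative (?s / t) * (?c / ?s - 1 / t)) (at t)"
    using pos assms(2) by (auto intro!: derivative_eq_intros DERIV_model_sin simp: field_simps)
  have sin_factor: "((\<lambda>t. (model_sin \<epsilon> t / t) ^ N) has_real_derivative
      (?s / t) ^ N * (real N * (?c / ?s - 1 / t))) (at t)"
  proof (cases N)
    case (Suc M)
    then show ?thesis by (intro DERIV_cong[OF DERIV_power[OF quotient]]) simp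
  qed simp
  have "((\<lambda>t. model_cos \<epsilon> t powi k) has_real_derivative
      of_int k * ?c powi (k - 1) * (- of_int \<epsilon> * ?s)) (at t)"
    using pos by (intro DERIV_power_int DERIV_model_cos assms) auto
  then have cos_factor: "((\<lambda>t. model_cos \<epsilon> t powi k) has_real_derivative
      ?c powi k * (- of_int \<epsilon> * of_int k * ?s / ?c)) (at t)"
    using pos by (simp add: power_int_diff mult_ac)
  show ?thesis
    unfolding normalized_model_density_def[abs_def]
    by (rule DERIV_cong[OF DERIV_mult[OF sin_factor cos_factor]])
      (simp add: model_mean_curvature_def algebra_simps)
qed

lemma DERIV_model_mean_curvature:
  assumes "\<epsilon> \<in> {1, -1}" "0 < t" "t < 1"
  shows "(model_mean_curvature \<epsilon> N k has_real_derivative model_mean_curvature_derivative \<epsilon> N k t) (at t)"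
proof -
  let ?s = "model_sin \<epsilon> t" and ?c = "model_cos \<epsilon> t" and ?e = "of_int \<epsilon> :: real"
  note pos = model_sin_pos[OF assms(2,3), of \<epsilon>] model_cos_pos[OF assms(2,3), of \<epsilon>]
  have pythagoras: "?c\<^sup>2 + ?e * ?s\<^sup>2 = 1" using model_cos_squared[OF assms(1), of t] by simp
  have "(model_mean_curvature \<epsilon> N k has_real_derivative
     N * ((- ?e * ?s * ?s - ?c * ?c) / (?s * ?s) + 1 / t\<^sup>2) -
     (?e * k * ?c * ?c - ?e * k * ?s * (- ?e * ?s)) / (?c * ?c)) (at t)"
    unfolding model_mean_curvature_def[abs_def]
    using pos assms
    by (auto intro!: derivative_eq_intros DERIV_model_sin DERIV_model_cos simp: power2_eq_square)
  moreover have "- ?e * ?s * ?s - ?c * ?c = - 1"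
    using pythagoras by (simp add: power2_eq_square algebra_simps)
  moreover have "?e * k * ?c * ?c - ?e * k * ?s * (- ?e * ?s) = ?e * k * (?c\<^sup>2 + ?e * ?s\<^sup>2)"
    by (simp add: power2_eq_square algebra_simps)
  ultimately show ?thesis
    unfolding pythagoras by (simp add: model_mean_curvature_derivative_def power2_eq_square)
qed

lemma model_riccati_term_tendsto:
  assumes "\<epsilon> \<in> {1, -1}"
  shows "(model_riccati_term \<epsilon> N k \<longlongrightarrow> of_int \<epsilon> * (N + 3 * k)) (at_right 0)"
proof -
  from assms consider "\<epsilon> = 1" | "\<epsilon> = -1" by auto
  then show ?thesis
    unfolding model_riccati_term_def[abs_def] model_mean_curvature_derivative_def model_mean_curvature_def
      model_sin_def model_cos_def
    by cases (simp, real_asymp)+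
qed

lemma model_riccati_term_second_order:
  assumes "\<epsilon> \<in> {1, -1}"
  shows "((\<lambda>t. (model_riccati_term \<epsilon> N k t - of_int \<epsilon> * (N + 3 * k)) / t\<^sup>2) \<longlongrightarrow> (N + 15 * k) / 9) (at_right 0)"
proof -
  from assms consider "\<epsilon> = 1" | "\<epsilon> = -1" by auto
  then show ?thesis
    unfolding model_riccati_term_def model_mean_curvature_derivative_def model_mean_curvature_def
      model_sin_def model_cos_def
    by cases (simp, real_asymp)+
qed

subsection \<open>Curvature traces of a model density\<close>

lemma power_mult_tendsto_1_exponent_unique:
  fixes f g :: "real \<Rightarrow> real"
  assumes "(f \<longlongrightarrow> 1) (at_right 0)" "(g \<longlongrightarrow> 1) (at_right 0)" "\<forall>\<^sub>F t in at_right 0. t ^ a * f t = t ^ b * g t"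
  shows "a = b"
proof -
  have not_less: "\<not> a < b" if f: "(f \<longlongrightarrow> 1) (at_right 0)" and g: "(g \<longlongrightarrow> 1) (at_right 0)"
    and eq: "\<forall>\<^sub>F t in at_right 0. t ^ a * f t = t ^ b * g t" for a b and f g :: "real \<Rightarrow> real"
  proof
    assume "a < b"
    have "\<forall>\<^sub>F t in at_right 0. t ^ (b - a) * g t = f t"
      using eq eventually_at_right_less
    proof eventually_elim
      case (elim t)
      have "t ^ b = t ^ a * t ^ (b - a)" using \<open>a < b\<close> by (simp flip: power_add)
      then show ?case using elim by simp
    qed
    moreover have "((\<lambda>t. t ^ (b - a) * g t) \<longlongrightarrow> 0 ^ (b - a) * 1) (at_right 0)"
      by (intro tendsto_intros g)
    ultimately have "(f \<longlongrightarrow> 0 ^ (b - a) * 1) (at_right 0)"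
      by (rule Lim_transform_eventually[rotated])
    then have "(f \<longlongrightarrow> 0) (at_right 0)" using \<open>a < b\<close> by (simp add: zero_power)
    with f show False using tendsto_unique[OF trivial_limit_at_right_real] by force
  qed
  have "\<forall>\<^sub>F t in at_right 0. t ^ b * g t = t ^ a * f t"
    using assms(3) by eventually_elim (rule sym)
  from not_less[OF assms] not_less[OF assms(2,1) this] show ?thesis by simp
qed

locale model_exponential_coordinates = exponential_coordinates \<Omega> G E \<delta>
  for \<Omega> :: "(real^'n) set" and G E \<delta> +
  fixes \<epsilon> k :: int and N :: nat
  assumes sign: "\<epsilon> \<in> {1, -1}"
    and density: "\<And>x. 0 < norm x \<Longrightarrow> norm x < \<delta> \<Longrightarrow>
      norm x ^ (CARD('n) - 1) * sqrt (det (pullback_metric G E x)) = model_density \<epsilon> (int N + 1) k (norm x)"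
begin

lemma eventually_ray_right: "\<forall>\<^sub>F t in at_right (0::real). 0 < t \<and> t < \<delta> \<and> t < 1"
  using radius by (auto simp: eventually_at_right[of 0 1] intro!: exI[of _ "min \<delta> 1"])

lemma ray_tendsto_right:
  assumes "smooth_on (ball 0 \<delta>) F"
  shows "((\<lambda>t. F (t *\<^sub>R u)) \<longlongrightarrow> F 0) (at_right 0)"
  by (rule tendsto_mono[OF _ ray_tendsto[OF assms]]) (simp add: at_le)

lemma ray_in_ball: "norm u = 1 \<Longrightarrow> 0 < t \<Longrightarrow> t < \<delta> \<Longrightarrow> t *\<^sub>R (u :: real^'n) \<in> ball 0 \<delta>"
  by simp

lemma density_along_ray:
  assumes "norm u = 1" "0 < t" "t < \<delta>"
  shows "t ^ (CARD('n) - 1) * sqrt (det (pullback_metric G E (t *\<^sub>R u))) =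
    t ^ N * normalized_model_density \<epsilon> N k t"
  using density[of "t *\<^sub>R u"] assms by (simp add: model_density_normalized)

lemma dimension_eq: "CARD('n) - 1 = N"
proof (rule power_mult_tendsto_1_exponent_unique)
  define u :: "real^'n" where "u = axis undefined 1"
  have u: "norm u = 1" by (simp add: u_def)
  have "smooth_on (ball 0 \<delta>) (\<lambda>x. det (pullback_metric G E x))"
    by (intro smooth_intros smooth_pullback_metric open_ball)
  from tendsto_real_sqrt[OF ray_tendsto_right[OF this]]
  show "((\<lambda>t. sqrt (det (pullback_metric G E (t *\<^sub>R u)))) \<longlongrightarrow> 1) (at_right 0)"
    by (simp add: orthonormal_origin)
  show "(normalized_model_density \<epsilon> N k \<longlongrightarrow> 1) (at_right 0)"
    by (rule normalized_model_density_tendsto_1)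
  show "\<forall>\<^sub>F t in at_right 0. t ^ (CARD('n) - 1) * sqrt (det (pullback_metric G E (t *\<^sub>R u))) =
      t ^ N * normalized_model_density \<epsilon> N k t"
    using eventually_ray_right by eventually_elim (intro density_along_ray[OF u], auto)
qed

context
  fixes u :: "real^'n"
  assumes unit: "norm u = 1"
begin

lemma volume_along_ray:
  assumes t: "0 < t" "t < \<delta>" "t < 1"
  shows "det (pullback_metric G E (t *\<^sub>R u)) = (normalized_model_density \<epsilon> N k t)\<^sup>2"
proof -
  have "sqrt (det (pullback_metric G E (t *\<^sub>R u))) = normalized_model_density \<epsilon> N k t"
    using density_along_ray[OF unit t(1,2)] t(1) unfolding dimension_eq by simp
  then show ?thesis
    using normalized_model_density_pos[OF t(1,3), of \<epsilon> N k]
    by (metis real_sqrt_gt_0_iff real_sqrt_pow2 less_imp_le)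
qed

lemma trace_shape:
  assumes t: "0 < t" "t < \<delta>" "t < 1"
  shows "trace (shape u (t *\<^sub>R u)) = model_mean_curvature \<epsilon> (real N) (of_int k) t"
proof -
  let ?vol = "\<lambda>x. det (pullback_metric G E x)" and ?F = "normalized_model_density \<epsilon> N k"
  have "smooth_on (ball 0 \<delta>) ?vol"
    by (intro smooth_intros smooth_pullback_metric open_ball)
  from ray_derivative[OF this ray_in_ball[OF unit t(1,2)]]
  have "((\<lambda>s. ?vol (s *\<^sub>R u)) has_real_derivative 2 * ?vol (t *\<^sub>R u) * trace (shape u (t *\<^sub>R u))) (at t)"
    by (simp add: volume_derivative[OF ray_in_ball[OF unit t(1,2)]]
        has_real_derivative_iff_has_vector_derivative)
  moreover have "((\<lambda>s. ?vol (s *\<^sub>R u)) has_real_derivative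
      2 * (?F t)\<^sup>2 * model_mean_curvature \<epsilon> (real N) (of_int k) t) (at t)"
  proof (rule has_field_derivative_transform_within_open)
    show "((\<lambda>s. (?F s)\<^sup>2) has_real_derivative
        2 * (?F t)\<^sup>2 * model_mean_curvature \<epsilon> (real N) (of_int k) t) (at t)"
      by (rule DERIV_cong[OF DERIV_power[OF DERIV_normalized_model_density[OF sign t(1,3)]]])
        (simp add: power2_eq_square)
  qed (use t volume_along_ray in \<open>auto intro!: open_greaterThanLessThan[of 0 "min \<delta> 1"]\<close>)
  ultimately have "2 * (?F t)\<^sup>2 * trace (shape u (t *\<^sub>R u)) =
      2 * (?F t)\<^sup>2 * model_mean_curvature \<epsilon> (real N) (of_int k) t"
    unfolding volume_along_ray[OF t] by (rule DERIV_unique)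
  then show ?thesis using normalized_model_density_pos[OF t(1,3), of \<epsilon> N k] by simp
qed

lemma traced_riccati:
  assumes t: "0 < t" "t < \<delta>" "t < 1"
  shows "trace (shape u (t *\<^sub>R u) ** shape u (t *\<^sub>R u)) + trace (curvature u (t *\<^sub>R u)) =
    model_riccati_term \<epsilon> (real N) (of_int k) t"
proof -
  let ?h = "model_mean_curvature \<epsilon> (real N) (of_int k)"
  note ball = ray_in_ball[OF unit t(1,2)]
  have "((\<lambda>s. trace (shape u (s *\<^sub>R u))) has_real_derivative trace (\<partial> u (shape u) (t *\<^sub>R u))) (at t)"
    using bounded_linear.has_vector_derivative[OF bounded_linear_trace ray_derivative[OF smooth_shape ball]]
    by (simp add: has_real_derivative_iff_has_vector_derivative)
  moreover have "((\<lambda>s. trace (shape u (s *\<^sub>R u))) has_real_derivative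
      model_mean_curvature_derivative \<epsilon> (real N) (of_int k) t) (at t)"
    by (rule has_field_derivative_transform_within_open[OF DERIV_model_mean_curvature[OF sign t(1,3)],
          where S = "{0<..<min \<delta> 1}"]) (use t trace_shape in auto)
  ultimately have "trace (\<partial> u (shape u) (t *\<^sub>R u)) = model_mean_curvature_derivative \<epsilon> (real N) (of_int k) t"
    by (rule DERIV_unique)
  with trace_riccati[OF ball] show ?thesis
    using t by (simp add: trace_shape[OF t] model_riccati_term_def field_simps)
qed

lemma trace_curvature: "trace (curvature u 0) = of_int \<epsilon> * (real N + 3 * of_int k)"
proof -
  let ?q = "\<lambda>x. trace (shape u x ** shape u x) + trace (curvature u x)"
  have "smooth_on (ball 0 \<delta>) ?q"
    by (intro smooth_intros smooth_on_linear_compose[OF _ bounded_linear_trace] smooth_shape smooth_curvature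
        open_ball)
  then have "((\<lambda>t. ?q (t *\<^sub>R u)) \<longlongrightarrow> ?q 0) (at_right 0)" by (rule ray_tendsto_right)
  moreover have "((\<lambda>t. ?q (t *\<^sub>R u)) \<longlongrightarrow> of_int \<epsilon> * (real N + 3 * of_int k)) (at_right 0)"
    by (rule Lim_transform_eventually[OF model_riccati_term_tendsto[OF sign]])
      (rule eventually_mono[OF eventually_ray_right], simp add: traced_riccati)
  ultimately have "?q 0 = of_int \<epsilon> * (real N + 3 * of_int k)"
    by (rule tendsto_unique[OF trivial_limit_at_right_real])
  then show ?thesis by (simp add: shape_origin matrix_mult.zero_left trace_def)
qed

lemma trace_curvature_squared:
  assumes ricci: "\<And>t. 0 < t \<Longrightarrow> t < \<delta> \<Longrightarrow>
    trace (curvature u (t *\<^sub>R u)) = of_int \<epsilon> * (real N + 3 * of_int k)"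
  shows "trace (curvature u 0 ** curvature u 0) = real N + 15 * of_int k"
proof -
  let ?D = "\<partial> u (shape u) 0" and ?Q = "\<lambda>t. shape u (t *\<^sub>R u) /\<^sub>R t"
  have "((\<lambda>t. trace (?Q t ** ?Q t)) \<longlongrightarrow> trace (?D ** ?D)) (at_right 0)"
    by (intro bounded_linear.tendsto[OF bounded_linear_trace] matrix_mult.tendsto
        tendsto_mono[OF _ shape_quotient]) (simp_all add: at_le)
  moreover have "((\<lambda>t. trace (?Q t ** ?Q t)) \<longlongrightarrow> (real N + 15 * of_int k) / 9) (at_right 0)"
  proof (rule Lim_transform_eventually[OF model_riccati_term_second_order[OF sign]],
      rule eventually_mono[OF eventually_ray_right])
    fix t assume t: "0 < t \<and> t < \<delta> \<and> t < (1::real)"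
    have "trace (?Q t ** ?Q t) = trace (shape u (t *\<^sub>R u) ** shape u (t *\<^sub>R u)) / t\<^sup>2"
      by (simp add: matrix_mult.scaleR_left matrix_mult.scaleR_right trace_scaleR power2_eq_square
          divide_inverse)
    then show "(model_riccati_term \<epsilon> (real N) (of_int k) t - of_int \<epsilon> * (real N + 3 * of_int k)) / t\<^sup>2 =
      trace (?Q t ** ?Q t)"
      using traced_riccati[of t] ricci[of t] t by simp
  qed
  ultimately have "trace (?D ** ?D) = (real N + 15 * of_int k) / 9"
    by (rule tendsto_unique[OF trivial_limit_at_right_real])
  moreover have "curvature u 0 = - (3 *\<^sub>R ?D)"
    using shape_derivative_origin[of u] by simp
  then have "curvature u 0 ** curvature u 0 = 9 *\<^sub>R (?D ** ?D)"
    by (simp add: matrix_mult.minus_left matrix_mult.minus_right matrix_mult.scaleR_left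
        matrix_mult.scaleR_right)
  ultimately show ?thesis by (simp add: trace_scaleR)
qed

end

end

subsection \<open>Charts of a Riemannian manifold\<close>

lemma is_chart_inj: "is_chart X c \<Longrightarrow> inj_on (chart_map c) (chart_dom c)"
  by (metis homeomorphic_imp_injective_map is_chart_def openin_subset topspace_subtopology_subset)

lemma chart_inv_chart_map: "is_chart X c \<Longrightarrow> p \<in> chart_dom c \<Longrightarrow> chart_inv c (chart_map c p) = p"
  by (simp add: chart_inv_def is_chart_inj inv_into_f_f)

lemma openin_chart_dom: "is_chart X c \<Longrightarrow> openin X (chart_dom c)"
  by (simp add: is_chart_def)

lemma open_chart_image:
  assumes c: "is_chart X c" and V: "openin X V"
  shows "open (chart_map c ` (chart_dom c \<inter> V))"
proof -
  have "open_map (subtopology X (chart_dom c)) (top_of_set (chart_im c)) (chart_map c)"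
    using c homeomorphic_imp_open_map by (auto simp: is_chart_def)
  moreover have "openin (subtopology X (chart_dom c)) (chart_dom c \<inter> V)"
    using V by (auto simp: openin_subtopology)
  ultimately have "openin (top_of_set (chart_im c)) (chart_map c ` (chart_dom c \<inter> V))"
    by (auto simp: open_map_def)
  then show ?thesis using c by (auto simp: is_chart_def openin_open_eq)
qed

locale smooth_riemannian_manifold =
  fixes M :: "('a, 'n::finite) riemannian"
  assumes manifold: "riemannian_manifold M"
begin

lemma Hausdorff: "Hausdorff_space (space_top M)"
  using manifold by (simp add: riemannian_manifold_def smooth_manifold_def)

lemma is_chart_atlas: "c \<in> atlas M \<Longrightarrow> is_chart (space_top M) c"
  using manifold by (auto simp: riemannian_manifold_def smooth_manifold_def)

lemma coordinate_metric_chart: "c \<in> atlas M \<Longrightarrow> coordinate_metric (chart_im c) (metric M c)"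
  using manifold is_chart_atlas[of c] by unfold_locales (auto simp: riemannian_manifold_def is_chart_def)

lemma
  assumes "p \<in> topspace (space_top M)"
  shows chart_at_atlas: "chart_at M p \<in> atlas M"
    and chart_at_dom: "p \<in> chart_dom (chart_at M p)"
proof -
  have "\<exists>c. c \<in> atlas M \<and> p \<in> chart_dom c"
    using manifold assms by (auto simp: riemannian_manifold_def smooth_manifold_def)
  from someI_ex[OF this] show "chart_at M p \<in> atlas M" "p \<in> chart_dom (chart_at M p)"
    by (auto simp: chart_at_def)
qed

lemma chart_dom_subset: "c \<in> atlas M \<Longrightarrow> p \<in> chart_dom c \<Longrightarrow> p \<in> topspace (space_top M)"
  using openin_chart_dom[OF is_chart_atlas] openin_subset by blast

lemma metric_transition:
  assumes "c \<in> atlas M" "d \<in> atlas M" "q \<in> chart_dom c" "q \<in> chart_dom d"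
  shows "metric M c (chart_map c q) = pullback_metric (metric M d) (transition c d) (chart_map c q)"
proof -
  let ?J = "jacobian (transition c d) (chart_map c q)"
  have "metric M c (chart_map c q) = transpose ?J ** metric M d (chart_map d q) ** ?J"
    using manifold assms unfolding riemannian_manifold_def by blast
  moreover have "transition c d (chart_map c q) = chart_map d q"
    by (simp add: transition_def chart_inv_chart_map[OF is_chart_atlas[OF assms(1)] assms(3)])
  ultimately show ?thesis by (simp only: pullback_metric_def)
qed

lemma transition_differentiable:
  assumes "c \<in> atlas M" "d \<in> atlas M" "q \<in> chart_dom c" "q \<in> chart_dom d"
  shows "transition c d differentiable (at (chart_map c q))"
proof (rule smooth_on_differentiable)
  have "compatible c d"
    using manifold assms(1,2) unfolding riemannian_manifold_def smooth_manifold_def by blast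
  then show "smooth_on (chart_map c ` (chart_dom c \<inter> chart_dom d)) (transition c d)"
    by (simp add: compatible_def)
qed (use assms in auto)

end

subsection \<open>Uniqueness of geodesics\<close>

definition chart_velocity :: "('a, 'n::finite) chart \<Rightarrow> (real \<Rightarrow> 'a) \<Rightarrow> real \<Rightarrow> real^'n" where
  "chart_velocity c \<gamma> t = vector_derivative (chart_map c \<circ> \<gamma>) (at t)"

definition phase_curve :: "('a, 'n::finite) chart \<Rightarrow> (real \<Rightarrow> 'a) \<Rightarrow> real \<Rightarrow> (real^'n) \<times> (real^'n)" where
  "phase_curve c \<gamma> t = (chart_map c (\<gamma> t), chart_velocity c \<gamma> t)"

definition geodesic_field ::
  "(real^'n \<Rightarrow> real^'n^'n) \<Rightarrow> (real^'n) \<times> (real^'n) \<Rightarrow> (real^'n) \<times> (real^'n)" where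
  "geodesic_field G z = (snd z, - christoffel_vec G (fst z) (snd z) (snd z))"

lemma (in coordinate_metric) smooth_geodesic_field: "smooth_on (\<Omega> \<times> UNIV) (geodesic_field G)"
proof -
  have open_prod: "open (\<Omega> \<times> (UNIV :: (real^'n) set))" by (intro open_Times open_domain open_UNIV)
  note fst = smooth_on_linear[OF open_prod bounded_linear_fst]
  note snd = smooth_on_linear[OF open_prod bounded_linear_snd]
  have "smooth_on (\<Omega> \<times> UNIV) (\<lambda>z. \<Gamma> (fst z) (snd z) (snd z))"
    by (intro smooth_on_bilinear_family[OF bilinear_christoffel smooth_christoffel
        open_prod _ fst snd snd]) auto
  then show ?thesis
    unfolding geodesic_field_def[abs_def] by (intro smooth_on_Pair smooth_on_minus open_prod snd)
qed

lemma chart_velocity_cong: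
  assumes "\<forall>\<^sub>F s in nhds t. \<gamma> s = \<gamma>' s"
  shows "chart_velocity c \<gamma> t = chart_velocity c \<gamma>' t"
  unfolding chart_velocity_def
  by (rule vector_derivative_cong_eq) (use assms in \<open>auto elim: eventually_mono\<close>)

context smooth_riemannian_manifold
begin

lemma geodesic_on_subset: "geodesic_on M \<gamma> I \<Longrightarrow> I' \<subseteq> I \<Longrightarrow> geodesic_on M \<gamma> I'"
  unfolding geodesic_on_def
  using continuous_map_from_subtopology_mono[of euclidean I "space_top M" \<gamma> I'] by blast

lemma eventually_geodesic_in:
  assumes "geodesic_on M \<gamma> I" "open I" "t \<in> I" "openin (space_top M) V" "\<gamma> t \<in> V"
  shows "\<forall>\<^sub>F s in nhds t. s \<in> I \<and> \<gamma> s \<in> V"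
proof -
  have "openin (top_of_set I) {s \<in> topspace (top_of_set I). \<gamma> s \<in> V}"
    using assms by (intro openin_continuous_map_preimage) (auto simp: geodesic_on_def)
  then have "open {s \<in> I. \<gamma> s \<in> V}" using assms(2) by (simp add: openin_open_eq)
  from eventually_nhds_in_open[OF this, of t] assms show ?thesis by simp
qed

lemmas eventually_geodesic_in_chart = eventually_geodesic_in[OF _ _ _ openin_chart_dom[OF is_chart_atlas]]

lemma
  assumes \<gamma>: "geodesic_on M \<gamma> I" "open I" and c: "c \<in> atlas M" and t: "t \<in> I" "\<gamma> t \<in> chart_dom c"
  shows geodesic_has_velocity: "((chart_map c \<circ> \<gamma>) has_vector_derivative chart_velocity c \<gamma> t) (at t)"
    and geodesic_has_acceleration: "(chart_velocity c \<gamma> has_vector_derivative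
      - christoffel_vec (metric M c) (chart_map c (\<gamma> t)) (chart_velocity c \<gamma> t)
          (chart_velocity c \<gamma> t)) (at t)"
proof -
  obtain v where v: "\<And>s. s \<in> I \<Longrightarrow> \<gamma> s \<in> chart_dom c \<Longrightarrow>
      ((chart_map c \<circ> \<gamma>) has_vector_derivative v s) (at s) \<and>
      (v has_vector_derivative - christoffel_vec (metric M c) (chart_map c (\<gamma> s)) (v s) (v s)) (at s)"
    using \<gamma>(1) c unfolding geodesic_on_def by blast
  then have velocity: "chart_velocity c \<gamma> s = v s" if "s \<in> I" "\<gamma> s \<in> chart_dom c" for s
    using that by (auto simp: chart_velocity_def intro: vector_derivative_at)
  then show "((chart_map c \<circ> \<gamma>) has_vector_derivative chart_velocity c \<gamma> t) (at t)"
    using v t by simp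
  have "\<forall>\<^sub>F s in nhds t. v s = chart_velocity c \<gamma> s"
    using eventually_geodesic_in_chart[OF \<gamma> t(1) c t(2)] by eventually_elim (simp add: velocity)
  with v[OF t] velocity[OF t] show "(chart_velocity c \<gamma> has_vector_derivative
      - christoffel_vec (metric M c) (chart_map c (\<gamma> t)) (chart_velocity c \<gamma> t)
          (chart_velocity c \<gamma> t)) (at t)"
    using has_vector_derivative_transform_eventually by metis
qed

lemma phase_curve_ode:
  assumes "geodesic_on M \<gamma> I" "open I" "c \<in> atlas M" "t \<in> I" "\<gamma> t \<in> chart_dom c"
  shows "(phase_curve c \<gamma> has_vector_derivative geodesic_field (metric M c) (phase_curve c \<gamma> t)) (at t)"
  using geodesic_has_velocity[OF assms] geodesic_has_acceleration[OF assms]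
  unfolding phase_curve_def geodesic_field_def by (auto intro!: has_vector_derivative_Pair simp: o_def)

lemma geodesic_locally_unique:
  assumes I: "open I" "t0 \<in> I" and \<gamma>: "geodesic_on M \<gamma> I" and \<gamma>': "geodesic_on M \<gamma>' I"
    and c: "c \<in> atlas M" "\<gamma> t0 \<in> chart_dom c"
    and init: "\<gamma> t0 = \<gamma>' t0" "chart_velocity c \<gamma> t0 = chart_velocity c \<gamma>' t0"
  shows "\<forall>\<^sub>F t in nhds t0. \<gamma> t = \<gamma>' t"
proof -
  interpret coordinate_metric "chart_im c" "metric M c" by (rule coordinate_metric_chart[OF c(1)])
  have near: "\<forall>\<^sub>F t in nhds t0. t \<in> I \<and> \<gamma> t \<in> chart_dom c" "\<forall>\<^sub>F t in nhds t0. t \<in> I \<and> \<gamma>' t \<in> chart_dom c"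
    using eventually_geodesic_in_chart[OF \<gamma> I c] eventually_geodesic_in_chart[OF \<gamma>' I c(1)]
      c(2) init(1) by auto
  have "\<forall>\<^sub>F t in nhds t0. phase_curve c \<gamma> t = phase_curve c \<gamma>' t"
  proof (rule ode_locally_unique)
    show "open (chart_im c \<times> (UNIV :: (real^'n) set))"
      by (intro open_Times open_domain open_UNIV)
    show "Ck_on (Suc 0) (chart_im c \<times> UNIV) (geodesic_field (metric M c))"
      by (intro smooth_onD smooth_geodesic_field)
    show "phase_curve c \<gamma> t0 \<in> chart_im c \<times> UNIV"
      using c(2) by (simp add: phase_curve_def chart_im_def)
    show "phase_curve c \<gamma> t0 = phase_curve c \<gamma>' t0"
      using init by (simp add: phase_curve_def)
    show "\<forall>\<^sub>F t in nhds t0. (phase_curve c \<gamma> has_vector_derivative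
        geodesic_field (metric M c) (phase_curve c \<gamma> t)) (at t)"
      using near(1) by eventually_elim (simp add: phase_curve_ode[OF \<gamma> I(1) c(1)])
    show "\<forall>\<^sub>F t in nhds t0. (phase_curve c \<gamma>' has_vector_derivative
        geodesic_field (metric M c) (phase_curve c \<gamma>' t)) (at t)"
      using near(2) by eventually_elim (simp add: phase_curve_ode[OF \<gamma>' I(1) c(1)])
  qed
  with near show ?thesis
    by eventually_elim (use is_chart_inj[OF is_chart_atlas[OF c(1)]] in
        \<open>auto simp: phase_curve_def inj_on_def\<close>)
qed

lemma geodesics_agree_at_limit:
  assumes I: "open I" "t0 \<in> I" and \<gamma>: "geodesic_on M \<gamma> I" and \<gamma>': "geodesic_on M \<gamma>' I"
    and limit: "t0 islimpt {t \<in> I. \<forall>\<^sub>F s in nhds t. \<gamma> s = \<gamma>' s}"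
  shows "\<forall>\<^sub>F s in nhds t0. \<gamma> s = \<gamma>' s"
proof -
  define S where "S = {t \<in> I. \<forall>\<^sub>F s in nhds t. \<gamma> s = \<gamma>' s}"
  have cont: "continuous_map (top_of_set I) (space_top M) \<gamma>" "continuous_map (top_of_set I) (space_top M) \<gamma>'"
    using \<gamma> \<gamma>' by (auto simp: geodesic_on_def)
  have "S \<subseteq> {t \<in> I. \<gamma> t = \<gamma>' t}"
    unfolding S_def using eventually_nhds_x_imp_x by fast
  moreover have "closedin (top_of_set I) {t \<in> I. \<gamma> t = \<gamma>' t}"
    using closedin_continuous_maps_eq[OF Hausdorff cont] by simp
  ultimately have eq: "\<gamma> t0 = \<gamma>' t0"
    using limit I(2) islimpt_subset unfolding closedin_limpt S_def[symmetric] by blast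
  define c where "c = chart_at M (\<gamma> t0)"
  have "\<gamma> t0 \<in> topspace (space_top M)"
    using cont(1) I(2) by (auto simp: continuous_map_def)
  then have c: "c \<in> atlas M" "\<gamma> t0 \<in> chart_dom c"
    unfolding c_def by (rule chart_at_atlas chart_at_dom)+
  let ?F = "at t0 within S"
  have velocity_tendsto: "(chart_velocity c \<eta> \<longlongrightarrow> chart_velocity c \<eta> t0) ?F"
    if "geodesic_on M \<eta> I" "\<eta> t0 \<in> chart_dom c" for \<eta>
    using has_vector_derivative_continuous[OF geodesic_has_acceleration[OF that(1) I(1) c(1) I(2) that(2)]]
      continuous_within_subset unfolding continuous_within by blast
  have "\<forall>\<^sub>F t in ?F. chart_velocity c \<gamma> t = chart_velocity c \<gamma>' t"
    unfolding eventually_at_filter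
    by (rule always_eventually) (auto simp: S_def intro: chart_velocity_cong)
  with velocity_tendsto[OF \<gamma> c(2)] have "(chart_velocity c \<gamma>' \<longlongrightarrow> chart_velocity c \<gamma> t0) ?F"
    by (rule Lim_transform_eventually)
  moreover have "?F \<noteq> bot" using limit by (simp add: trivial_limit_within S_def)
  ultimately have "chart_velocity c \<gamma> t0 = chart_velocity c \<gamma>' t0"
    using velocity_tendsto[OF \<gamma>'] c(2) eq tendsto_unique by metis
  with geodesic_locally_unique[OF I \<gamma> \<gamma>' c eq] show ?thesis by simp
qed

lemma geodesic_unique:
  assumes I: "open I" "connected I" "t0 \<in> I" and \<gamma>: "geodesic_on M \<gamma> I" and \<gamma>': "geodesic_on M \<gamma>' I"
    and c: "c \<in> atlas M" "\<gamma> t0 \<in> chart_dom c"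
    and init: "\<gamma> t0 = \<gamma>' t0" "chart_velocity c \<gamma> t0 = chart_velocity c \<gamma>' t0"
    and t: "t \<in> I"
  shows "\<gamma> t = \<gamma>' t"
proof -
  define S where "S = {t \<in> I. \<forall>\<^sub>F s in nhds t. \<gamma> s = \<gamma>' s}"
  have "t0 \<in> S"
    using geodesic_locally_unique[OF I(1,3) \<gamma> \<gamma>' c init] I(3) by (simp add: S_def)
  moreover have "openin (top_of_set I) S"
  proof -
    have "\<forall>\<^sub>F s in nhds r. s \<in> S" if "r \<in> S" for r
      using that I(1) by (simp add: S_def eventually_conj_iff eventually_eventually eventually_nhds_in_open)
    then have "open S" by (subst open_subopen) (auto simp: eventually_nhds subset_eq)
    then show ?thesis using I(1) by (auto simp: openin_open_eq S_def)
  qed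
  moreover have "closedin (top_of_set I) S"
    using geodesics_agree_at_limit[OF I(1) _ \<gamma> \<gamma>'] by (auto simp: closedin_limpt S_def)
  ultimately have "S = I" using I(2) unfolding connected_clopen by blast
  then show ?thesis using t eventually_nhds_x_imp_x by (fastforce simp: S_def)
qed

subsection \<open>The exponential map along rays\<close>

lemma exp_map_eq:
  assumes p: "p \<in> topspace (space_top M)" and q: "exp_rel M p \<xi> q"
  shows "exp_map M p \<xi> = q"
  unfolding exp_map_def
proof (rule the_equality, rule q)
  let ?c = "chart_at M p"
  fix q' assume "exp_rel M p \<xi> q'"
  then obtain \<gamma>' a' b' where \<gamma>': "a' < 0" "1 < b'" "geodesic_on M \<gamma>' {a'<..<b'}" "\<gamma>' 0 = p"
    "((chart_map ?c \<circ> \<gamma>') has_vector_derivative \<xi>) (at 0)" "\<gamma>' 1 = q'"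
    unfolding exp_rel_def by blast
  from q obtain \<gamma> a b where \<gamma>: "a < 0" "1 < b" "geodesic_on M \<gamma> {a<..<b}" "\<gamma> 0 = p"
    "((chart_map ?c \<circ> \<gamma>) has_vector_derivative \<xi>) (at 0)" "\<gamma> 1 = q"
    unfolding exp_rel_def by blast
  have "\<gamma> 1 = \<gamma>' 1"
  proof (rule geodesic_unique)
    show "geodesic_on M \<gamma> {max a a'<..<min b b'}" "geodesic_on M \<gamma>' {max a a'<..<min b b'}"
      by (rule geodesic_on_subset[OF \<gamma>(3)] geodesic_on_subset[OF \<gamma>'(3)], auto)+
    show "?c \<in> atlas M" "\<gamma> 0 \<in> chart_dom ?c"
      using chart_at_atlas[OF p] chart_at_dom[OF p] \<gamma>(4) by simp_all
    show "chart_velocity ?c \<gamma> 0 = chart_velocity ?c \<gamma>' 0"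
      using \<gamma>(5) \<gamma>'(5) by (simp add: chart_velocity_def vector_derivative_at)
  qed (use \<gamma> \<gamma>' in auto)
  then show "q' = q" using \<gamma>(6) \<gamma>'(6) by simp
qed

lemma geodesic_on_rescale:
  assumes \<gamma>: "geodesic_on M \<gamma> I" "open I" and sub: "\<And>s. s \<in> I' \<Longrightarrow> r * s \<in> I"
  shows "geodesic_on M (\<lambda>s. \<gamma> (r * s)) I'"
  unfolding geodesic_on_def
proof (intro conjI ballI)
  have "continuous_map (top_of_set I') (top_of_set I) (\<lambda>s. r * s)"
    using sub by (auto intro!: continuous_intros)
  from continuous_map_compose[OF this, of "space_top M" \<gamma>] \<gamma>
  show "continuous_map (top_of_set I') (space_top M) (\<lambda>s. \<gamma> (r * s))"
    by (simp add: geodesic_on_def o_def)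
  fix c assume c: "c \<in> atlas M"
  interpret coordinate_metric "chart_im c" "metric M c" by (rule coordinate_metric_chart[OF c])

  show "\<exists>v. \<forall>s\<in>I'. \<gamma> (r * s) \<in> chart_dom c \<longrightarrow>
     ((chart_map c \<circ> (\<lambda>s. \<gamma> (r * s))) has_vector_derivative v s) (at s) \<and>
     (v has_vector_derivative - \<Gamma> (chart_map c (\<gamma> (r * s))) (v s) (v s)) (at s)"
  proof (intro exI[of _ "\<lambda>s. r *\<^sub>R chart_velocity c \<gamma> (r * s)"] ballI impI conjI)
    fix s assume s: "s \<in> I'" "\<gamma> (r * s) \<in> chart_dom c"
    show "((chart_map c \<circ> (\<lambda>s. \<gamma> (r * s))) has_vector_derivative r *\<^sub>R chart_velocity c \<gamma> (r * s)) (at s)"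
      using has_vector_derivative_rescale[OF geodesic_has_velocity[OF \<gamma> c sub[OF s(1)] s(2)]]
      by (simp add: o_def)
    show "((\<lambda>s. r *\<^sub>R chart_velocity c \<gamma> (r * s)) has_vector_derivative
       - \<Gamma> (chart_map c (\<gamma> (r * s))) (r *\<^sub>R chart_velocity c \<gamma> (r * s))
           (r *\<^sub>R chart_velocity c \<gamma> (r * s))) (at s)"
      using bounded_linear.has_vector_derivative[OF bounded_linear_scaleR_right
          has_vector_derivative_rescale[OF geodesic_has_acceleration[OF \<gamma> c sub[OF s(1)] s(2)]], of r]
      by (simp add: christoffel_linear)
  qed
qed

lemma interval_contains_scaled_segment:
  fixes a b t :: real
  assumes "a < 0" "0 < b" "t \<in> {a<..<b}"
  obtains a' b' where "a' < 0" "1 < b'" "\<And>s. s \<in> {a'<..<b'} \<Longrightarrow> t * s \<in> {a<..<b}"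
proof -
  consider (zero) "t = 0" | (pos) "0 < t" | (neg) "t < 0" by linarith
  then show thesis
  proof cases
    case zero
    then show thesis using assms that[of "- 1" 2] by simp
  next
    case pos
    then show thesis using assms by (intro that[of "a / t" "b / t"]) (auto simp: field_simps)
  next
    case neg
    then show thesis using assms by (intro that[of "b / t" "a / t"]) (auto simp: field_simps)
  qed
qed

lemma exp_map_ray:
  assumes p: "p \<in> topspace (space_top M)" and \<gamma>: "geodesic_on M \<gamma> {a<..<b}" "a < 0" "0 < b" "\<gamma> 0 = p"
    and init: "((chart_map (chart_at M p) \<circ> \<gamma>) has_vector_derivative \<xi>) (at 0)" and t: "t \<in> {a<..<b}"
  shows "exp_map M p (t *\<^sub>R \<xi>) = \<gamma> t"
proof (rule exp_map_eq[OF p])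
  obtain a' b' where ab': "a' < 0" "1 < b'" "\<And>s. s \<in> {a'<..<b'} \<Longrightarrow> t * s \<in> {a<..<b}"
    using interval_contains_scaled_segment[OF \<gamma>(2,3) t] by blast
  have "geodesic_on M (\<lambda>s. \<gamma> (t * s)) {a'<..<b'}"
    by (intro geodesic_on_rescale[OF \<gamma>(1)] ab'(3)) auto
  moreover have "((chart_map (chart_at M p) \<circ> (\<lambda>s. \<gamma> (t * s))) has_vector_derivative t *\<^sub>R \<xi>) (at 0)"
    using has_vector_derivative_rescale[of "chart_map (chart_at M p) \<circ> \<gamma>" \<xi> t 0] init by (simp add: o_def)
  ultimately show "exp_rel M p (t *\<^sub>R \<xi>) (\<gamma> t)"
    unfolding exp_rel_def using \<gamma>(4) ab'
    by (intro exI[of _ "\<lambda>s. \<gamma> (t * s)"] exI[of _ a'] exI[of _ b']) auto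
qed

end

subsection \<open>Change of coordinates for metrics\<close>

lemma jacobian_compose:
  fixes f g :: "real^'n \<Rightarrow> real^'n"
  assumes "f differentiable (at x)" "g differentiable (at (f x))"
  shows "jacobian (\<lambda>x. g (f x)) x = jacobian g (f x) ** jacobian f x"
proof -
  have "(\<lambda>x. g (f x)) differentiable (at x)"
    using differentiable_chain_at[OF assms] by (simp add: o_def)
  then have "jacobian (\<lambda>x. g (f x)) x *v w = (jacobian g (f x) ** jacobian f x) *v w" for w
    using assms by (simp add: jacobian_vector_mult directional_derivative_compose
        flip: matrix_vector_mul_assoc)
  then show ?thesis by (simp add: matrix_eq)
qed

lemma jacobian_matrix_vector_mult: "jacobian ((*v) B) x = (B :: real^'n^'n)"
  by (simp add: matrix_eq jacobian_vector_mult bounded_linear_imp_differentiable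
      directional_derivative_bounded_linear matrix_vector_mult.bounded_linear_right)

lemma pullback_metric_compose:
  assumes "f differentiable (at x)" "g differentiable (at (f x))"
  shows "pullback_metric G (\<lambda>x. g (f x)) x =
    transpose (jacobian f x) ** pullback_metric G g (f x) ** jacobian f x"
  by (simp add: pullback_metric_def jacobian_compose[OF assms] matrix_transpose_mul matrix_mul_assoc)

lemma pullback_metric_cong:
  assumes "open S" "x \<in> S" "\<And>y. y \<in> S \<Longrightarrow> f y = g y"
  shows "pullback_metric G f x = pullback_metric G g x"
proof -
  have "frechet_derivative f (at x) = frechet_derivative g (at x)"
    by (intro ext directional_derivative_cong[OF assms(1,2)] assms(3))
  then show ?thesis by (simp add: pullback_metric_def jacobian_def assms(2,3))
qed

lemma (in smooth_riemannian_manifold) metric_in_eq_pullback: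
  assumes n: "smooth_chart M n" and c: "c \<in> atlas M" and q: "q \<in> chart_dom n" "q \<in> chart_dom c"
  shows "metric_in M n (chart_map n q) = pullback_metric (metric M c) (transition n c) (chart_map n q)"
proof -
  define d where "d = chart_at M q"
  let ?y = "chart_map n q" and ?S = "chart_map n ` (chart_dom n \<inter> chart_dom c)"
  have d: "d \<in> atlas M" "q \<in> chart_dom d"
    using chart_at_atlas chart_at_dom chart_dom_subset[OF c q(2)] by (auto simp: d_def)
  have n_chart: "is_chart (space_top M) n" and "compatible n c"
    using n c by (auto simp: smooth_chart_def)
  note n_inv = chart_inv_chart_map[OF n_chart] and c_inv = chart_inv_chart_map[OF is_chart_atlas[OF c]]
  have S: "open ?S" "?y \<in> ?S"
    using open_chart_image[OF n_chart openin_chart_dom[OF is_chart_atlas[OF c]]] q by auto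
  have n_c: "transition n c ?y = chart_map c q"
    by (simp add: transition_def n_inv q)
  have "metric_in M n ?y = pullback_metric (metric M d) (transition n d) ?y"
    by (simp add: metric_in_def Let_def pullback_metric_def n_inv[OF q(1)] d_def[symmetric] transition_def)
  also have "\<dots> = pullback_metric (metric M d) (\<lambda>z. transition c d (transition n c z)) ?y"
    by (intro pullback_metric_cong[OF S]) (auto simp: transition_def n_inv c_inv)
  also have "\<dots> = transpose (jacobian (transition n c) ?y) **
      pullback_metric (metric M d) (transition c d) (transition n c ?y) ** jacobian (transition n c) ?y"
  proof (intro pullback_metric_compose)
    show "transition n c differentiable (at ?y)"
      using \<open>compatible n c\<close> S(2) by (auto simp: compatible_def intro: smooth_on_differentiable)
    show "transition c d differentiable (at (transition n c ?y))"
      unfolding n_c by (rule transition_differentiable[OF c d(1) q(2) d(2)])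
  qed
  also have "\<dots> = pullback_metric (metric M c) (transition n c) ?y"
    unfolding n_c metric_transition[OF c d(1) q(2) d(2), symmetric]
    by (simp add: pullback_metric_def n_c)
  finally show ?thesis .
qed

subsection \<open>Orthonormal frames\<close>

lemma congruence_entry: "(transpose L ** g ** L) $ i $ j = column i L \<bullet> (g *v column j L)"
  for L g :: "real^'n^'n"
  unfolding matrix_mul_assoc[symmetric]
  by (simp add: matrix_matrix_mult_def transpose_def inner_vec_def matrix_vector_mult_def column_def)

lemma orthonormal_frame_congruence:
  assumes "orthonormal_frame M p L"
  shows "transpose L ** metric M (chart_at M p) (chart_map (chart_at M p) p) ** L = mat 1"
  using assms by (simp add: vec_eq_iff congruence_entry orthonormal_frame_def inner_at_def mat_def)

lemma norm_at_frame: "orthonormal_frame M p L \<Longrightarrow> norm_at M p (L *v x) = norm x"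
  by (simp add: norm_at_def inner_at_def norm_eq_sqrt_inner orthonormal_frame_congruence
      flip: congruence_inner)

lemma det_frame_squared:
  "orthonormal_frame M p L \<Longrightarrow> (det L)\<^sup>2 * det (metric M (chart_at M p) (chart_map (chart_at M p) p)) = 1"
  using arg_cong[OF orthonormal_frame_congruence, of M p L det]
  by (simp add: det_mul power2_eq_square mult_ac)

lemma det_frame_nonzero: "orthonormal_frame M p L \<Longrightarrow> det L \<noteq> 0"
  using det_frame_squared[of M p L] by auto

lemma det_frame_change_squared:
  assumes "orthonormal_frame M p L" "orthonormal_frame M p L'"
  shows "(det (matrix_inv L ** L'))\<^sup>2 = 1"
proof -
  let ?g = "det (metric M (chart_at M p) (chart_map (chart_at M p) p))"
  have "(det L)\<^sup>2 * ?g * (det (matrix_inv L ** L'))\<^sup>2 = (det L * det (matrix_inv L ** L'))\<^sup>2 * ?g"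
    by (simp add: power_mult_distrib)
  also have "det L * det (matrix_inv L ** L') = det L'"
    by (simp add: matrix_mul_assoc matrix_inv_right[OF det_frame_nonzero[OF assms(1)]] flip: det_mul)
  finally show ?thesis by (simp add: det_frame_squared assms)
qed

subsection \<open>Normal coordinates read in a chart of the atlas\<close>

lemma
  assumes "normal_coordinates M p L \<delta>" "x \<in> ball 0 \<delta>"
  shows exp_in_normal_chart: "exp_map M p (L *v x) \<in> chart_dom (normal_chart M p L \<delta>)"
    and normal_chart_exp: "chart_map (normal_chart M p L \<delta>) (exp_map M p (L *v x)) = x"
  using assms inv_into_f_f[of "\<lambda>x. exp_map M p (L *v x)" "ball 0 \<delta>" x]
  by (auto simp: normal_chart_def normal_coordinates_def)

lemma transition_normal_chart:
  assumes normal: "normal_coordinates M p L \<delta>" and x: "x \<in> ball 0 \<delta>"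
  shows "transition (normal_chart M p L \<delta>) c x = chart_map c (exp_map M p (L *v x))"
proof -
  have "is_chart (space_top M) (normal_chart M p L \<delta>)"
    using normal by (simp add: normal_coordinates_def smooth_chart_def)
  from chart_inv_chart_map[OF this exp_in_normal_chart[OF normal x]] show ?thesis
    by (simp add: transition_def normal_chart_exp[OF normal x])
qed

lemma (in smooth_riemannian_manifold) normal_coordinates_geodesic:
  assumes p: "p \<in> topspace (space_top M)" and normal: "normal_coordinates M p L \<delta>" and "0 < \<delta>"
    and t0: "t0 *\<^sub>R x \<in> ball 0 \<delta>"
  obtains \<gamma> I where "open I" "0 \<in> I" "t0 \<in> I" "geodesic_on M \<gamma> I" "\<gamma> 0 = p"
    "((chart_map (chart_at M p) \<circ> \<gamma>) has_vector_derivative L *v x) (at 0)"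
    "\<And>t. t \<in> I \<Longrightarrow> exp_map M p (L *v (t *\<^sub>R x)) = \<gamma> t"
proof -
  obtain r where r: "r \<noteq> 0" "r *\<^sub>R x \<in> ball 0 \<delta>" "t0 = 0 \<or> t0 = r"
  proof (cases "t0 = 0")
    case True
    have "norm ((\<delta> / (2 * (norm x + 1))) *\<^sub>R x) < \<delta>"
    proof -
      have "norm x / (2 * (norm x + 1)) < 1" by (simp add: field_simps add_strict_increasing)
      then show ?thesis using mult_strict_left_mono[OF _ \<open>0 < \<delta>\<close>] \<open>0 < \<delta>\<close> by fastforce
    qed
    then show thesis
      using True \<open>0 < \<delta>\<close> by (intro that[of "\<delta> / (2 * (norm x + 1))"]) (auto simp: add_nonneg_eq_0_iff)
  qed (use that[of t0] t0 in auto)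
  obtain q where "exp_rel M p (L *v (r *\<^sub>R x)) q"
    using normal r(2) unfolding normal_coordinates_def by blast
  then obtain \<gamma> a b where \<gamma>: "a < 0" "1 < b" "geodesic_on M \<gamma> {a<..<b}" "\<gamma> 0 = p"
    and init: "((chart_map (chart_at M p) \<circ> \<gamma>) has_vector_derivative L *v (r *\<^sub>R x)) (at 0)"
    unfolding exp_rel_def by blast
  let ?I = "(\<lambda>t. inverse r * t) -` {a<..<b}" and ?\<eta> = "\<lambda>t. \<gamma> (inverse r * t)"
  show thesis
  proof (rule that[of ?I ?\<eta>])
    show "open ?I" by (intro open_vimage open_greaterThanLessThan continuous_intros)
    show "geodesic_on M ?\<eta> ?I" by (rule geodesic_on_rescale[OF \<gamma>(3)]) auto
    show "((chart_map (chart_at M p) \<circ> ?\<eta>) has_vector_derivative L *v x) (at 0)"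
      using has_vector_derivative_rescale[of "chart_map (chart_at M p) \<circ> \<gamma>" _ "inverse r" 0] init r(1)
      by (fastforce simp: o_def matrix_vector_mult.scaleR_right)
    fix t assume "t \<in> ?I"
    then have "exp_map M p ((inverse r * t) *\<^sub>R (L *v (r *\<^sub>R x))) = ?\<eta> t"
      using \<gamma> by (intro exp_map_ray[OF p \<gamma>(3) _ _ _ init]) auto
    moreover have "inverse r * t * r = t" using r(1) by simp
    ultimately show "exp_map M p (L *v (t *\<^sub>R x)) = ?\<eta> t"
      by (simp add: matrix_vector_mult.scaleR_right)
  qed (use \<gamma> r in auto)
qed

locale normal_coordinates_in_chart = smooth_riemannian_manifold M
  for M :: "('a, 'n::finite) riemannian" +
  fixes p :: 'a and c :: "('a, 'n) chart" and L :: "real^'n^'n" and \<delta> :: real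
  assumes point: "p \<in> topspace (space_top M)" and chart: "c \<in> atlas M" "p \<in> chart_dom c"
    and normal: "normal_coordinates M p L \<delta>" and radius: "0 < \<delta>"
begin

definition exp_in_chart :: "real^'n \<Rightarrow> real^'n" where
  "exp_in_chart x = chart_map c (exp_map M p (L *v x))"

definition exp_domain :: "(real^'n) set" where
  "exp_domain = {x \<in> ball 0 \<delta>. exp_map M p (L *v x) \<in> chart_dom c}"

lemma frame: "orthonormal_frame M p L"
  using normal by (simp add: normal_coordinates_def)

lemma smooth_normal_chart: "smooth_chart M (normal_chart M p L \<delta>)"
  using normal by (simp add: normal_coordinates_def)

lemma exp_domain_eq:
  "exp_domain = chart_map (normal_chart M p L \<delta>) ` (chart_dom (normal_chart M p L \<delta>) \<inter> chart_dom c)"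
proof -
  have "chart_dom (normal_chart M p L \<delta>) = (\<lambda>x. exp_map M p (L *v x)) ` ball 0 \<delta>"
    by (simp add: normal_chart_def)
  then have "chart_dom (normal_chart M p L \<delta>) \<inter> chart_dom c = (\<lambda>x. exp_map M p (L *v x)) ` exp_domain"
    by (auto simp: exp_domain_def)
  moreover have "chart_map (normal_chart M p L \<delta>) (exp_map M p (L *v x)) = x" if "x \<in> exp_domain" for x
    using that normal_chart_exp[OF normal] by (simp add: exp_domain_def)
  ultimately show ?thesis by (simp add: image_image)
qed

lemma open_exp_domain: "open exp_domain"
  unfolding exp_domain_eq using smooth_normal_chart
  by (intro open_chart_image[where X = "space_top M"] openin_chart_dom[OF is_chart_atlas[OF chart(1)]])
    (simp add: smooth_chart_def)

lemma smooth_exp_in_chart: "smooth_on exp_domain exp_in_chart"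
proof (rule smooth_on_cong[OF open_exp_domain])
  show "smooth_on exp_domain (transition (normal_chart M p L \<delta>) c)"
    using smooth_normal_chart chart(1) unfolding exp_domain_eq by (simp add: smooth_chart_def compatible_def)
qed (simp add: exp_domain_def exp_in_chart_def transition_normal_chart[OF normal])

lemma exp_in_chart_differentiable: "x \<in> exp_domain \<Longrightarrow> exp_in_chart differentiable (at x)"
  by (rule smooth_on_differentiable[OF smooth_exp_in_chart])

lemma exp_in_chart_im: "x \<in> exp_domain \<Longrightarrow> exp_in_chart x \<in> chart_im c"
  by (auto simp: exp_domain_def exp_in_chart_def chart_im_def)

lemma exp_map_origin: "exp_map M p 0 = p"
proof (rule normal_coordinates_geodesic[OF point normal radius, of 0 0])
  show "0 *\<^sub>R 0 \<in> ball (0 :: real^'n) \<delta>" using radius by simp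
qed (metis matrix_vector_mult_0_right scaleR_zero_right)

lemma exp_in_chart_origin: "exp_in_chart 0 = chart_map c p"
  by (simp add: exp_in_chart_def exp_map_origin)

lemma origin_in_exp_domain: "0 \<in> exp_domain"
  using radius chart(2) by (simp add: exp_domain_def exp_map_origin)

lemma exp_in_chart_ray:
  assumes "t *\<^sub>R x \<in> exp_domain"
  shows "((\<lambda>s. exp_in_chart (s *\<^sub>R x)) has_vector_derivative \<partial> x exp_in_chart (t *\<^sub>R x)) (at t)"
  using has_vector_derivative_compose[where c = "\<lambda>s. s *\<^sub>R x" and t = t]
    exp_in_chart_differentiable[OF assms] has_vector_derivative_affine[of 0 x t] by simp

lemma exp_in_chart_geodesic:
  assumes t: "t *\<^sub>R u \<in> exp_domain"
  defines "y \<equiv> t *\<^sub>R u"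
  shows "\<partial> u (\<partial> u exp_in_chart) y =
    - christoffel_vec (metric M c) (exp_in_chart y) (\<partial> u exp_in_chart y) (\<partial> u exp_in_chart y)"
proof -
  have "t *\<^sub>R u \<in> ball 0 \<delta>" using t by (simp add: exp_domain_def)
  from normal_coordinates_geodesic[OF point normal radius this]
  obtain \<gamma> I where I: "open I" "t \<in> I" and \<gamma>: "geodesic_on M \<gamma> I"
    and exp_eq: "\<And>s. s \<in> I \<Longrightarrow> exp_map M p (L *v (s *\<^sub>R u)) = \<gamma> s"
    by metis
  define W where "W = I \<inter> (\<lambda>s. s *\<^sub>R u) -` exp_domain"
  have W: "open W" "t \<in> W"
    using I t unfolding W_def by (auto intro!: open_Int open_vimage open_exp_domain continuous_intros)
  have curve: "exp_in_chart (s *\<^sub>R u) = (chart_map c \<circ> \<gamma>) s" "\<gamma> s \<in> chart_dom c" if "s \<in> W" for s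
    using that exp_eq[of s] by (auto simp: W_def exp_in_chart_def exp_domain_def)
  have velocity: "chart_velocity c \<gamma> s = \<partial> u exp_in_chart (s *\<^sub>R u)" if s: "s \<in> W" for s
    unfolding chart_velocity_def
  proof (rule vector_derivative_at,
      rule has_vector_derivative_transform_within_open[OF exp_in_chart_ray W(1) s])
    show "s *\<^sub>R u \<in> exp_domain" using s by (simp add: W_def)
  qed (rule curve)
  have "\<partial> u exp_in_chart differentiable (at y)"
    using smooth_on_differentiable[OF smooth_on_directional_derivative[OF smooth_exp_in_chart]] t
    by (simp add: y_def)
  then have "((\<lambda>s. \<partial> u exp_in_chart (s *\<^sub>R u)) has_vector_derivative \<partial> u (\<partial> u exp_in_chart) y) (at t)"
    using has_vector_derivative_compose[where c = "\<lambda>s. s *\<^sub>R u" and t = t]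
        has_vector_derivative_affine[of 0 u t]
    by (simp add: y_def)
  then have "(chart_velocity c \<gamma> has_vector_derivative \<partial> u (\<partial> u exp_in_chart) y) (at t)"
    by (rule has_vector_derivative_transform_within_open[OF _ W]) (simp add: velocity)
  moreover have "(chart_velocity c \<gamma> has_vector_derivative - christoffel_vec (metric M c) (exp_in_chart y)
      (\<partial> u exp_in_chart y) (\<partial> u exp_in_chart y)) (at t)"
    using geodesic_has_acceleration[OF \<gamma> I(1) chart(1) I(2) curve(2)[OF W(2)]]
    by (simp add: velocity[OF W(2)] y_def curve(1)[OF W(2)])
  ultimately show ?thesis by (rule vector_derivative_unique_at)
qed

lemma exp_in_chart_jacobian_origin:
  "jacobian exp_in_chart 0 = jacobian (transition (chart_at M p) c) (chart_map (chart_at M p) p) ** L"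
proof -
  define d where "d = chart_at M p"
  have d: "d \<in> atlas M" "p \<in> chart_dom d"
    using chart_at_atlas[OF point] chart_at_dom[OF point] by (auto simp: d_def)
  note transition_diff = transition_differentiable[OF d(1) chart(1) d(2) chart(2)]
  have "\<partial> w exp_in_chart 0 = \<partial> (L *v w) (transition d c) (chart_map d p)" for w
  proof -
    have "0 *\<^sub>R w \<in> ball 0 \<delta>" using radius by simp
    from normal_coordinates_geodesic[OF point normal radius this]
    obtain \<gamma> I where I: "open I" "0 \<in> I" and \<gamma>: "geodesic_on M \<gamma> I" "\<gamma> 0 = p"
      and init: "((chart_map d \<circ> \<gamma>) has_vector_derivative L *v w) (at 0)"
      and exp_eq: "\<And>s. s \<in> I \<Longrightarrow> exp_map M p (L *v (s *\<^sub>R w)) = \<gamma> s"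
      unfolding d_def by metis
    have "\<forall>\<^sub>F s in nhds 0. s \<in> I \<and> \<gamma> s \<in> chart_dom d"
      by (rule eventually_geodesic_in_chart[OF \<gamma>(1) I d(1)]) (simp add: \<gamma>(2) d(2))
    then have "\<forall>\<^sub>F s in nhds 0. exp_in_chart (s *\<^sub>R w) = transition d c ((chart_map d \<circ> \<gamma>) s)"
      by eventually_elim
        (simp add: exp_in_chart_def exp_eq transition_def chart_inv_chart_map[OF is_chart_atlas[OF d(1)]])
    with exp_in_chart_ray[of 0 w]
    have "((\<lambda>s. transition d c ((chart_map d \<circ> \<gamma>) s)) has_vector_derivative \<partial> w exp_in_chart 0) (at 0)"
      using has_vector_derivative_transform_eventually origin_in_exp_domain by fastforce
    moreover have "((\<lambda>s. transition d c ((chart_map d \<circ> \<gamma>) s)) has_vector_derivative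
        \<partial> (L *v w) (transition d c) ((chart_map d \<circ> \<gamma>) 0)) (at 0)"
      by (rule has_vector_derivative_compose[OF init]) (simp add: \<gamma>(2) transition_diff)
    ultimately show ?thesis using vector_derivative_unique_at \<gamma>(2) by fastforce
  qed
  then show ?thesis
    by (simp add: matrix_eq jacobian_vector_mult exp_in_chart_differentiable origin_in_exp_domain
        transition_diff[unfolded d_def] d_def flip: matrix_vector_mul_assoc)
qed

lemma pullback_metric_origin: "pullback_metric (metric M c) exp_in_chart 0 = mat 1"
proof -
  let ?d = "chart_at M p"
  let ?T = "jacobian (transition ?d c) (chart_map ?d p)"
  have d: "?d \<in> atlas M" "p \<in> chart_dom ?d"
    using chart_at_atlas[OF point] chart_at_dom[OF point] by auto
  have "pullback_metric (metric M c) exp_in_chart 0 =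
      transpose L ** (transpose ?T ** metric M c (chart_map c p) ** ?T) ** L"
    by (simp add: pullback_metric_def exp_in_chart_jacobian_origin exp_in_chart_origin matrix_transpose_mul
        matrix_mul_assoc)
  also have "transpose ?T ** metric M c (chart_map c p) ** ?T = metric M ?d (chart_map ?d p)"
    unfolding metric_transition[OF d(1) chart(1) d(2) chart(2)] pullback_metric_def
    by (simp add: transition_def chart_inv_chart_map[OF is_chart_atlas[OF d(1)] d(2)])
  finally show ?thesis using orthonormal_frame_congruence[OF frame] by simp
qed

lemma density_in_chart:
  assumes x: "x \<in> exp_domain" and density: "has_density M p (L *v x) \<rho>"
  shows "norm x ^ (CARD('n) - 1) * sqrt (det (pullback_metric (metric M c) exp_in_chart x)) = \<rho>"
proof -
  from density obtain L' \<delta>' x' where normal': "normal_coordinates M p L' \<delta>'" and x': "x' \<in> ball 0 \<delta>'"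
    and eq: "L *v x = L' *v x'"
    and \<rho>: "\<rho> = norm_at M p (L *v x) ^ (CARD('n) - 1) * sqrt (det (metric_in M (normal_chart M p L' \<delta>') x'))"
    unfolding has_density_def by blast
  let ?n = "normal_chart M p L' \<delta>'"
  define B where "B = matrix_inv L ** L'"
  have LB: "L *v (B *v y) = L' *v y" for y
    by (simp add: B_def matrix_inv_vector_right[OF det_frame_nonzero[OF frame]] flip: matrix_vector_mul_assoc)
  have Bx: "B *v x' = x"
    by (simp add: B_def matrix_inv_vector_left[OF det_frame_nonzero[OF frame]] eq[symmetric]
        flip: matrix_vector_mul_assoc)
  have detB: "(det B)\<^sup>2 = 1"
    unfolding B_def using frame normal'
    by (intro det_frame_change_squared) (auto simp: normal_coordinates_def)
  define U where "U = ball 0 \<delta>' \<inter> (*v) B -` exp_domain"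
  have U: "open U" "x' \<in> U"
    unfolding U_def using x' x
    by (auto intro!: open_Int open_vimage open_exp_domain linear_continuous_on
        matrix_vector_mult.bounded_linear_right simp: Bx)
  have "metric_in M ?n x' = pullback_metric (metric M c) (transition ?n c) x'"
    using metric_in_eq_pullback[of ?n c "exp_map M p (L' *v x')"] normal' chart(1) x
        exp_in_normal_chart[OF normal' x']
    by (simp add: normal_chart_exp[OF normal' x'] normal_coordinates_def exp_domain_def eq)
  also have "\<dots> = pullback_metric (metric M c) (\<lambda>y. exp_in_chart (B *v y)) x'"
    by (rule pullback_metric_cong[OF U])
      (simp add: U_def transition_normal_chart[OF normal'] exp_in_chart_def LB)
  also have "\<dots> = transpose B ** pullback_metric (metric M c) exp_in_chart x ** B"
    using pullback_metric_compose[of "(*v) B" x' exp_in_chart] exp_in_chart_differentiable[OF x]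
    by (simp add: Bx jacobian_matrix_vector_mult bounded_linear_imp_differentiable
        matrix_vector_mult.bounded_linear_right)
  finally have "det (metric_in M ?n x') = det (pullback_metric (metric M c) exp_in_chart x)"
    using detB by (simp add: det_mul power2_eq_square mult_ac)
  then show ?thesis by (simp add: \<rho> norm_at_frame[OF frame])
qed

lemma eventually_exponential_coordinates:
  "\<forall>\<^sub>F r in at_right 0. exponential_coordinates (chart_im c) (metric M c) exp_in_chart r
      \<and> ball 0 r \<subseteq> exp_domain"
proof -
  interpret coordinate_metric "chart_im c" "metric M c" by (rule coordinate_metric_chart[OF chart(1)])
  let ?R = "{x \<in> exp_domain. det (jacobian exp_in_chart x) \<noteq> 0}"
  have "smooth_on exp_domain (\<lambda>x. det (jacobian exp_in_chart x))"
    by (intro smooth_intros smooth_on_jacobian open_exp_domain smooth_exp_in_chart)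
  then have "open ((\<lambda>x. det (jacobian exp_in_chart x)) -` (- {0}) \<inter> exp_domain)"
    using smooth_on_continuous_on continuous_on_open_vimage[OF open_exp_domain] by blast
  moreover have "(\<lambda>x. det (jacobian exp_in_chart x)) -` (- {0}) \<inter> exp_domain = ?R" by auto
  moreover have "0 \<in> ?R"
    using arg_cong[OF pullback_metric_origin, of det] origin_in_exp_domain
    by (auto simp: pullback_metric_def det_mul)
  ultimately obtain r0 where r0: "0 < r0" "ball 0 r0 \<subseteq> ?R" using openE by metis
  have "exponential_coordinates (chart_im c) (metric M c) exp_in_chart r \<and> ball 0 r \<subseteq> exp_domain"
    if "0 < r" "r < r0" for r
  proof -
    have ball: "x \<in> ?R" if "x \<in> ball 0 r" for x
      using that \<open>r < r0\<close> r0(2) by (auto simp: subset_iff)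
    then have "ball 0 r \<subseteq> exp_domain" by auto
    moreover have "exponential_coordinates (chart_im c) (metric M c) exp_in_chart r"
      using ball smooth_on_subset[OF smooth_exp_in_chart \<open>ball 0 r \<subseteq> exp_domain\<close>] \<open>0 < r\<close>
      by unfold_locales
        (auto simp: exp_in_chart_im exp_in_chart_geodesic pullback_metric_origin simp del: mem_ball)
    ultimately show ?thesis by simp
  qed
  then show ?thesis unfolding eventually_at_right_field using r0(1) by blast
qed

end

subsection \<open>Harmonic spaces with a model density\<close>

context smooth_riemannian_manifold
begin

lemma harmonic_normal_coordinates:
  assumes p: "p \<in> topspace (space_top M)" and harmonic: "harmonic_with_density M f"
  obtains L \<delta> where "normal_coordinates M p L \<delta>" "0 < \<delta>"
proof -
  let ?d = "chart_at M p"
  interpret coordinate_metric "chart_im ?d" "metric M ?d"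
    by (rule coordinate_metric_chart[OF chart_at_atlas[OF p]])
  obtain r where "0 < r"
    and density: "\<And>\<xi>. 0 < norm_at M p \<xi> \<Longrightarrow> norm_at M p \<xi> < r \<Longrightarrow> has_density M p \<xi> (f (norm_at M p \<xi>))"
    using harmonic p unfolding harmonic_with_density_def by blast
  obtain v :: "real^'n" where "v \<noteq> 0" by (metis axis_eq_0_iff zero_neq_one)
  moreover have "chart_map ?d p \<in> chart_im ?d"
    using chart_at_dom[OF p] by (simp add: chart_im_def)
  ultimately have v: "norm_at M p v > 0"
    using positive_metric by (simp add: norm_at_def inner_at_def)
  define \<xi> where "\<xi> = (r / (2 * norm_at M p v)) *\<^sub>R v"
  have "inner_at M p (s *\<^sub>R v) (s *\<^sub>R v) = s\<^sup>2 * inner_at M p v v" for s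
    by (simp add: inner_at_def matrix_vector_mult.scaleR_right power2_eq_square)
  then have "norm_at M p \<xi> = r / 2"
    using v \<open>0 < r\<close> by (simp add: \<xi>_def norm_at_def real_sqrt_mult)
  then obtain L \<delta> and x :: "real^'n" where "normal_coordinates M p L \<delta>" "x \<in> ball 0 \<delta>"
    using density[of \<xi>] \<open>0 < r\<close> unfolding has_density_def by auto
  moreover from this(2) have "0 < \<delta>" by (metis ball_eq_empty emptyE not_le)
  ultimately show thesis using that by blast
qed

end

locale harmonic_model_manifold = smooth_riemannian_manifold M
  for M :: "('a, 'n::finite) riemannian" +
  fixes \<epsilon> k :: int and N :: nat
  assumes sign: "\<epsilon> \<in> {1, -1}" and harmonic: "harmonic_with_density M (model_density \<epsilon> (int N + 1) k)"
begin

lemma model_exponential_coordinates_exist: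
  assumes c: "c \<in> atlas M" and x: "x \<in> chart_im c"
  obtains E \<delta> where "model_exponential_coordinates (chart_im c) (metric M c) E \<delta> \<epsilon> k N" "E 0 = x"
proof -
  from x obtain p where p: "p \<in> chart_dom c" and "x = chart_map c p" by (auto simp: chart_im_def)
  have p_space: "p \<in> topspace (space_top M)" by (rule chart_dom_subset[OF c p])
  obtain r where "0 < r" and density: "\<And>\<xi>. 0 < norm_at M p \<xi> \<Longrightarrow> norm_at M p \<xi> < r \<Longrightarrow>
      has_density M p \<xi> (model_density \<epsilon> (int N + 1) k (norm_at M p \<xi>))"
    using harmonic p_space unfolding harmonic_with_density_def by blast
  obtain L \<delta> where "normal_coordinates M p L \<delta>" "0 < \<delta>"
    using harmonic_normal_coordinates[OF p_space harmonic] by blast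
  then interpret normal_coordinates_in_chart M p c L \<delta>
    by unfold_locales (use c p p_space in auto)
  have "\<forall>\<^sub>F s in at_right 0. s < r" using \<open>0 < r\<close> by (simp add: eventually_at_right_field) blast
  with eventually_exponential_coordinates
  have "\<forall>\<^sub>F s in at_right 0. (exponential_coordinates (chart_im c) (metric M c) exp_in_chart s \<and>
      ball 0 s \<subseteq> exp_domain) \<and> s < r"
    by (rule eventually_conj)
  then obtain s where s: "exponential_coordinates (chart_im c) (metric M c) exp_in_chart s"
    "ball 0 s \<subseteq> exp_domain" "s < r"
    using eventually_happens'[OF trivial_limit_at_right_real] by blast
  have "norm y ^ (CARD('n) - 1) * sqrt (det (pullback_metric (metric M c) exp_in_chart y)) =
      model_density \<epsilon> (int N + 1) k (norm y)" if "0 < norm y" "norm y < s" for y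
    using density[of "L *v y"] density_in_chart[of y] norm_at_frame[OF frame, of y] that s(2,3) by auto
  with s(1) sign have "model_exponential_coordinates (chart_im c) (metric M c) exp_in_chart s \<epsilon> k N"
    by (simp add: model_exponential_coordinates_def model_exponential_coordinates_axioms_def)
  then show thesis using that exp_in_chart_origin \<open>x = chart_map c p\<close> by simp
qed

lemma dimension:
  assumes "c \<in> atlas M" "x \<in> chart_im c"
  shows "CARD('n) - 1 = N"
proof -
  obtain E \<delta> where "model_exponential_coordinates (chart_im c) (metric M c) E \<delta> \<epsilon> k N"
    using model_exponential_coordinates_exist[OF assms] by blast
  then interpret model_exponential_coordinates "chart_im c" "metric M c" E \<delta> \<epsilon> k N .
  show ?thesis by (rule dimension_eq)
qed

lemma trace_jacobi_matrix:
  assumes "c \<in> atlas M" "x \<in> chart_im c" "v \<bullet> (metric M c x *v v) = 1"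
  shows "trace (jacobi_matrix (metric M c) x v) = of_int \<epsilon> * (real N + 3 * of_int k)"
proof -
  obtain E \<delta> where "model_exponential_coordinates (chart_im c) (metric M c) E \<delta> \<epsilon> k N" and "E 0 = x"
    using model_exponential_coordinates_exist[OF assms(1,2)] .
  then interpret model_exponential_coordinates "chart_im c" "metric M c" E \<delta> \<epsilon> k N by simp
  obtain u where "norm u = 1" "curvature u 0 = jacobi_matrix (metric M c) x v"
    using curvature_unit_velocity[of v] assms(3) \<open>E 0 = x\<close> by metis
  then show ?thesis using trace_curvature by metis
qed

lemma trace_jacobi_matrix_squared:
  assumes "c \<in> atlas M" "x \<in> chart_im c" "v \<bullet> (metric M c x *v v) = 1"
  shows "trace (jacobi_matrix (metric M c) x v ** jacobi_matrix (metric M c) x v) = real N + 15 * of_int k"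
proof -
  obtain E \<delta> where "model_exponential_coordinates (chart_im c) (metric M c) E \<delta> \<epsilon> k N" and "E 0 = x"
    using model_exponential_coordinates_exist[OF assms(1,2)] .
  then interpret model_exponential_coordinates "chart_im c" "metric M c" E \<delta> \<epsilon> k N by simp
  obtain u where u: "norm u = 1" "curvature u 0 = jacobi_matrix (metric M c) x v"
    using curvature_unit_velocity[of v] assms(3) \<open>E 0 = x\<close> by metis
  have "trace (curvature u (t *\<^sub>R u)) = of_int \<epsilon> * (real N + 3 * of_int k)" if "0 < t" "t < \<delta>" for t
  proof -
    note ball = ray_in_ball[OF u(1) that]
    have "\<partial> u E (t *\<^sub>R u) \<bullet> (metric M c (E (t *\<^sub>R u)) *v \<partial> u E (t *\<^sub>R u)) = 1"
      using radial_isometry[OF ball] u(1) by (simp add: pullback_metric_inner J_mult[OF ball] norm_eq_1)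
    then show ?thesis
      unfolding curvature_def by (rule trace_jacobi_matrix[OF assms(1) exp_in_domain[OF ball]])
  qed
  from trace_curvature_squared[OF u(1) this] show ?thesis by (simp add: u(2))
qed

end


subsection \<open>The eigenvalue bound\<close>

lemma eigenvalue_bound_of_traces:
  fixes N k s \<mu> :: real
  assumes s: "s\<^sup>2 = 1" and N: "N > 1"
    and traces: "(s * (N + 3 * k) - \<mu>)\<^sup>2 \<le> (N + 15 * k - \<mu>\<^sup>2) * (N - 1)"
  shows "\<bar>s * \<mu> - (N + 3 * k) / N\<bar> \<le> 3 * (N - 1) / N * sqrt (k * (N - k) / (N - 1))"
proof -
  define l where "l = s * \<mu>"
  have "l\<^sup>2 = \<mu>\<^sup>2" using s by (simp add: l_def power_mult_distrib)
  moreover have "s * (N + 3 * k) - \<mu> = s * (N + 3 * k - l)"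
    using s by (simp add: l_def algebra_simps power2_eq_square)
  then have "(s * (N + 3 * k) - \<mu>)\<^sup>2 = (N + 3 * k - l)\<^sup>2"
    using s by (simp add: power_mult_distrib)
  ultimately have "N * (N + 3 * k - l)\<^sup>2 \<le> N * ((N + 15 * k - l\<^sup>2) * (N - 1))"
    using traces N by simp
  then have "(N * l - (N + 3 * k))\<^sup>2 \<le> 9 * (N - 1) * (k * (N - k))"
    by (simp add: power2_eq_square algebra_simps)
  also have "\<dots> = (3 * (N - 1))\<^sup>2 * (k * (N - k) / (N - 1))"
  proof -
    have cancel: "9 * d * a = (3 * d)\<^sup>2 * (a / d)" if "d \<noteq> 0" for d a :: real
      using that by (simp add: power2_eq_square)
    show ?thesis by (rule cancel) (use N in simp)
  qed
  finally have "sqrt ((N * l - (N + 3 * k))\<^sup>2) \<le> sqrt ((3 * (N - 1))\<^sup>2 * (k * (N - k) / (N - 1)))"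
    by (rule real_sqrt_le_mono)
  then have "\<bar>N * l - (N + 3 * k)\<bar> \<le> 3 * (N - 1) * sqrt (k * (N - k) / (N - 1))"
    unfolding real_sqrt_mult real_sqrt_abs using N by simp
  then have "\<bar>N * l - (N + 3 * k)\<bar> / N \<le> 3 * (N - 1) * sqrt (k * (N - k) / (N - 1)) / N"
    using N by (intro divide_right_mono) auto
  moreover have "l - (N + 3 * k) / N = (N * l - (N + 3 * k)) / N"
    using N by (simp add: diff_divide_distrib)
  ultimately show ?thesis using N by (simp add: l_def abs_divide)
qed

lemma (in harmonic_model_manifold) reduced_jacobi_eigenvalue_traces:
  assumes p: "p \<in> topspace (space_top M)" and unit: "norm_at M p \<xi> = 1"
    and eigenvalue: "reduced_jacobi_eigenvalue M p \<xi> \<mu>"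
  shows "(of_int \<epsilon> * (real N + 3 * of_int k) - \<mu>)\<^sup>2 \<le>
    (real N + 15 * of_int k - \<mu>\<^sup>2) * (real CARD('n) - 2)"
proof -
  let ?c = "chart_at M p"
  let ?x = "chart_map ?c p"
  let ?R = "jacobi_matrix (metric M ?c) ?x \<xi>"
  have c: "?c \<in> atlas M" and x: "?x \<in> chart_im ?c"
    using chart_at_atlas[OF p] chart_at_dom[OF p] by (auto simp: chart_im_def)
  interpret coordinate_metric "chart_im ?c" "metric M ?c" by (rule coordinate_metric_chart[OF c])
  have \<xi>: "\<xi> \<bullet> (metric M ?c ?x *v \<xi>) = 1"
    using unit by (simp add: norm_at_def inner_at_def)
  obtain \<eta> where "\<eta> \<noteq> 0" "inner_at M p \<xi> \<eta> = 0" "jacobi_op M p \<xi> \<eta> = \<mu> *\<^sub>R \<eta>"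
    using eigenvalue unfolding reduced_jacobi_eigenvalue_def by blast
  then have \<eta>: "\<eta> \<noteq> 0" "?R *v \<eta> = \<mu> *\<^sub>R \<eta>" "\<xi> \<bullet> (metric M ?c ?x *v \<eta>) = 0"
    by (simp_all add: inner_at_def jacobi_op_def curvature_at_def jacobi_matrix_mult[OF x] jacobi_at_def)
  obtain L \<delta> where "normal_coordinates M p L \<delta>"
    using harmonic_normal_coordinates[OF p harmonic] by blast
  then have "transpose L ** metric M ?c ?x ** L = mat 1"
    by (intro orthonormal_frame_congruence) (simp add: normal_coordinates_def)
  then have "(trace ?R - \<mu>)\<^sup>2 \<le> (trace (?R ** ?R) - \<mu>\<^sup>2) * (real CARD('n) - 2)"
  proof (rule self_adjoint_eigenvalue_trace_inequality[OF _ _ \<xi> _ \<eta>])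
    show "a \<bullet> (metric M ?c ?x *v (?R *v b)) = b \<bullet> (metric M ?c ?x *v (?R *v a))" for a b
      using jacobi_at_self_adjoint[OF x, of \<xi> b a] by (simp add: jacobi_matrix_mult[OF x] inner_commute)
    show "?R *v \<xi> = 0" by (simp add: jacobi_matrix_mult[OF x] jacobi_at_self[OF x])
  qed
  then show ?thesis
    by (simp add: trace_jacobi_matrix[OF c x \<xi>] trace_jacobi_matrix_squared[OF c x \<xi>])
qed

theorem theorem1p9:
  fixes M :: "('a, 'n::finite) riemannian"
    and \<epsilon> m k :: int and p :: 'a and \<xi> :: "real^'n" and \<mu> :: real
  assumes "\<epsilon> \<in> {1, -1}"
    and "m > 2"
    and "riemannian_manifold M"
    and "harmonic_with_density M (model_density \<epsilon> m k)"
    and "p \<in> topspace (space_top M)"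
    and "norm_at M p \<xi> = 1"
    and "reduced_jacobi_eigenvalue M p \<xi> \<mu>"
  shows "(of_int m + 3 * of_int k - 1) / (of_int m - 1) - error_term m k \<le> of_int \<epsilon> * \<mu> \<and>
         of_int \<epsilon> * \<mu> \<le> (of_int m + 3 * of_int k - 1) / (of_int m - 1) + error_term m k"
proof -
  define N where "N = nat (m - 1)"
  have m: "m = int N + 1" and N: "1 < N" using assms(2) by (auto simp: N_def)
  interpret harmonic_model_manifold M \<epsilon> k N
    using assms(1,3,4) by unfold_locales (simp_all add: m)
  have "CARD('n) - 1 = N"
    using dimension chart_at_atlas[OF assms(5)] chart_at_dom[OF assms(5)] unfolding chart_im_def by blast
  then have "real CARD('n) - 2 = real N - 1" using N by simp
  then have "(of_int \<epsilon> * (real N + 3 * of_int k) - \<mu>)\<^sup>2 \<le>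
      (real N + 15 * of_int k - \<mu>\<^sup>2) * (real N - 1)"
    using reduced_jacobi_eigenvalue_traces[OF assms(5-7)] by simp
  then have "\<bar>of_int \<epsilon> * \<mu> - (real N + 3 * of_int k) / real N\<bar> \<le>
      3 * (real N - 1) / real N * sqrt (of_int k * (real N - of_int k) / (real N - 1))"
    using sign N by (intro eigenvalue_bound_of_traces) auto
  also have "\<dots> = error_term m k"
    by (simp add: error_term_def m algebra_simps)
  finally show ?thesis by (simp add: m abs_le_iff algebra_simps)
qed

end
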